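(* There exists a unique collection of constants $\{c^a_{\bar\lambda}\}$ from $\mathbb C(s_1,s_2,x_1,\ldots,x_r)$ with $c^a_{\bar\emptyset}=1$ such that the map $$[\bar\lambda]=[(\lambda^1,\ldots,\lambda^r)]\mapsto c^a_{\bar\lambda}\cdot|\lambda^1\rangle\otimes\cdots\otimes|\lambda^r\rangle$$ induces an isomorphism $V^r\to{}^aF(-x_1)\otimes\cdots\otimes{}^aF(-x_r)$ of $\ddot Y_{h_1,h_2,h_3}(\mathfrak{gl}_1)$-representations with $h_i=s_i$.
   Context: (1) Algebra. For $h_1+h_2+h_3=0$, $\sigma_2=h_1h_2+h_1h_3+h_2h_3$, $\sigma_3=h_1h_2h_3$, $\ddot Y_{h_1,h_2,h_3}(\mathfrak{gl}_1)$ is the unital associative algebra generated by $e_j,f_j,\psi_j$ ($j\in\mathbb Z_+=\{0,1,\dots\}$) with relations ($\{a,b\}=ab+ba$; $\mathrm{Sym}_{\mathfrak S_3}$ = sum over permutations of $i_1,i_2,i_3$): - $[\psi_i,\psi_j]=0$, $[e_i,f_j]=\psi_{i+j}$; - $[e_{i+3},e_j]-3[e_{i+2},e_{j+1}]+3[e_{i+1},e_{j+2}]-[e_i,e_{j+3}]+\sigma_2([e_{i+1},e_j]-[e_i,e_{j+1}])=\sigma_3\{e_i,e_j\}$; - $[f_{i+3},f_j]-3[f_{i+2},f_{j+1}]+3[f_{i+1},f_{j+2}]-[f_i,f_{j+3}]+\sigma_2([f_{i+1},f_j]-[f_i,f_{j+1}])=-\sigma_3\{f_i,f_j\}$; - $[\psi_{i+3},e_j]-3[\psi_{i+2},e_{j+1}]+3[\psi_{i+1},e_{j+2}]-[\psi_i,e_{j+3}]+\sigma_2([\psi_{i+1},e_j]-[\psi_i,e_{j+1}])=\sigma_3\{\psi_i,e_j\}$;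 - $[\psi_{i+3},f_j]-3[\psi_{i+2},f_{j+1}]+3[\psi_{i+1},f_{j+2}]-[\psi_i,f_{j+3}]+\sigma_2([\psi_{i+1},f_j]-[\psi_i,f_{j+1}])=-\sigma_3\{\psi_i,f_j\}$; - $[\psi_0,e_j]=[\psi_1,e_j]=0$, $[\psi_2,e_j]=2e_j$; $[\psi_0,f_j]=[\psi_1,f_j]=0$, $[\psi_2,f_j]=-2f_j$; - $\mathrm{Sym}_{\mathfrak S_3}[e_{i_1},[e_{i_2},e_{i_3+1}]]=0$, $\mathrm{Sym}_{\mathfrak S_3}[f_{i_1},[f_{i_2},f_{i_3+1}]]=0$. Generating series: $e(z)=\sum_{j\ge0}e_jz^{-j-1}$, $f(z)=\sum_{j\ge0}f_jz^{-j-1}$, $\psi(z)=1+\sigma_3\sum_{j\ge0}\psi_jz^{-j-1}$. The base field is $\mathbb C(s_1,s_2,x_1,\dots,x_r)$, $s_3=-s_1-s_2$, $h_i=s_i$. $(\cdot)^+$ denotes expansion in $z^{-1}$; $\delta^+(w)=\sum_{n\ge0}w^n$. (2) The representation $V^r$. $M(r,n)$ is the Gieseker moduli space of framed torsion-free sheaves on $\mathbb P^2$ of rank $r$ with $c_2=n$, equivalently $M(r,n)=\{(B_1,B_2,i,j)\mid[B_1,B_2]+ij=0\}^s/GL_n(\mathbb C)$ with $B_1,B_2\in\mathrm{End}(\mathbb C^n)$, $i\in\mathrm{Hom}(\mathbb C^r,\mathbb C^n)$, $j\in\mathrm{Hom}(\mathbb C^n,\mathbb C^r)$, stable: no proper subspace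 of $\mathbb C^n$ containing $\mathrm{Im}(i)$ is $B_1,B_2$-invariant. $\mathfrak F_r$ is the tautological rank $n$ bundle. $\mathbb T_r=(\mathbb C^* )^2\times(\mathbb C^* )^r$ acts via the action on $\mathbb P^2$ and by rescaling the framing, with $H^\bullet_{\mathbb T_r}(pt)=\mathbb C[s_1,s_2,x_1,\dots,x_r]$; its fixed points are labeled by $r$-tuples of Young diagrams $\bar\lambda=(\lambda^1,\dots,\lambda^r)$, $|\bar\lambda|=n$. The Hecke correspondence $M(r;n,n+1)$ parametrizes a point of $M(r,n+1)$ together with a line $S\subset\mathrm{Ker}\,j\subset\mathbb C^{n+1}$ invariant under $B_1,B_2$; $L_r$ is its tautological line bundle (fiber $S$), $\mathbf p_r,\mathbf q_r$ its projections to $M(r,n)$ and $M(r,n+1)$. $V^r=\bigoplus_nH^\bullet_{\mathbb T_r}(M(r,n))\otimes_{H^\bullet_{\mathbb T_r}(pt)}\mathrm{Frac}(H^\bullet_{\mathbb T_r}(pt))$, with basis $[\bar\lambda]$, the direct images of the fundamental cycles of the fixed points. The action is $e_j=\mathbf q_{r*}(c_1(L_r)^j\cdot\mathbf p_r^* )$, $f_j=(-1)^{r-1}\mathbf p_{r*}(c_1(L_r)^j\cdot\mathbf q_r^* )$, $\psi(z)=\big(\prod_{a=1}^r\frac{z+x_a-s_3}{z+x_a}\big)^+\mathbf C_r(z)$ with $\mathbf C_r(z)=\Big(\prod_{k=1}^3\frac{\mathrm{ch}(\mathfrak F_rt_k^{-1},-z^{-1})}{\mathrm{ch}(\mathfrak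 F_rt_k,-z^{-1})}\Big)^+$, where $\mathrm{ch}(F,\cdot)$ is the Chern polynomial. Conventions are such that explicitly, with $x^{(a)}_k:=(\lambda^a_k-1)s_1+(k-1)s_2-x_a$ and $\square^l_j$ the box added/removed in row $j$ of $\lambda^l$, the coefficient of $[\bar\lambda]$ in $e_p[\bar\lambda-\square^l_j]$ is $\frac{(x^{(l)}_j)^p}{s_1+s_2}\prod_{a=1}^r\prod_{k=1}^\infty\frac{s_1+s_2+x^{(a)}_k-x^{(l)}_j}{s_1+x^{(a)}_k-x^{(l)}_j}$; the coefficient of $[\bar\lambda]$ in $f_p[\bar\lambda+\square^l_j]$ is $(-1)^{r-1}\frac{(s_1+x^{(l)}_j)^p}{s_1+s_2}\prod_{a=1}^r\prod_{k=1}^\infty\frac{s_1+s_2+x^{(l)}_j-x^{(a)}_k}{s_1+x^{(l)}_j-x^{(a)}_k}$; all other matrix coefficients of $e_p,f_p$ vanish. The infinite products are taken after telescoping: if $\lambda^a_k=0$ for $k>L$, the tail $\prod_{k>L}$ equals $1/(s_1+x^{(a)}_{L+1}-x^{(l)}_j)$ in the first formula and $s_1+s_2+x^{(l)}_j-x^{(a)}_{L+1}$ in the second ($L\ge j$). The eigenvalue of $\psi(z)$ on $[\bar\lambda]$ is $\Big(\prod_{a=1}^r\frac{z+x_a-s_3}{z+x_a}\prod_{a=1}^r\prod_{\square\in\lambda^a}\prod_{k=1}^3\frac{z-\chi(\square)+s_k}{z-\chi(\square)-s_k}\Big)^+$, where the box in row $j$, column $i$ of $\lambda^a$ has $\chi(\square)=(i-1)s_1+(j-1)s_2-x_a$.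 (3) Fock module ${}^aF(u)$: basis $|\lambda\rangle$ over Young diagrams, $\lambda\pm i$ = add/remove a box in row $i$, $$e(z)|\lambda\rangle=\frac1{h_1z}\sum_{i\ge1}\prod_{j=1}^{i-1}\frac{((\lambda_i-\lambda_j)h_1+(i-j-1)h_2)((\lambda_i-\lambda_j+1)h_1+(i-j+1)h_2)}{((\lambda_i-\lambda_j)h_1+(i-j)h_2)((\lambda_i-\lambda_j+1)h_1+(i-j)h_2)}\delta^+\Big(\frac{\lambda_ih_1+(i-1)h_2+u}{z}\Big)|\lambda+i\rangle,$$ $$f(z)|\lambda\rangle=-\frac1{h_1z}\sum_{i\ge1}\frac{(\lambda_{i+1}-\lambda_i)h_1}{(\lambda_{i+1}-\lambda_i+1)h_1+h_2}\prod_{j=i+1}^\infty\frac{((\lambda_j-\lambda_i+1)h_1+(j-i+1)h_2)((\lambda_{j+1}-\lambda_i)h_1+(j-i)h_2)}{((\lambda_{j+1}-\lambda_i+1)h_1+(j-i+1)h_2)((\lambda_j-\lambda_i)h_1+(j-i)h_2)}\delta^+\Big(\frac{(\lambda_i-1)h_1+(i-1)h_2+u}{z}\Big)|\lambda-i\rangle,$$ $$\psi(z)|\lambda\rangle=\gamma_{\lambda,u}(z)^+|\lambda\rangle,\quad\gamma_{\lambda,u}(z)=\frac{z-((\lambda_1-1)h_1-h_2+u)}{z-(\lambda_1h_1+u)}\prod_{i\ge1}\frac{(z-(\lambda_ih_1+ih_2+u))(z-((\lambda_{i+1}-1)h_1+(i-1)h_2+u))}{(z-(\lambda_{i+1}h_1+ih_2+u))(z-((\lambda_i-1)h_1+(i-1)h_2+u))}.$$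 (4) Tensor product ${}^aF(u_1)\otimes\cdots\otimes{}^aF(u_r)$: $\psi(z)$ acts as $\psi(z)\otimes\cdots\otimes\psi(z)$; $e(z)$ acts on $|\lambda^1\rangle\otimes\cdots\otimes|\lambda^r\rangle$ as the sum over $k$ of $e(z)$ acting on the $k$-th factor with each term containing $\delta^+(\chi/z)$ multiplied by $\prod_{l<k}\gamma_{\lambda^l,u_l}(\chi)$, and $f(z)$ as the sum over $k$ of $f(z)$ acting on the $k$-th factor with each such term multiplied by $\prod_{l>k}\gamma_{\lambda^l,u_l}(\chi)$. *)

theory Defs
  imports
    Complex_Main
    "HOL-Library.Poly_Mapping"
    "HOL-Combinatorics.Permutations"
    "HOL-Computational_Algebra.Computational_Algebra"
begin

section \<open>The base field\<close>

text \<open>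
  The rank is the cardinality of the index type \<open>'r::{finite,linorder}\<close>; the order is the order of
  the factors of the tensor product. The linear order on the indeterminates plays no
  mathematical role; the library needs one for the polynomial ring to be an integral domain.
\<close>

datatype 'r indet = S1 | S2 | X 'r

instantiation indet :: (linorder) linorder
begin

fun less_eq_indet :: "'a indet \<Rightarrow> 'a indet \<Rightarrow> bool" where
  "less_eq_indet S1 b \<longleftrightarrow> True"
| "less_eq_indet S2 b \<longleftrightarrow> b \<noteq> S1"
| "less_eq_indet (X a) b \<longleftrightarrow> (case b of X a' \<Rightarrow> a \<le> a' | _ \<Rightarrow> False)"

definition less_indet :: "'a indet \<Rightarrow> 'a indet \<Rightarrow> bool" where
  "less_indet a b \<longleftrightarrow> a \<le> b \<and> \<not> b \<le> a"

instance
proof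
  fix a b c :: "'a indet"
  show "a < b \<longleftrightarrow> a \<le> b \<and> \<not> b \<le> a" by (rule less_indet_def)
  show "a \<le> a" by (cases a) auto
  show "a \<le> b \<Longrightarrow> b \<le> c \<Longrightarrow> a \<le> c" by (cases a; cases b; cases c) auto
  show "a \<le> b \<Longrightarrow> b \<le> a \<Longrightarrow> a = b" by (cases a; cases b) auto
  show "a \<le> b \<or> b \<le> a" by (cases a; cases b) auto
qed

end

type_synonym 'r ratfun = "(('r indet \<Rightarrow>\<^sub>0 nat) \<Rightarrow>\<^sub>0 complex) fract"

definition indeterminate :: "'r indet \<Rightarrow> 'r::linorder ratfun" where
  "indeterminate v = Fract (Poly_Mapping.single (Poly_Mapping.single v 1) 1) 1"

abbreviation s1 :: "'r::linorder ratfun" where "s1 \<equiv> indeterminate S1"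
abbreviation s2 :: "'r::linorder ratfun" where "s2 \<equiv> indeterminate S2"
abbreviation s3 :: "'r::linorder ratfun" where "s3 \<equiv> - s1 - s2"
abbreviation xvar :: "'r \<Rightarrow> 'r::linorder ratfun" where "xvar a \<equiv> indeterminate (X a)"

section \<open>The affine Yangian of \<open>gl\<^sub>1\<close>\<close>

datatype 'a free_monoid = Word (letters: "'a list")

instantiation free_monoid :: (type) monoid_add
begin

definition zero_free_monoid :: "'a free_monoid" where "0 = Word []"
definition plus_free_monoid :: "'a free_monoid \<Rightarrow> 'a free_monoid \<Rightarrow> 'a free_monoid" where
  "u + v = Word (letters u @ letters v)"

instance by standard (auto simp: zero_free_monoid_def plus_free_monoid_def)

end

datatype ygen = GenE nat | GenF nat | GenPsi nat

text \<open>
  The free unital associative algebra on a set is the monoid algebra of the free monoid on it;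
  the multiplication is the convolution product of the library.
\<close>

type_synonym 'k ygen_free_alg = "ygen free_monoid \<Rightarrow>\<^sub>0 'k"

definition free_gen :: "ygen \<Rightarrow> 'k::field ygen_free_alg" where
  "free_gen g = Poly_Mapping.single (Word [g]) 1"

definition free_scalar :: "'k::field \<Rightarrow> 'k ygen_free_alg" where
  "free_scalar c = Poly_Mapping.single 0 c"

definition commutator :: "'a::ring \<Rightarrow> 'a \<Rightarrow> 'a" where "commutator a b = a * b - b * a"
definition anticommutator :: "'a::ring \<Rightarrow> 'a \<Rightarrow> 'a" where "anticommutator a b = a * b + b * a"

definition sigma2 :: "'k::field \<Rightarrow> 'k \<Rightarrow> 'k \<Rightarrow> 'k" where
  "sigma2 h1 h2 h3 = h1 * h2 + h1 * h3 + h2 * h3"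
definition sigma3 :: "'k::field \<Rightarrow> 'k \<Rightarrow> 'k \<Rightarrow> 'k" where
  "sigma3 h1 h2 h3 = h1 * h2 * h3"

definition cubic_lhs ::
  "'k::field \<Rightarrow> (nat \<Rightarrow> 'k ygen_free_alg) \<Rightarrow> (nat \<Rightarrow> 'k ygen_free_alg) \<Rightarrow> nat \<Rightarrow> nat \<Rightarrow> 'k ygen_free_alg"
where
  "cubic_lhs \<sigma>2 a b i j =
     commutator (a (i + 3)) (b j) - 3 * commutator (a (i + 2)) (b (j + 1))
     + 3 * commutator (a (i + 1)) (b (j + 2)) - commutator (a i) (b (j + 3))
     + free_scalar \<sigma>2 * (commutator (a (i + 1)) (b j) - commutator (a i) (b (j + 1)))"

definition serre_lhs :: "(nat \<Rightarrow> 'k::field ygen_free_alg) \<Rightarrow> (nat \<Rightarrow> nat) \<Rightarrow> 'k ygen_free_alg" where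
  "serre_lhs a i =
     (\<Sum>\<pi> | \<pi> permutes {1, 2, 3}.
        commutator (a (i (\<pi> 1))) (commutator (a (i (\<pi> 2))) (a (i (\<pi> 3) + 1))))"

abbreviation gen_e :: "nat \<Rightarrow> 'k::field ygen_free_alg" where "gen_e j \<equiv> free_gen (GenE j)"
abbreviation gen_f :: "nat \<Rightarrow> 'k::field ygen_free_alg" where "gen_f j \<equiv> free_gen (GenF j)"
abbreviation gen_psi :: "nat \<Rightarrow> 'k::field ygen_free_alg" where "gen_psi j \<equiv> free_gen (GenPsi j)"

text \<open>A relation \<open>a = b\<close> is recorded as the element \<open>a - b\<close>.\<close>

inductive_set yangian_relators :: "'k::field \<Rightarrow> 'k \<Rightarrow> 'k \<Rightarrow> 'k ygen_free_alg set"
  for h1 h2 h3 :: 'k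
where
  psi_psi: "commutator (gen_psi i) (gen_psi j) \<in> yangian_relators h1 h2 h3"
| e_f: "commutator (gen_e i) (gen_f j) - gen_psi (i + j) \<in> yangian_relators h1 h2 h3"
| e_e: "cubic_lhs (sigma2 h1 h2 h3) gen_e gen_e i j
    - free_scalar (sigma3 h1 h2 h3) * anticommutator (gen_e i) (gen_e j) \<in> yangian_relators h1 h2 h3"
| f_f: "cubic_lhs (sigma2 h1 h2 h3) gen_f gen_f i j
    + free_scalar (sigma3 h1 h2 h3) * anticommutator (gen_f i) (gen_f j) \<in> yangian_relators h1 h2 h3"
| psi_e: "cubic_lhs (sigma2 h1 h2 h3) gen_psi gen_e i j
    - free_scalar (sigma3 h1 h2 h3) * anticommutator (gen_psi i) (gen_e j) \<in> yangian_relators h1 h2 h3"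
| psi_f: "cubic_lhs (sigma2 h1 h2 h3) gen_psi gen_f i j
    + free_scalar (sigma3 h1 h2 h3) * anticommutator (gen_psi i) (gen_f j) \<in> yangian_relators h1 h2 h3"
| psi0_e: "commutator (gen_psi 0) (gen_e j) \<in> yangian_relators h1 h2 h3"
| psi1_e: "commutator (gen_psi 1) (gen_e j) \<in> yangian_relators h1 h2 h3"
| psi2_e: "commutator (gen_psi 2) (gen_e j) - 2 * gen_e j \<in> yangian_relators h1 h2 h3"
| psi0_f: "commutator (gen_psi 0) (gen_f j) \<in> yangian_relators h1 h2 h3"
| psi1_f: "commutator (gen_psi 1) (gen_f j) \<in> yangian_relators h1 h2 h3"
| psi2_f: "commutator (gen_psi 2) (gen_f j) + 2 * gen_f j \<in> yangian_relators h1 h2 h3"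
| serre_e: "serre_lhs gen_e i \<in> yangian_relators h1 h2 h3"
| serre_f: "serre_lhs gen_f i \<in> yangian_relators h1 h2 h3"

inductive_set two_sided_ideal :: "'a::ring_1 set \<Rightarrow> 'a set" for S :: "'a set"
where
  ideal_zero: "0 \<in> two_sided_ideal S"
| ideal_base: "a \<in> S \<Longrightarrow> a \<in> two_sided_ideal S"
| ideal_add: "a \<in> two_sided_ideal S \<Longrightarrow> b \<in> two_sided_ideal S \<Longrightarrow> a + b \<in> two_sided_ideal S"
| ideal_mult_left: "a \<in> two_sided_ideal S \<Longrightarrow> b * a \<in> two_sided_ideal S"
| ideal_mult_right: "a \<in> two_sided_ideal S \<Longrightarrow> a * b \<in> two_sided_ideal S"

lemma ideal_uminus: "a \<in> two_sided_ideal S \<Longrightarrow> - a \<in> two_sided_ideal S"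
  using ideal_mult_left[of a S "-1"] by simp

lemma ideal_diff:
  "a \<in> two_sided_ideal S \<Longrightarrow> b \<in> two_sided_ideal S \<Longrightarrow> a - b \<in> two_sided_ideal S"
  using ideal_add[OF _ ideal_uminus, of a S b] by simp

definition yangian_cong :: "'r::linorder ratfun ygen_free_alg \<Rightarrow> 'r ratfun ygen_free_alg \<Rightarrow> bool" where
  "yangian_cong a b \<longleftrightarrow> a - b \<in> two_sided_ideal (yangian_relators s1 s2 s3)"

lemma equivp_yangian_cong:
  "equivp (yangian_cong :: 'r::linorder ratfun ygen_free_alg \<Rightarrow> 'r ratfun ygen_free_alg \<Rightarrow> bool)"
  (is "equivp ?R")
proof (rule equivpI)
  show "reflp ?R"
    by (auto intro!: reflpI simp: yangian_cong_def ideal_zero)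
  show "symp ?R"
  proof (rule sympI)
    fix a b :: "'r ratfun ygen_free_alg" assume "yangian_cong a b"
    then show "yangian_cong b a"
      unfolding yangian_cong_def by (metis ideal_uminus minus_diff_eq)
  qed
  show "transp ?R"
  proof (rule transpI)
    fix a b c :: "'r ratfun ygen_free_alg" assume "yangian_cong a b" "yangian_cong b c"
    then show "yangian_cong a c"
      unfolding yangian_cong_def using ideal_add[of "a - b" _ "b - c"] by simp
  qed
qed

text \<open>The algebra for \<open>h\<^sub>i = s\<^sub>i\<close>.\<close>

quotient_type 'r yangian = "'r::linorder ratfun ygen_free_alg" / yangian_cong
  by (rule equivp_yangian_cong)

instantiation yangian :: (linorder) "{ring, monoid_mult}"
begin

lift_definition zero_yangian :: "'a yangian" is 0 .
lift_definition one_yangian :: "'a yangian" is 1 .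

lift_definition plus_yangian :: "'a yangian \<Rightarrow> 'a yangian \<Rightarrow> 'a yangian" is "(+)"
  unfolding yangian_cong_def by (metis add_diff_add ideal_add)

lift_definition minus_yangian :: "'a yangian \<Rightarrow> 'a yangian \<Rightarrow> 'a yangian" is "(-)"
proof -
  fix a b c d :: "'a ratfun ygen_free_alg"
  assume "yangian_cong a b" "yangian_cong c d"
  moreover have "(a - c) - (b - d) = (a - b) - (c - d)" by simp
  ultimately show "yangian_cong (a - c) (b - d)"
    unfolding yangian_cong_def by (metis ideal_diff)
qed

lift_definition uminus_yangian :: "'a yangian \<Rightarrow> 'a yangian" is uminus
proof -
  fix a b :: "'a ratfun ygen_free_alg"
  assume "yangian_cong a b"
  moreover have "- a - - b = - (a - b)" by simp
  ultimately show "yangian_cong (- a) (- b)"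
    unfolding yangian_cong_def by (metis ideal_uminus)
qed

lift_definition times_yangian :: "'a yangian \<Rightarrow> 'a yangian \<Rightarrow> 'a yangian" is "(*)"
proof -
  fix a b c d :: "'a ratfun ygen_free_alg"
  assume "yangian_cong a b" "yangian_cong c d"
  moreover have "a * c - b * d = (a - b) * c + b * (c - d)" by (simp add: algebra_simps)
  ultimately show "yangian_cong (a * c) (b * d)"
    unfolding yangian_cong_def by (metis ideal_add ideal_mult_left ideal_mult_right)
qed

instance
proof
  fix a b c :: "'a yangian"
  have eq: "u = v \<Longrightarrow> yangian_cong u v" for u v :: "'a ratfun ygen_free_alg"
    by (simp add: yangian_cong_def ideal_zero)
  show "a + b + c = a + (b + c)" by transfer (rule eq, simp add: algebra_simps)
  show "a + b = b + a" by transfer (rule eq, simp add: algebra_simps)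
  show "0 + a = a" by transfer (rule eq, simp)
  show "- a + a = 0" by transfer (rule eq, simp)
  show "a - b = a + - b" by transfer (rule eq, simp)
  show "a * b * c = a * (b * c)" by transfer (rule eq, simp add: mult.assoc)
  show "(a + b) * c = a * c + b * c" by transfer (rule eq, simp add: algebra_simps)
  show "a * (b + c) = a * b + a * c" by transfer (rule eq, simp add: algebra_simps)
  show "1 * a = a" by transfer (rule eq, simp)
  show "a * 1 = a" by transfer (rule eq, simp)
qed

end

definition yangian_scale :: "'r::linorder ratfun \<Rightarrow> 'r yangian \<Rightarrow> 'r yangian" where
  "yangian_scale c y = abs_yangian (free_scalar c) * y"

lift_definition yangian_gen :: "ygen \<Rightarrow> 'r::linorder yangian" is free_gen .

section \<open>Representations on spaces with a given basis\<close>

text \<open>The vector space with basis indexed by \<open>'b\<close>; the basis vectors are \<open>ket b\<close>.\<close>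

type_synonym ('b, 'k) based_space = "'b \<Rightarrow>\<^sub>0 'k"

definition ket :: "'b \<Rightarrow> ('b, 'k::field) based_space" where
  "ket b = Poly_Mapping.single b 1"

definition vscale :: "'k::field \<Rightarrow> ('b, 'k) based_space \<Rightarrow> ('b, 'k) based_space" where
  "vscale c v = Poly_Mapping.map ((*) c) v"

lemma lookup_vscale [simp]: "Poly_Mapping.lookup (vscale c v) b = c * Poly_Mapping.lookup v b"
  by (simp add: vscale_def Poly_Mapping.map.rep_eq when_def)

lemma vector_space_vscale: "vector_space (vscale :: 'k::field \<Rightarrow> ('b, 'k) based_space \<Rightarrow> _)"
  by standard (auto intro!: poly_mapping_eqI simp: lookup_add algebra_simps)

definition linear_extension ::
  "('b \<Rightarrow> ('c, 'k::field) based_space) \<Rightarrow> ('b, 'k) based_space \<Rightarrow> ('c, 'k) based_space"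
where
  "linear_extension g v = (\<Sum>b\<in>Poly_Mapping.keys v. vscale (Poly_Mapping.lookup v b) (g b))"

definition yangian_rep ::
  "('r::linorder yangian \<Rightarrow> ('b, 'r ratfun) based_space \<Rightarrow> ('b, 'r ratfun) based_space) \<Rightarrow> bool"
where
  "yangian_rep \<rho> \<longleftrightarrow>
     (\<forall>y. Vector_Spaces.linear vscale vscale (\<rho> y)) \<and>
     (\<forall>y z v. \<rho> (y + z) v = \<rho> y v + \<rho> z v) \<and>
     (\<forall>c y v. \<rho> (yangian_scale c y) v = vscale c (\<rho> y v)) \<and>
     (\<forall>y z v. \<rho> (y * z) v = \<rho> y (\<rho> z v)) \<and>
     (\<forall>v. \<rho> 1 v = v)"

definition yangian_rep_given_by ::
  "(nat \<Rightarrow> ('b, 'r::linorder ratfun) based_space \<Rightarrow> ('b, 'r ratfun) based_space) \<Rightarrow>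
   (nat \<Rightarrow> ('b, 'r ratfun) based_space \<Rightarrow> ('b, 'r ratfun) based_space) \<Rightarrow>
   (nat \<Rightarrow> ('b, 'r ratfun) based_space \<Rightarrow> ('b, 'r ratfun) based_space) \<Rightarrow>
   ('r yangian \<Rightarrow> ('b, 'r ratfun) based_space \<Rightarrow> ('b, 'r ratfun) based_space) \<Rightarrow> bool"
where
  "yangian_rep_given_by e f psi \<rho> \<longleftrightarrow>
     yangian_rep \<rho> \<and>
     (\<forall>j. \<rho> (yangian_gen (GenE j)) = e j \<and>
          \<rho> (yangian_gen (GenF j)) = f j \<and>
          \<rho> (yangian_gen (GenPsi j)) = psi j)"

definition yangian_rep_iso ::
  "('r::linorder yangian \<Rightarrow> ('b, 'r ratfun) based_space \<Rightarrow> ('b, 'r ratfun) based_space) \<Rightarrow>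
   ('r yangian \<Rightarrow> ('c, 'r ratfun) based_space \<Rightarrow> ('c, 'r ratfun) based_space) \<Rightarrow>
   (('b, 'r ratfun) based_space \<Rightarrow> ('c, 'r ratfun) based_space) \<Rightarrow> bool"
where
  "yangian_rep_iso \<rho> \<rho>' \<phi> \<longleftrightarrow>
     yangian_rep \<rho> \<and> yangian_rep \<rho>' \<and>
     Vector_Spaces.linear vscale vscale \<phi> \<and> bij \<phi> \<and>
     (\<forall>y v. \<phi> (\<rho> y v) = \<rho>' y (\<phi> v))"

section \<open>Young diagrams\<close>

text \<open>Rows are numbered from 1; the value at 0 is a dummy.\<close>

typedef young =
  "{\<mu> :: nat \<Rightarrow> nat. \<mu> 0 = 0 \<and> (\<forall>k\<ge>1. \<mu> (k + 1) \<le> \<mu> k) \<and> finite {k. \<mu> k \<noteq> 0}}"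
  morphisms row Abs_young
  by (rule exI[of _ "\<lambda>_. 0"]) simp

definition empty_young :: young where "empty_young = Abs_young (\<lambda>_. 0)"

definition num_rows :: "young \<Rightarrow> nat" where "num_rows \<mu> = card {k. row \<mu> k \<noteq> 0}"

definition addable :: "young \<Rightarrow> nat set" where
  "addable \<mu> = {i. i = 1 \<or> (2 \<le> i \<and> row \<mu> i < row \<mu> (i - 1))}"

definition removable :: "young \<Rightarrow> nat set" where
  "removable \<mu> = {i. 1 \<le> i \<and> row \<mu> (i + 1) < row \<mu> i}"

lemma finite_rows: "finite {k. row \<mu> k \<noteq> 0}"
  using row[of \<mu>] by simp

lemma finite_addable: "finite (addable \<mu>)"
proof (rule finite_subset)
  show "addable \<mu> \<subseteq> insert 1 (Suc ` {k. row \<mu> k \<noteq> 0})"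
  proof
    fix i assume "i \<in> addable \<mu>"
    then show "i \<in> insert 1 (Suc ` {k. row \<mu> k \<noteq> 0})"
      by (cases i) (auto simp: addable_def)
  qed
qed (use finite_rows in simp)

lemma finite_removable: "finite (removable \<mu>)"
  by (rule finite_subset[OF _ finite_rows[of \<mu>]]) (auto simp: removable_def)

text \<open>Meaningful only for \<open>i \<in> addable \<mu>\<close>, respectively \<open>i \<in> removable \<mu>\<close>.\<close>

definition add_box :: "young \<Rightarrow> nat \<Rightarrow> young" where
  "add_box \<mu> i = Abs_young ((row \<mu>)(i := row \<mu> i + 1))"

definition remove_box :: "young \<Rightarrow> nat \<Rightarrow> young" where
  "remove_box \<mu> i = Abs_young ((row \<mu>)(i := row \<mu> i - 1))"

text \<open>Pairs \<open>(i, j)\<close> of a column \<open>i\<close> and a row \<open>j\<close>.\<close>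

definition boxes :: "young \<Rightarrow> (nat \<times> nat) set" where
  "boxes \<mu> = {(i, j). 1 \<le> j \<and> 1 \<le> i \<and> i \<le> row \<mu> j}"

lemma finite_boxes: "finite (boxes \<mu>)"
proof (rule finite_subset)
  show "boxes \<mu> \<subseteq> (\<Union>j\<in>{k. row \<mu> k \<noteq> 0}. {..row \<mu> j} \<times> {j})"
    by (auto simp: boxes_def)
qed (use finite_rows in auto)

abbreviation rowk :: "young \<Rightarrow> nat \<Rightarrow> 'k::field" where
  "rowk \<mu> i \<equiv> of_nat (row \<mu> i)"

section \<open>Expansions in \<open>z\<^sup>-\<^sup>1\<close>\<close>

text \<open>
  Power series in \<open>z\<^sup>-\<^sup>1\<close> are formal power series in \<open>w = z\<^sup>-\<^sup>1\<close>. A polynomial \<open>p\<close> in \<open>z\<close> is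
  \<open>z ^ degree p\<close> times \<open>reflect_poly p\<close> evaluated at \<open>w\<close>, so \<open>expand_inf p q\<close> is the expansion of \<open>p / q\<close>
  provided that \<open>degree p \<le> degree q\<close> and \<open>q \<noteq> 0\<close>.
\<close>

definition expand_inf :: "'k::field poly \<Rightarrow> 'k poly \<Rightarrow> 'k fps" where
  "expand_inf p q =
     fps_X ^ (degree q - degree p) * fps_of_poly (reflect_poly p) / fps_of_poly (reflect_poly q)"

text \<open>The coefficient of \<open>z ^ (-j-1)\<close>.\<close>

definition mode :: "'k::field fps \<Rightarrow> nat \<Rightarrow> 'k" where
  "mode A j = fps_nth A (j + 1)"

text \<open>\<open>delta_plus \<chi>\<close> stands for \<open>\<delta>\<^sup>+(\<chi>/z)\<close>.\<close>

definition delta_plus :: "'k::field \<Rightarrow> 'k fps" where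
  "delta_plus \<chi> = Abs_fps (\<lambda>n. \<chi> ^ n)"

text \<open>The modes \<open>\<psi>\<^sub>j\<close> of a series \<open>1 + \<sigma>\<^sub>3 \<Sum> \<psi>\<^sub>j z ^ (-j-1)\<close>.\<close>

definition psi_mode :: "'k::field \<Rightarrow> 'k fps \<Rightarrow> nat \<Rightarrow> 'k" where
  "psi_mode \<sigma>3 A j = mode A j / \<sigma>3"

section \<open>The representation \<open>V\<^sup>r\<close>\<close>

text \<open>
  The localized equivariant cohomology of the moduli spaces \<open>M(r,n)\<close>, for all \<open>n\<close> together, is
  rendered as the vector space on the fixed point basis, and \<open>e\<^sub>p\<close>, \<open>f\<^sub>p\<close>, \<open>\<psi>\<^sub>p\<close> as the operators
  with the matrix coefficients obtained from fixed point localization.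
\<close>

type_synonym 'r fixed_point = "'r \<Rightarrow> young"
type_synonym 'r gieseker_space = "('r fixed_point, 'r ratfun) based_space"

definition xrow :: "'r::linorder fixed_point \<Rightarrow> 'r \<Rightarrow> nat \<Rightarrow> 'r ratfun" where
  "xrow \<Lambda> a k = (rowk (\<Lambda> a) k - 1) * s1 + (of_nat k - 1) * s2 - xvar a"

text \<open>
  In the next two definitions \<open>\<Lambda>\<close> is the fixed point reached after the box in row \<open>j\<close> of the
  \<open>l\<close>-th diagram has been added, respectively removed. The products over all \<open>k \<ge> 1\<close> are cut
  off at a row \<open>L \<ge> j\<close> below which the diagram \<open>\<Lambda> a\<close> is empty; the remaining factor is the
  telescoped tail.
\<close>

definition gieseker_e_coeff :: "nat \<Rightarrow> 'r::{finite,linorder} fixed_point \<Rightarrow> 'r \<Rightarrow> nat \<Rightarrow> 'r ratfun" where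
  "gieseker_e_coeff p \<Lambda> l j =
     xrow \<Lambda> l j ^ p / (s1 + s2) *
     (\<Prod>a\<in>UNIV. let L = max (num_rows (\<Lambda> a)) j in
        (\<Prod>k=1..L. (s1 + s2 + xrow \<Lambda> a k - xrow \<Lambda> l j) / (s1 + xrow \<Lambda> a k - xrow \<Lambda> l j)) *
        (1 / (s1 + xrow \<Lambda> a (L + 1) - xrow \<Lambda> l j)))"

definition gieseker_f_coeff :: "nat \<Rightarrow> 'r::{finite,linorder} fixed_point \<Rightarrow> 'r \<Rightarrow> nat \<Rightarrow> 'r ratfun" where
  "gieseker_f_coeff p \<Lambda> l j =
     (-1) ^ (card (UNIV :: 'r set) - 1) * ((s1 + xrow \<Lambda> l j) ^ p / (s1 + s2)) *
     (\<Prod>a\<in>UNIV. let L = max (num_rows (\<Lambda> a)) j in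
        (\<Prod>k=1..L. (s1 + s2 + xrow \<Lambda> l j - xrow \<Lambda> a k) / (s1 + xrow \<Lambda> l j - xrow \<Lambda> a k)) *
        (s1 + s2 + xrow \<Lambda> l j - xrow \<Lambda> a (L + 1)))"

definition gieseker_e :: "nat \<Rightarrow> 'r::{finite,linorder} gieseker_space \<Rightarrow> 'r gieseker_space" where
  "gieseker_e p = linear_extension (\<lambda>M.
     \<Sum>l\<in>UNIV. \<Sum>j\<in>addable (M l).
       let \<Lambda> = M(l := add_box (M l) j) in vscale (gieseker_e_coeff p \<Lambda> l j) (ket \<Lambda>))"

definition gieseker_f :: "nat \<Rightarrow> 'r::{finite,linorder} gieseker_space \<Rightarrow> 'r gieseker_space" where
  "gieseker_f p = linear_extension (\<lambda>M.
     \<Sum>l\<in>UNIV. \<Sum>j\<in>removable (M l).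
       let \<Lambda> = M(l := remove_box (M l) j) in vscale (gieseker_f_coeff p \<Lambda> l j) (ket \<Lambda>))"

definition box_weight :: "'r::linorder \<Rightarrow> nat \<times> nat \<Rightarrow> 'r ratfun" where
  "box_weight a b = (of_nat (fst b) - 1) * s1 + (of_nat (snd b) - 1) * s2 - xvar a"

definition gieseker_psi_num :: "'r::{finite,linorder} fixed_point \<Rightarrow> 'r ratfun poly" where
  "gieseker_psi_num \<Lambda> =
     (\<Prod>a\<in>UNIV. [:xvar a - s3, 1:]) *
     (\<Prod>a\<in>UNIV. \<Prod>b\<in>boxes (\<Lambda> a). \<Prod>s\<leftarrow>[s1, s2, s3]. [:- box_weight a b + s, 1:])"

definition gieseker_psi_den :: "'r::{finite,linorder} fixed_point \<Rightarrow> 'r ratfun poly" where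
  "gieseker_psi_den \<Lambda> =
     (\<Prod>a\<in>UNIV. [:xvar a, 1:]) *
     (\<Prod>a\<in>UNIV. \<Prod>b\<in>boxes (\<Lambda> a). \<Prod>s\<leftarrow>[s1, s2, s3]. [:- box_weight a b - s, 1:])"

definition gieseker_psi :: "nat \<Rightarrow> 'r::{finite,linorder} gieseker_space \<Rightarrow> 'r gieseker_space" where
  "gieseker_psi p = linear_extension (\<lambda>\<Lambda>.
     vscale (psi_mode (sigma3 s1 s2 s3) (expand_inf (gieseker_psi_num \<Lambda>) (gieseker_psi_den \<Lambda>)) p)
       (ket \<Lambda>))"

section \<open>Fock modules and their tensor products\<close>

text \<open>
  The parameters \<open>h1\<close>, \<open>h2\<close>, \<open>u\<close> are elements of a field; the third parameter is \<open>- h1 - h2\<close>.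
  \<open>fock_e_point\<close> and \<open>fock_f_point\<close> are the \<open>\<chi>\<close> in the delta functions.
\<close>

definition fock_e_point :: "'k::field \<Rightarrow> 'k \<Rightarrow> 'k \<Rightarrow> young \<Rightarrow> nat \<Rightarrow> 'k" where
  "fock_e_point h1 h2 u \<mu> i = rowk \<mu> i * h1 + (of_nat i - 1) * h2 + u"

definition fock_f_point :: "'k::field \<Rightarrow> 'k \<Rightarrow> 'k \<Rightarrow> young \<Rightarrow> nat \<Rightarrow> 'k" where
  "fock_f_point h1 h2 u \<mu> i = (rowk \<mu> i - 1) * h1 + (of_nat i - 1) * h2 + u"

definition fock_e_prod :: "'k::field \<Rightarrow> 'k \<Rightarrow> young \<Rightarrow> nat \<Rightarrow> 'k" where
  "fock_e_prod h1 h2 \<mu> i =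
     (\<Prod>j=1..<i.
        (((rowk \<mu> i - rowk \<mu> j) * h1 + (of_nat i - of_nat j - 1) * h2) *
         ((rowk \<mu> i - rowk \<mu> j + 1) * h1 + (of_nat i - of_nat j + 1) * h2)) /
        (((rowk \<mu> i - rowk \<mu> j) * h1 + (of_nat i - of_nat j) * h2) *
         ((rowk \<mu> i - rowk \<mu> j + 1) * h1 + (of_nat i - of_nat j) * h2)))"

text \<open>The factors of the infinite product with \<open>j > num_rows \<mu>\<close> are equal to 1.\<close>

definition fock_f_prod :: "'k::field \<Rightarrow> 'k \<Rightarrow> young \<Rightarrow> nat \<Rightarrow> 'k" where
  "fock_f_prod h1 h2 \<mu> i =
     ((rowk \<mu> (i + 1) - rowk \<mu> i) * h1) / ((rowk \<mu> (i + 1) - rowk \<mu> i + 1) * h1 + h2) *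
     (\<Prod>j=i+1..num_rows \<mu>.
        (((rowk \<mu> j - rowk \<mu> i + 1) * h1 + (of_nat j - of_nat i + 1) * h2) *
         ((rowk \<mu> (j + 1) - rowk \<mu> i) * h1 + (of_nat j - of_nat i) * h2)) /
        (((rowk \<mu> (j + 1) - rowk \<mu> i + 1) * h1 + (of_nat j - of_nat i + 1) * h2) *
         ((rowk \<mu> j - rowk \<mu> i) * h1 + (of_nat j - of_nat i) * h2)))"

text \<open>The coefficient of \<open>|\<mu> + i\<rangle>\<close> in \<open>e(z)|\<mu>\<rangle>\<close>, and that of \<open>|\<mu> - i\<rangle>\<close> in \<open>f(z)|\<mu>\<rangle>\<close>.\<close>

definition fock_e_series :: "'k::field \<Rightarrow> 'k \<Rightarrow> 'k \<Rightarrow> young \<Rightarrow> nat \<Rightarrow> 'k fps" where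
  "fock_e_series h1 h2 u \<mu> i =
     fps_const (1 / h1) * fps_X * fps_const (fock_e_prod h1 h2 \<mu> i) *
     delta_plus (fock_e_point h1 h2 u \<mu> i)"

definition fock_f_series :: "'k::field \<Rightarrow> 'k \<Rightarrow> 'k \<Rightarrow> young \<Rightarrow> nat \<Rightarrow> 'k fps" where
  "fock_f_series h1 h2 u \<mu> i =
     - fps_const (1 / h1) * fps_X * fps_const (fock_f_prod h1 h2 \<mu> i) *
     delta_plus (fock_f_point h1 h2 u \<mu> i)"

text \<open>
  Numerator and denominator of \<open>\<gamma>\<close> as polynomials in \<open>z\<close>; the factors of the infinite product
  with \<open>i > num_rows \<mu>\<close> are equal to 1.
\<close>

definition gamma_num :: "'k::field \<Rightarrow> 'k \<Rightarrow> young \<Rightarrow> 'k \<Rightarrow> 'k poly" where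
  "gamma_num h1 h2 \<mu> u =
     [:- ((rowk \<mu> 1 - 1) * h1 - h2 + u), 1:] *
     (\<Prod>i=1..num_rows \<mu>.
        [:- (rowk \<mu> i * h1 + of_nat i * h2 + u), 1:] *
        [:- ((rowk \<mu> (i + 1) - 1) * h1 + (of_nat i - 1) * h2 + u), 1:])"

definition gamma_den :: "'k::field \<Rightarrow> 'k \<Rightarrow> young \<Rightarrow> 'k \<Rightarrow> 'k poly" where
  "gamma_den h1 h2 \<mu> u =
     [:- (rowk \<mu> 1 * h1 + u), 1:] *
     (\<Prod>i=1..num_rows \<mu>.
        [:- (rowk \<mu> (i + 1) * h1 + of_nat i * h2 + u), 1:] *
        [:- ((rowk \<mu> i - 1) * h1 + (of_nat i - 1) * h2 + u), 1:])"

definition gamma :: "'k::field \<Rightarrow> 'k \<Rightarrow> young \<Rightarrow> 'k \<Rightarrow> 'k \<Rightarrow> 'k" where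
  "gamma h1 h2 \<mu> u \<chi> = poly (gamma_num h1 h2 \<mu> u) \<chi> / poly (gamma_den h1 h2 \<mu> u) \<chi>"

text \<open>
  The tensor product of the Fock modules with parameters \<open>u k\<close>, \<open>k :: 'r\<close>, in increasing order of
  \<open>k\<close>, has the basis of the pure tensors of basis vectors, which is indexed by families of
  Young diagrams.
\<close>

type_synonym ('r, 'k) fock_tensor_space = "('r \<Rightarrow> young, 'k) based_space"

definition fock_tensor_e ::
  "'k::field \<Rightarrow> 'k \<Rightarrow> ('r::{finite,linorder} \<Rightarrow> 'k) \<Rightarrow> nat \<Rightarrow>
   ('r, 'k) fock_tensor_space \<Rightarrow> ('r, 'k) fock_tensor_space"
where
  "fock_tensor_e h1 h2 u p = linear_extension (\<lambda>\<Lambda>.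
     \<Sum>k\<in>UNIV. \<Sum>i\<in>addable (\<Lambda> k).
       vscale (mode
           (fps_const (\<Prod>l\<in>{..<k}. gamma h1 h2 (\<Lambda> l) (u l) (fock_e_point h1 h2 (u k) (\<Lambda> k) i)) *
            fock_e_series h1 h2 (u k) (\<Lambda> k) i) p)
         (ket (\<Lambda>(k := add_box (\<Lambda> k) i))))"

definition fock_tensor_f ::
  "'k::field \<Rightarrow> 'k \<Rightarrow> ('r::{finite,linorder} \<Rightarrow> 'k) \<Rightarrow> nat \<Rightarrow>
   ('r, 'k) fock_tensor_space \<Rightarrow> ('r, 'k) fock_tensor_space"
where
  "fock_tensor_f h1 h2 u p = linear_extension (\<lambda>\<Lambda>.
     \<Sum>k\<in>UNIV. \<Sum>i\<in>removable (\<Lambda> k).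
       vscale (mode
           (fps_const (\<Prod>l\<in>{k<..}. gamma h1 h2 (\<Lambda> l) (u l) (fock_f_point h1 h2 (u k) (\<Lambda> k) i)) *
            fock_f_series h1 h2 (u k) (\<Lambda> k) i) p)
         (ket (\<Lambda>(k := remove_box (\<Lambda> k) i))))"

definition fock_tensor_psi ::
  "'k::field \<Rightarrow> 'k \<Rightarrow> ('r::{finite,linorder} \<Rightarrow> 'k) \<Rightarrow> nat \<Rightarrow>
   ('r, 'k) fock_tensor_space \<Rightarrow> ('r, 'k) fock_tensor_space"
where
  "fock_tensor_psi h1 h2 u p = linear_extension (\<lambda>\<Lambda>.
     vscale (psi_mode (sigma3 h1 h2 (- h1 - h2))
         (\<Prod>k\<in>UNIV. expand_inf (gamma_num h1 h2 (\<Lambda> k) (u k)) (gamma_den h1 h2 (\<Lambda> k) (u k))) p)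
       (ket \<Lambda>))"

section \<open>Rescaling of the bases\<close>

definition rescaling_map ::
  "('r::linorder fixed_point \<Rightarrow> 'r ratfun) \<Rightarrow> 'r gieseker_space \<Rightarrow> ('r, 'r ratfun) fock_tensor_space"
where
  "rescaling_map c = linear_extension (\<lambda>\<Lambda>. vscale (c \<Lambda>) (ket \<Lambda>))"

end

theory Submission
  imports Defs
begin

text \<open>
  Put \<open>h\<^sub>3 = - h\<^sub>1 - h\<^sub>2\<close>, and attach to row \<open>i\<close> of the \<open>a\<close>-th diagram the coordinate
  \<open>y = \<lambda>\<^sub>i h\<^sub>1 + (i - 1) h\<^sub>2 + u\<^sub>a\<close>, the weight of the box that would be added to this row. Let
  \<open>g(t) = (t - h\<^sub>2) (t - h\<^sub>3) / (t (t + h\<^sub>1))\<close>. After regrouping, the coefficient of adding a box to row \<open>b\<close> in the tensor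
  product of Fock modules is the product of \<open>g(y\<^sub>b - y\<^sub>b\<^sub>')\<close> over all rows \<open>b'\<close> before \<open>b\<close>, in the lexicographic order, that of
  removing one is the product of \<open>g(y\<^sub>b\<^sub>' - y\<^sub>b)\<close> over all rows after \<open>b\<close>, and \<open>\<psi>(z)\<close> is the product of \<open>g(z - y\<^sub>b)\<close> over all rows.
  So the module is an infinite tensor product of modules with a single row each. Coefficients that would not lead to a
  diagram vanish, because \<open>g(h\<^sub>2) = 0\<close>, and one may sum over all rows. All but finitely many rows are empty; their
  factors telescope to a simple fraction, and since no relation involves more than three boxes, a sufficiently large
  finite number of rows can be kept and the rest treated as a factor that no step changes.

  The relations of the Yangian then become identities for a few rows. The cubic relation for \<open>e\<close> is an identity for two
  rows (\<open>exchange\<close>), the Serre relation one for three rows, which may coincide (\<open>serre_sum_zero\<close>). Reversing the order of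
  the rows and the sign of the coordinates turns \<open>f\<close> into operators of the type of \<open>e\<close> (\<open>lowering_as_raising\<close>). The relations
  with \<open>\<psi>\<close> follow from the factor by which \<open>\<psi>(z)\<close> changes when a box is added (\<open>psi_recursion_modes\<close>). In \<open>[e\<^sub>p, f\<^sub>q]\<close> the
  off-diagonal terms cancel, and the diagonal ones are the residues of \<open>z\<^sup>p\<^sup>+\<^sup>q \<psi>(z) / \<sigma>\<^sub>3\<close>, so that this relation is the partial
  fraction decomposition of \<open>\<psi>(z)\<close> (\<open>e_f_relation\<close>).

  In the fixed point basis \<open>\<psi>(z)\<close> has the same eigenvalues. The coefficients of \<open>e\<close> are different, but the ratios of the
  coefficients in the two bases multiply to the same value along both paths of every square in the graph of tuples of diagrams
  (\<open>amplitude_ratio_diamond\<close>). Hence they are the ratios \<open>c(\<Lambda> + b) / c(\<Lambda>)\<close> for constants \<open>c\<close>, which can be computed by removing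
  boxes in any order (\<open>rescaling_add_at\<close>). The products of the coefficients of \<open>e\<close> and \<open>f\<close> along an edge and back agree in the two
  bases (\<open>amplitude_products\<close>), so rescaling by \<open>c\<close> matches \<open>f\<close> as well, and carries the representation on the tensor
  product to one on the fixed point basis. Since no coefficient of \<open>e\<^sub>0\<close> between neighbouring tuples vanishes, \<open>c\<close> is determined by
  its value 1 at the empty diagrams (\<open>rescaling_unique\<close>).
\<close>

section \<open>The structure function of the Yangian\<close>

text \<open>
  This is \<open>(t - h\<^sub>2) (t - h\<^sub>3) / (t (t + h\<^sub>1))\<close> with \<open>h\<^sub>3 = - h\<^sub>1 - h\<^sub>2\<close>: the factor that a row contributes to the
  coefficient of adding a box to another row, as a function of the difference \<open>t\<close> of their coordinates. It is
  also the factor \<open>(z - y - h\<^sub>2) (z - y - h\<^sub>3) / ((z - y) (z - y + h\<^sub>1))\<close> that a row with coordinate \<open>y\<close>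
  contributes to \<open>\<psi>(z)\<close>, for \<open>t = z - y\<close>.
\<close>

definition bond :: "'k::field \<Rightarrow> 'k \<Rightarrow> 'k \<Rightarrow> 'k" where
  "bond h1 h2 t = ((t - h2) * (t + h1 + h2)) / (t * (t + h1))"

text \<open>
  The polynomial \<open>t\<^sup>3 + \<sigma>\<^sub>2 t - \<sigma>\<^sub>3\<close> in factored form. The cubic relation for \<open>e\<close> says that
  \<open>structure_cubic h1 h2 (x - y)\<close> annihilates the products \<open>e(x) e(y)\<close>, up to the exchange of the two factors.
\<close>

definition structure_cubic :: "'k::field \<Rightarrow> 'k \<Rightarrow> 'k \<Rightarrow> 'k" where
  "structure_cubic h1 h2 t = (t - h1) * (t - h2) * (t + h1 + h2)"

lemma bond_reflect: "bond h1 h2 (- t - h1) = bond h1 h2 t"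
proof -
  have "(- t - h1 - h2) * (- t - h1 + h1 + h2) = (t - h2) * (t + h1 + h2)"
    "(- t - h1) * (- t - h1 + h1) = t * (t + h1)"
    by (simp_all add: algebra_simps)
  then show ?thesis unfolding bond_def by simp
qed

text \<open>
  With this lemma and the next one, adding boxes to two rows in the two possible orders multiplies a common
  factor by \<open>p(t)\<close> and by \<open>- p(- t)\<close>, where \<open>p\<close> is the structure cubic. All order dependence is
  polynomial once the antisymmetric denominator is split off.
\<close>

lemma bond_eq_cubic:
  fixes t h1 h2 :: "'k::field"
  assumes "t \<noteq> h1"
  shows "bond h1 h2 t = structure_cubic h1 h2 t / (t * (t + h1) * (t - h1))"
  unfolding bond_def structure_cubic_def using assms
  by (cases "t = 0"; cases "t + h1 = 0") (auto simp: divide_simps)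

lemma bond_shift_eq_cubic:
  fixes t h1 h2 :: "'k::field"
  assumes "t \<noteq> - h1"
  shows "bond h1 h2 (t - h1) = - structure_cubic h1 h2 (- t) / (t * (t + h1) * (t - h1))"
proof -
  have "t + h1 \<noteq> 0" using assms by (simp add: eq_neg_iff_add_eq_0)
  moreover have "structure_cubic h1 h2 (- t) = - ((t - h1 - h2) * (t - h1 + h1 + h2) * (t + h1))"
    unfolding structure_cubic_def by algebra
  ultimately show ?thesis unfolding bond_def
    by (cases "t = 0"; cases "t - h1 = 0") (auto simp: divide_simps)
qed

lemma bond_exchange:
  fixes t h1 h2 :: "'k::field"
  assumes "t \<noteq> h1" "t \<noteq> - h1"
  shows "bond h1 h2 (t - h1) * structure_cubic h1 h2 t + bond h1 h2 t * structure_cubic h1 h2 (- t) = 0"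
  unfolding bond_eq_cubic[OF assms(1)] bond_shift_eq_cubic[OF assms(2)] by simp

text \<open>
  The Serre relation for two boxes added to a row and one to a later row. The three terms belong to the
  times at which the later row is changed: it sees the earlier row after two, one or no steps.
\<close>

lemma serre_two_lower:
  fixes t h1 h2 :: "'k::field"
  assumes "t \<noteq> 0" "t - h1 \<noteq> 0" "t + h1 \<noteq> 0" "t - 2 * h1 \<noteq> 0"
  shows "bond h1 h2 (t - 2 * h1) * (t - 2 * h1) + bond h1 h2 (t - h1) * (h1 - 2 * t) + bond h1 h2 t * (t + h1) = 0"
  unfolding bond_def using assms
  by (simp add: divide_simps) algebra

text \<open>
  The same with two boxes added to the later row, which sees the earlier row before or after its step.
\<close>

lemma serre_two_upper:
  fixes t h1 h2 :: "'k::field"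
  assumes "t \<noteq> 0" "t - h1 \<noteq> 0" "t + h1 \<noteq> 0" "t + 2 * h1 \<noteq> 0"
  shows "bond h1 h2 (t + h1) * (- t - 2 * h1) + bond h1 h2 t * (h1 + 2 * t) + bond h1 h2 (t - h1) * (h1 - t) = 0"
  unfolding bond_def using assms
  by (simp add: divide_simps) algebra

text \<open>
  The Serre relation for three distinct rows after the common denominator has been removed: an
  antisymmetrization of a polynomial of degree 10 that vanishes identically.
\<close>

lemma serre_cubic_identity:
  fixes a b c h1 h2 :: "'k::field"
  defines "p \<equiv> structure_cubic h1 h2"
  shows "p (a - b) * p (a - c) * p (b - c) * (a - 2 * b + c)
       - p (a - c) * p (a - b) * p (c - b) * (a - 2 * c + b)
       - p (b - a) * p (b - c) * p (a - c) * (b - 2 * a + c)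
       + p (b - c) * p (b - a) * p (c - a) * (b - 2 * c + a)
       + p (c - a) * p (c - b) * p (a - b) * (c - 2 * a + b)
       - p (c - b) * p (c - a) * p (b - a) * (c - 2 * b + a) = 0"
  unfolding p_def structure_cubic_def by algebra


section \<open>Partial fractions\<close>

text \<open>
  The splitting of a product of two simple fractions, in a form that is insensitive to how the numerators are written.
\<close>

lemma two_pole_split:
  fixes x w m :: "'k::field"
  assumes "x \<noteq> 0" "w \<noteq> 0" "m \<noteq> 0" "x * v + y * m = u * w"
  shows "r / x * (y / w) = r * (u / m) / x + v / w * (r / - m)"
proof -
  have "y * m = u * w - x * v" using assms(4) by algebra
  then have y: "y = (u * w - x * v) / m" using assms(3) by (simp add: eq_divide_eq)
  have "(u * w - x * v) / m / w = u / m - x * v / (m * w)"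
    using assms(2) by (simp add: diff_divide_distrib)
  then have "r / x * (y / w) = r / x * (u / m) - r / x * (x * v / (m * w))"
    unfolding y by (simp add: right_diff_distrib)
  also have "r / x * (x * v / (m * w)) = r * v / (m * w)"
    using assms(1) by simp
  finally show ?thesis by (simp add: mult_ac)
qed

text \<open>
  By induction on the number of poles. Only simple poles occur, and numerator and denominator have the same degree
  with the same leading coefficient, so that the polynomial part is 1.
\<close>

lemma partial_fractions_value:
  fixes a b :: "'i \<Rightarrow> 'k::field"
  assumes "finite I" "inj_on b I" "z \<notin> b ` I"
  shows "(\<Prod>i\<in>I. (z - a i) / (z - b i)) =
    1 + (\<Sum>i\<in>I. (b i - a i) * (\<Prod>j\<in>I - {i}. (b i - a j) / (b i - b j)) / (z - b i))"
  using assms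
proof (induction I arbitrary: z rule: finite_induct)
  case empty
  then show ?case by simp
next
  case (insert n I)
  have inj: "inj_on b I" and bn: "b n \<notin> b ` I" using insert by (auto simp: inj_on_def)
  have zn: "z \<noteq> b n" and zI: "z \<notin> b ` I" using insert.prems by auto
  let ?R = "\<lambda>i. (b i - a i) * (\<Prod>j\<in>I - {i}. (b i - a j) / (b i - b j))"
  have split: "(b i - a i) * (\<Prod>j\<in>insert n I - {i}. (b i - a j) / (b i - b j)) =
      ?R i * ((b i - a n) / (b i - b n))" if "i \<in> I" for i
  proof -
    have "insert n I - {i} = insert n (I - {i})" using that insert.hyps by auto
    then show ?thesis using insert.hyps by simp
  qed
  have key: "?R i / (z - b i) * ((z - a n) / (z - b n)) =
     ?R i * ((b i - a n) / (b i - b n)) / (z - b i) +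
     (b n - a n) / (z - b n) * (?R i / (b n - b i))" if "i \<in> I" for i
  proof -
    have nz: "z - b i \<noteq> 0" "z - b n \<noteq> 0" "b i - b n \<noteq> 0"
      using zn zI bn that by (metis imageI right_minus_eq)+
    have "(z - b i) * (b n - a n) + (z - a n) * (b i - b n) = (b i - a n) * (z - b n)"
      by algebra
    from two_pole_split[OF nz this] show ?thesis by (simp only: minus_diff_eq)
  qed
  have "(\<Prod>i\<in>insert n I. (z - a i) / (z - b i)) =
      (1 + (\<Sum>i\<in>I. ?R i / (z - b i))) * ((z - a n) / (z - b n))"
    using insert.IH[OF inj zI] insert.hyps by simp
  also have "\<dots> = (z - a n) / (z - b n) + (\<Sum>i\<in>I. ?R i / (z - b i) * ((z - a n) / (z - b n)))"
    by (simp only: distrib_right sum_distrib_right mult_1_left)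
  also have "(\<Sum>i\<in>I. ?R i / (z - b i) * ((z - a n) / (z - b n))) =
    (\<Sum>i\<in>I. ?R i * ((b i - a n) / (b i - b n)) / (z - b i)) +
    (b n - a n) / (z - b n) * (\<Sum>i\<in>I. ?R i / (b n - b i))"
    by (simp only: key sum.distrib sum_distrib_left cong: sum.cong)
  also have "(z - a n) / (z - b n) = 1 + (b n - a n) / (z - b n)"
    using zn by (simp add: field_simps)
  also have "1 + (b n - a n) / (z - b n) + ((\<Sum>i\<in>I. ?R i * ((b i - a n) / (b i - b n)) / (z - b i)) +
    (b n - a n) / (z - b n) * (\<Sum>i\<in>I. ?R i / (b n - b i))) =
    1 + (b n - a n) * (1 + (\<Sum>i\<in>I. ?R i / (b n - b i))) / (z - b n) +
     (\<Sum>i\<in>I. ?R i * ((b i - a n) / (b i - b n)) / (z - b i))"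
    by (simp add: distrib_left add_divide_distrib)
  also have "1 + (\<Sum>i\<in>I. ?R i / (b n - b i)) = (\<Prod>j\<in>insert n I - {n}. (b n - a j) / (b n - b j))"
    using insert.IH[OF inj bn] insert.hyps by (simp add: insert_Diff_if)
  also have "(\<Sum>i\<in>I. ?R i * ((b i - a n) / (b i - b n)) / (z - b i)) =
    (\<Sum>i\<in>I. (b i - a i) * (\<Prod>j\<in>insert n I - {i}. (b i - a j) / (b i - b j)) / (z - b i))"
    by (simp only: split cong: sum.cong)
  finally show ?case using insert.hyps by (simp add: add.assoc)
qed

lemma delta_plus_inverse: "delta_plus b * (1 - fps_const b * fps_X) = (1::'k::field fps)"
proof -
  have "delta_plus b = 1 + fps_const b * fps_X * delta_plus b"
    by (rule fps_ext) (simp add: delta_plus_def mult.assoc power_eq_if)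
  then show ?thesis by (simp add: algebra_simps)
qed

lemma delta_plus_split:
  fixes a b c :: "'k::field"
  assumes "s + t = 1" "s * c + t * b = a"
  shows "delta_plus b * ((1 - fps_const a * fps_X) * delta_plus c) =
    fps_const s * delta_plus b + fps_const t * delta_plus c"
proof -
  have "fps_const s + fps_const t = 1" "fps_const s * fps_const c + fps_const t * fps_const b = fps_const a"
    using assms by simp_all
  moreover note delta_plus_inverse[of b] delta_plus_inverse[of c]
  ultimately show ?thesis by algebra
qed

lemma fps_const_of_sum: "fps_const (\<Sum>i\<in>I. f i) = (\<Sum>i\<in>I. fps_const (f i))"
  by (induction I rule: infinite_finite_induct) (simp_all flip: fps_const_add)

text \<open>
  The expansion at infinity of the previous identity, with \<open>X\<close> for \<open>z\<^sup>-\<^sup>1\<close>. The induction needs the values of the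
  partial sums at the new pole, which the previous lemma provides.
\<close>

lemma partial_fractions_fps:
  fixes a b :: "'i \<Rightarrow> 'k::field"
  assumes "finite I" "inj_on b I"
  shows "(\<Prod>i\<in>I. (1 - fps_const (a i) * fps_X) * delta_plus (b i)) =
    1 + (\<Sum>i\<in>I. fps_const ((b i - a i) * (\<Prod>j\<in>I - {i}. (b i - a j) / (b i - b j))) * fps_X * delta_plus (b i))"
  using assms
proof (induction I rule: finite_induct)
  case empty
  then show ?case by simp
next
  case (insert n I)
  have inj: "inj_on b I" and bn: "b n \<notin> b ` I" using insert by (auto simp: inj_on_def)
  let ?R = "\<lambda>i. (b i - a i) * (\<Prod>j\<in>I - {i}. (b i - a j) / (b i - b j))"
  let ?g = "\<lambda>i. delta_plus (b i)"
  let ?l = "\<lambda>c. 1 - fps_const c * fps_X :: 'k fps"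
  have split: "(b i - a i) * (\<Prod>j\<in>insert n I - {i}. (b i - a j) / (b i - b j)) =
      ?R i * ((b i - a n) / (b i - b n))" if "i \<in> I" for i
  proof -
    have "insert n I - {i} = insert n (I - {i})" using that insert.hyps by auto
    then show ?thesis using insert.hyps by simp
  qed
  have key: "?g i * (?l (a n) * ?g n) =
     fps_const ((b i - a n) / (b i - b n)) * ?g i + fps_const ((b n - a n) / (b n - b i)) * ?g n"
    if "i \<in> I" for i
  proof -
    have nz: "b i - b n \<noteq> 0" "b n - b i \<noteq> 0" using bn that by (metis imageI right_minus_eq)+
    let ?s = "(b i - a n) / (b i - b n)" and ?t = "(b n - a n) / (b n - b i)"
    have st: "?s + ?t = 1" "?s * b n + ?t * b i = a n"
    proof -
      have "?t = - ((b n - a n) / (b i - b n))" by (metis minus_diff_eq minus_divide_right)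
      moreover have "(b i - a n) / (b i - b n) - (b n - a n) / (b i - b n) = 1"
        using nz by (simp flip: diff_divide_distrib)
      moreover have "(b i - a n) * b n - (b n - a n) * b i = a n * (b i - b n)" by algebra
      then have "(b i - a n) / (b i - b n) * b n - (b n - a n) / (b i - b n) * b i = a n"
        using nz by (simp flip: diff_divide_distrib add: nonzero_divide_eq_eq)
      ultimately show "?s + ?t = 1" "?s * b n + ?t * b i = a n" by simp_all
    qed
    show ?thesis by (rule delta_plus_split[OF st])
  qed
  have base: "?l (a n) * ?g n = 1 + fps_const (b n - a n) * fps_X * ?g n"
  proof -
    have "?l (a n) = ?l (b n) + (fps_const (b n) - fps_const (a n)) * fps_X" by algebra
    then have "?l (a n) = ?l (b n) + fps_const (b n - a n) * fps_X" by simp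
    then have "?l (a n) * ?g n = ?g n * ?l (b n) + fps_const (b n - a n) * fps_X * ?g n"
      by algebra
    then show ?thesis by (simp only: delta_plus_inverse)
  qed
  have collect: "1 + fps_const q * fps_X * G + (S + fps_const (q * T) * (fps_X * G)) =
    1 + fps_const (q * (1 + T)) * fps_X * G + S" for q T and S G :: "'k fps"
  proof -
    have "fps_const (q * (1 + T)) = fps_const q + fps_const (q * T)" by (simp add: distrib_left)
    then show ?thesis by algebra
  qed
  have "(\<Prod>i\<in>insert n I. ?l (a i) * ?g i) = (1 + (\<Sum>i\<in>I. fps_const (?R i) * fps_X * ?g i)) * (?l (a n) * ?g n)"
    using insert.IH[OF inj] insert.hyps by (simp add: mult.commute)
  also have "\<dots> = ?l (a n) * ?g n + (\<Sum>i\<in>I. fps_const (?R i) * fps_X * (?g i * (?l (a n) * ?g n)))"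
    by (simp only: distrib_right sum_distrib_right mult_1_left mult.assoc)
  also have "(\<Sum>i\<in>I. fps_const (?R i) * fps_X * (?g i * (?l (a n) * ?g n))) =
    (\<Sum>i\<in>I. fps_const (?R i * ((b i - a n) / (b i - b n))) * fps_X * ?g i +
       fps_const ((b n - a n) * (?R i / (b n - b i))) * (fps_X * ?g n))"
  proof (rule sum.cong[OF refl])
    fix i assume "i \<in> I"
    have "fps_const r * fps_X * (fps_const s * u + fps_const (v / w) * y) =
      fps_const (r * s) * fps_X * u + fps_const (v * (r / w)) * (fps_X * y)"
      for r s v w and u y :: "'k fps"
    proof -
      have "fps_const (v * (r / w)) = fps_const r * fps_const (v / w)" by simp
      then show ?thesis by (simp only: fps_const_mult[symmetric] distrib_left mult_ac)
    qed
    then show "fps_const (?R i) * fps_X * (?g i * (?l (a n) * ?g n)) =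
       fps_const (?R i * ((b i - a n) / (b i - b n))) * fps_X * ?g i +
       fps_const ((b n - a n) * (?R i / (b n - b i))) * (fps_X * ?g n)"
      unfolding key[OF \<open>i \<in> I\<close>] by blast
  qed
  also have "\<dots> = (\<Sum>i\<in>I. fps_const (?R i * ((b i - a n) / (b i - b n))) * fps_X * ?g i) +
     fps_const ((b n - a n) * (\<Sum>i\<in>I. ?R i / (b n - b i))) * (fps_X * ?g n)"
    by (simp only: sum.distrib sum_distrib_left fps_const_of_sum sum_distrib_right)
  also have "?l (a n) * ?g n + \<dots> = 1 + fps_const ((b n - a n) * (1 + (\<Sum>i\<in>I. ?R i / (b n - b i)))) * fps_X * ?g n +
     (\<Sum>i\<in>I. fps_const (?R i * ((b i - a n) / (b i - b n))) * fps_X * ?g i)"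
    unfolding base by (rule collect)
  also have "1 + (\<Sum>i\<in>I. ?R i / (b n - b i)) = (\<Prod>j\<in>insert n I - {n}. (b n - a j) / (b n - b j))"
    using partial_fractions_value[OF insert.hyps(1) inj bn, of a] insert.hyps by (simp add: insert_Diff_if)
  also have "(\<Sum>i\<in>I. fps_const (?R i * ((b i - a n) / (b i - b n))) * fps_X * ?g i) =
    (\<Sum>i\<in>I. fps_const ((b i - a i) * (\<Prod>j\<in>insert n I - {i}. (b i - a j) / (b i - b j))) * fps_X * ?g i)"
    by (simp only: split cong: sum.cong)
  finally show ?case using insert.hyps by (simp add: add.assoc)
qed

section \<open>Rows of boxes and the coefficients of a product of one-row modules\<close>

definition shift_at :: "'k::field \<Rightarrow> ('i \<Rightarrow> 'k) \<Rightarrow> 'i \<Rightarrow> 'i \<Rightarrow> 'k" where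
  "shift_at h z i = z(i := z i + h)"

lemma shift_at_same [simp]: "shift_at h z i i = z i + h"
  by (simp add: shift_at_def)

lemma shift_at_other [simp]: "j \<noteq> i \<Longrightarrow> shift_at h z i j = z j"
  by (simp add: shift_at_def)

lemma shift_at_commute: "shift_at h (shift_at h' z i) j = shift_at h' (shift_at h z j) i"
  by (cases "i = j") (auto simp: shift_at_def fun_eq_iff)

text \<open>
  Rows whose coordinates never become equal or adjacent, however many boxes are added to or removed
  from them: the condition that keeps all denominators away from 0.
\<close>

definition spread :: "'k::field \<Rightarrow> 'i set \<Rightarrow> ('i \<Rightarrow> 'k) \<Rightarrow> bool" where
  "spread h J z \<longleftrightarrow> (\<forall>i\<in>J. \<forall>j\<in>J. i \<noteq> j \<longrightarrow> (\<forall>n::int. z i - z j \<noteq> of_int n * h))"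

lemma spreadD:
  assumes "spread h J z" "i \<in> J" "j \<in> J" "i \<noteq> j"
  shows "z i \<noteq> z j" "z i - z j \<noteq> h" "z i - z j + h \<noteq> 0" "z i - z j \<noteq> 2 * h" "z i - z j + 2 * h \<noteq> 0"
proof -
  have *: "z i - z j \<noteq> of_int n * h" for n using assms unfolding spread_def by blast
  show "z i \<noteq> z j" "z i - z j \<noteq> h" "z i - z j \<noteq> 2 * h" using *[of 0] *[of 1] *[of 2] by auto
  show "z i - z j + h \<noteq> 0" "z i - z j + 2 * h \<noteq> 0"
    using *[of "-1"] *[of "-2"] by (auto simp: eq_neg_iff_add_eq_0)
qed

text \<open>
  A finite set of rows with coordinates \<open>z i\<close>, in a linear order. Adding a box to row \<open>i\<close> shifts \<open>z i\<close> by \<open>h1\<close>, and its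
  coefficient is the product of the structure function over the earlier rows, as in a tensor product of one-row
  modules, times a factor \<open>c i\<close> of the coordinate of row \<open>i\<close> alone, which accounts for the empty rows outside \<open>J\<close>.
  The order is a parameter, since the lowering operators use the reversed one.
\<close>

locale linearly_ordered_rows =
  fixes h1 h2 :: "'k::field" and J :: "'i set" and lt :: "'i \<Rightarrow> 'i \<Rightarrow> bool" and c :: "'i \<Rightarrow> 'k \<Rightarrow> 'k"
  assumes finite_J: "finite J"
    and lt_asym: "lt i j \<Longrightarrow> \<not> lt j i"
    and lt_trans: "lt i j \<Longrightarrow> lt j k \<Longrightarrow> lt i k"
    and lt_total: "i \<noteq> j \<Longrightarrow> lt i j \<or> lt j i"
begin

definition row_coeff :: "('i \<Rightarrow> 'k) \<Rightarrow> 'i \<Rightarrow> 'k" where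
  "row_coeff z i = c i (z i) * (\<Prod>j\<in>{j\<in>J. lt j i}. bond h1 h2 (z i - z j))"

abbreviation move :: "('i \<Rightarrow> 'k) \<Rightarrow> 'i \<Rightarrow> 'i \<Rightarrow> 'k" where "move \<equiv> shift_at h1"

text \<open>
  The part of the coefficient of row \<open>i\<close> that does not see the rows in \<open>S\<close>; the new coordinate \<open>v\<close> of row \<open>i\<close> is a
  separate argument, so that it is the same function before and after steps in \<open>S\<close>.
\<close>

definition rest_coeff :: "'i set \<Rightarrow> ('i \<Rightarrow> 'k) \<Rightarrow> 'i \<Rightarrow> 'k \<Rightarrow> 'k" where
  "rest_coeff S z i v = c i v * (\<Prod>j\<in>{j\<in>J - S. lt j i}. bond h1 h2 (v - z j))"

lemma row_coeff_factor:
  assumes "S \<subseteq> J" "\<And>j. j \<in> J - S \<Longrightarrow> z' j = z j"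
  shows "row_coeff z' i = rest_coeff S z i (z' i) * (\<Prod>j\<in>{j\<in>S. lt j i}. bond h1 h2 (z' i - z' j))"
proof -
  have "{j\<in>J. lt j i} = {j\<in>J - S. lt j i} \<union> {j\<in>S. lt j i}" using assms(1) by auto
  moreover have "finite {j\<in>J - S. lt j i}" "finite {j\<in>S. lt j i}"
    using finite_J assms(1) by (auto intro: finite_subset)
  moreover have "{j\<in>J - S. lt j i} \<inter> {j\<in>S. lt j i} = {}" by auto
  ultimately have "(\<Prod>j\<in>{j\<in>J. lt j i}. bond h1 h2 (z' i - z' j)) =
    (\<Prod>j\<in>{j\<in>J - S. lt j i}. bond h1 h2 (z' i - z' j)) * (\<Prod>j\<in>{j\<in>S. lt j i}. bond h1 h2 (z' i - z' j))"
    by (simp add: prod.union_disjoint)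
  moreover have "(\<Prod>j\<in>{j\<in>J - S. lt j i}. bond h1 h2 (z' i - z' j)) =
      (\<Prod>j\<in>{j\<in>J - S. lt j i}. bond h1 h2 (z' i - z j))"
    by (rule prod.cong) (auto simp: assms(2))
  ultimately show ?thesis unfolding row_coeff_def rest_coeff_def by (simp add: mult.assoc)
qed

lemma not_lt_refl [simp]: "\<not> lt i i" using lt_asym by blast

lemma coeff_pair:
  assumes "lt i j" "i \<in> J" "j \<in> J" "\<And>l. l \<noteq> i \<Longrightarrow> l \<noteq> j \<Longrightarrow> z' l = z l"
  shows "row_coeff z' i = rest_coeff {i, j} z i (z' i)"
    "row_coeff z' j = rest_coeff {i, j} z j (z' j) * bond h1 h2 (z' j - z' i)"
proof -
  have s: "{l\<in>{i, j}. lt l i} = {}" "{l\<in>{i, j}. lt l j} = {i}"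
    using assms(1) lt_asym by auto
  show "row_coeff z' i = rest_coeff {i, j} z i (z' i)"
    "row_coeff z' j = rest_coeff {i, j} z j (z' j) * bond h1 h2 (z' j - z' i)"
    using row_coeff_factor[of "{i, j}" z' z i, unfolded s] row_coeff_factor[of "{i, j}" z' z j, unfolded s] assms
    by simp_all
qed

text \<open>
  Only the later row sees the earlier one, so the two orders of adding boxes differ by the shift of one
  argument of the structure function.
\<close>

lemma exchange_ordered:
  assumes "lt i j" "i \<in> J" "j \<in> J" "spread h1 J z"
  shows "row_coeff z i * row_coeff (move z i) j * structure_cubic h1 h2 (z j - z i) +
    row_coeff z j * row_coeff (move z j) i * structure_cubic h1 h2 (z i - z j) = 0"
proof -
  have ij: "i \<noteq> j" "j \<noteq> i" using assms(1) by auto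
  let ?t = "z j - z i"
  have cz: "row_coeff z i = rest_coeff {i, j} z i (z i)"
      "row_coeff z j = rest_coeff {i, j} z j (z j) * bond h1 h2 ?t"
      "row_coeff (move z i) j = rest_coeff {i, j} z j (z j) * bond h1 h2 (?t - h1)"
      "row_coeff (move z j) i = rest_coeff {i, j} z i (z i)"
    using coeff_pair[OF assms(1-3), where z' = z and z = z] coeff_pair[OF assms(1-3), where z' = "move z i" and z = z]
      coeff_pair[OF assms(1-3), where z' = "move z j" and z = z] ij
    by (simp_all add: diff_diff_eq)
  have "bond h1 h2 (?t - h1) * structure_cubic h1 h2 ?t + bond h1 h2 ?t * structure_cubic h1 h2 (z i - z j) = 0"
    using bond_exchange[of ?t h1 h2] spreadD[OF assms(4,3,2)] ij by (simp add: eq_neg_iff_add_eq_0)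
  then show ?thesis unfolding cz by algebra
qed

lemma exchange:
  assumes "i \<noteq> j" "i \<in> J" "j \<in> J" "spread h1 J z"
  shows "row_coeff z i * row_coeff (move z i) j * structure_cubic h1 h2 (z j - z i) +
    row_coeff z j * row_coeff (move z j) i * structure_cubic h1 h2 (z i - z j) = 0"
  using exchange_ordered[of i j z] exchange_ordered[of j i z] lt_total[OF assms(1)] assms
  by (auto simp: add.commute)

text \<open>
  Symmetrizing \<open>[e\<^sub>p, [e\<^sub>q, e\<^sub>r\<^sub>+\<^sub>1]]\<close> over the exponents leaves, for every order of adding the three boxes, the factor
  \<open>x\<^sub>1 - 2 x\<^sub>2 + x\<^sub>3\<close>, where \<open>x\<^sub>1, x\<^sub>2, x\<^sub>3\<close> are the weights of the boxes in the order in which they are added.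
\<close>

definition serre_term :: "('i \<Rightarrow> 'k) \<Rightarrow> 'i \<Rightarrow> 'i \<Rightarrow> 'i \<Rightarrow> 'k" where
  "serre_term z i j k = row_coeff z i * row_coeff (move z i) j * row_coeff (move (move z i) j) k *
     (z i - 2 * move z i j + move (move z i) j k)"

definition serre_sum :: "('i \<Rightarrow> 'k) \<Rightarrow> 'i \<Rightarrow> 'i \<Rightarrow> 'i \<Rightarrow> 'k" where
  "serre_sum z i j k = serre_term z i j k + serre_term z i k j + serre_term z j i k +
     serre_term z j k i + serre_term z k i j + serre_term z k j i"

text \<open>
  Three consecutive boxes of a row have weights in arithmetic progression.
\<close>

lemma serre_single_row: "serre_term z i i i = 0"
  by (simp add: serre_term_def)

lemma serre_two_rows_lower:
  assumes "lt i j" "i \<in> J" "j \<in> J" "spread h1 J z"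
  shows "serre_term z i i j + serre_term z i j i + serre_term z j i i = 0"
proof -
  have ij: "i \<noteq> j" "j \<noteq> i" using assms(1) by auto
  let ?t = "z j - z i"
  define r where "r = rest_coeff {i, j} z"
  note cp = coeff_pair[OF assms(1-3), where z = z, folded r_def]
  have c: "row_coeff z i = r i (z i)" "row_coeff (move z i) i = r i (z i + h1)"
    "row_coeff (move z j) i = r i (z i)"
    "row_coeff (move (move z i) j) i = r i (z i + h1)"
    "row_coeff (move (move z j) i) i = r i (z i + h1)"
    "row_coeff z j = r j (z j) * bond h1 h2 ?t"
    "row_coeff (move z i) j = r j (z j) * bond h1 h2 (?t - h1)"
    "row_coeff (move (move z i) i) j = r j (z j) * bond h1 h2 (?t - 2 * h1)"
    using ij by (simp_all add: cp algebra_simps)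
  note t = spreadD[OF assms(4,3,2) ij(2)]
  have "bond h1 h2 (?t - 2 * h1) * (?t - 2 * h1) + bond h1 h2 (?t - h1) * (h1 - 2 * ?t) + bond h1 h2 ?t * (?t + h1) = 0"
    using t by (intro serre_two_lower) auto
  then have "r i (z i) * r i (z i + h1) * r j (z j) * (bond h1 h2 (?t - 2 * h1) * (?t - 2 * h1) +
     bond h1 h2 (?t - h1) * (h1 - 2 * ?t) + bond h1 h2 ?t * (?t + h1)) = 0" by simp
  then show ?thesis by (simp only: serre_term_def c shift_at_same shift_at_other[OF ij(1)] shift_at_other[OF ij(2)]) algebra
qed

lemma serre_two_rows_upper:
  assumes "lt i j" "i \<in> J" "j \<in> J" "spread h1 J z"
  shows "serre_term z j j i + serre_term z j i j + serre_term z i j j = 0"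
proof -
  have ij: "i \<noteq> j" "j \<noteq> i" using assms(1) by auto
  let ?t = "z j - z i"
  define r where "r = rest_coeff {i, j} z"
  note cp = coeff_pair[OF assms(1-3), where z = z, folded r_def]
  have c: "row_coeff z i = r i (z i)"
    "row_coeff (move z j) i = r i (z i)"
    "row_coeff (move (move z j) j) i = r i (z i)"
    "row_coeff z j = r j (z j) * bond h1 h2 ?t"
    "row_coeff (move z j) j = r j (z j + h1) * bond h1 h2 (?t + h1)"
    "row_coeff (move (move z j) i) j = r j (z j + h1) * bond h1 h2 ?t"
    "row_coeff (move (move z i) j) j = r j (z j + h1) * bond h1 h2 ?t"
    "row_coeff (move z i) j = r j (z j) * bond h1 h2 (?t - h1)"
    using ij by (simp_all add: cp algebra_simps)
  note t = spreadD[OF assms(4,3,2) ij(2)]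
  have "bond h1 h2 (?t + h1) * (- ?t - 2 * h1) + bond h1 h2 ?t * (h1 + 2 * ?t) + bond h1 h2 (?t - h1) * (h1 - ?t) = 0"
    using t by (intro serre_two_upper) auto
  then have "r i (z i) * r j (z j + h1) * r j (z j) * bond h1 h2 ?t * (bond h1 h2 (?t + h1) * (- ?t - 2 * h1) +
     bond h1 h2 ?t * (h1 + 2 * ?t) + bond h1 h2 (?t - h1) * (h1 - ?t)) = 0" by simp
  then show ?thesis by (simp only: serre_term_def c shift_at_same shift_at_other[OF ij(1)] shift_at_other[OF ij(2)]) algebra
qed

lemma coeff_triple:
  assumes "lt i j" "lt j k" "i \<in> J" "j \<in> J" "k \<in> J" "\<And>l. l \<noteq> i \<Longrightarrow> l \<noteq> j \<Longrightarrow> l \<noteq> k \<Longrightarrow> z' l = z l"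
  shows "row_coeff z' i = rest_coeff {i, j, k} z i (z' i)"
    "row_coeff z' j = rest_coeff {i, j, k} z j (z' j) * bond h1 h2 (z' j - z' i)"
    "row_coeff z' k = rest_coeff {i, j, k} z k (z' k) * (bond h1 h2 (z' k - z' i) * bond h1 h2 (z' k - z' j))"
proof -
  have ik: "lt i k" using assms(1,2) lt_trans by blast
  have ne: "i \<noteq> j" using assms by auto
  have s: "{l\<in>{i, j, k}. lt l i} = {}" "{l\<in>{i, j, k}. lt l j} = {i}" "{l\<in>{i, j, k}. lt l k} = {i, j}"
    using assms(1,2) ik lt_asym by auto
  show "row_coeff z' i = rest_coeff {i, j, k} z i (z' i)"
    "row_coeff z' j = rest_coeff {i, j, k} z j (z' j) * bond h1 h2 (z' j - z' i)"
    "row_coeff z' k = rest_coeff {i, j, k} z k (z' k) * (bond h1 h2 (z' k - z' i) * bond h1 h2 (z' k - z' j))"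
    using row_coeff_factor[of "{i, j, k}" z' z i, unfolded s] row_coeff_factor[of "{i, j, k}" z' z j, unfolded s]
      row_coeff_factor[of "{i, j, k}" z' z k, unfolded s] assms ne by simp_all
qed

text \<open>
  Each of the three pairs of rows contributes \<open>p\<close> or \<open>- p\<close> of the difference of coordinates, according to the
  order of the two boxes, over a common denominator; what remains is the polynomial identity above.
\<close>

lemma serre_three_rows:
  assumes "lt i j" "lt j k" "i \<in> J" "j \<in> J" "k \<in> J" "spread h1 J z"
  shows "serre_sum z i j k = 0"
proof -
  have ik: "lt i k" using assms(1,2) lt_trans by blast
  have ne: "i \<noteq> j" "j \<noteq> i" "i \<noteq> k" "k \<noteq> i" "j \<noteq> k" "k \<noteq> j" using assms(1,2) ik by auto
  let ?s = "z j - z i" and ?t = "z k - z i" and ?u = "z k - z j"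
  define r where "r = rest_coeff {i, j, k} z"
  define R where "R = r i (z i) * r j (z j) * r k (z k)"
  note cp = coeff_triple[OF assms(1-5), where z = z, folded r_def]
  let ?b = "\<lambda>t. bond h1 h2 t" and ?p = "structure_cubic h1 h2"
  let ?D = "\<lambda>t. t * (t + h1) * (t - h1)"
  have diffs: "a - (b + h1) = a - b - h1" for a b :: 'k by simp
  have terms:
    "serre_term z i j k = R * (?b (?s - h1) * ?b (?t - h1) * ?b (?u - h1)) * (z i - 2 * z j + z k)"
    "serre_term z i k j = R * (?b (?s - h1) * ?b (?t - h1) * ?b ?u) * (z i - 2 * z k + z j)"
    "serre_term z j i k = R * (?b ?s * ?b (?t - h1) * ?b (?u - h1)) * (z j - 2 * z i + z k)"
    "serre_term z j k i = R * (?b ?s * ?b ?t * ?b (?u - h1)) * (z j - 2 * z k + z i)"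
    "serre_term z k i j = R * (?b (?s - h1) * ?b ?t * ?b ?u) * (z k - 2 * z i + z j)"
    "serre_term z k j i = R * (?b ?s * ?b ?t * ?b ?u) * (z k - 2 * z j + z i)"
    unfolding serre_term_def R_def using ne by (simp_all add: cp diffs mult_ac)
  have nz: "?s \<noteq> h1" "?s \<noteq> - h1" "?t \<noteq> h1" "?t \<noteq> - h1" "?u \<noteq> h1" "?u \<noteq> - h1"
    using spreadD[OF assms(6), of j i] spreadD[OF assms(6), of k i] spreadD[OF assms(6), of k j] assms ne
    by (auto simp: eq_neg_iff_add_eq_0)
  have after: "?b ?s = ?p ?s / ?D ?s" "?b ?t = ?p ?t / ?D ?t" "?b ?u = ?p ?u / ?D ?u"
    using nz by (auto intro!: bond_eq_cubic)
  have before: "?b (?s - h1) = - ?p (z i - z j) / ?D ?s" "?b (?t - h1) = - ?p (z i - z k) / ?D ?t"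
     "?b (?u - h1) = - ?p (z j - z k) / ?D ?u"
    using nz bond_shift_eq_cubic[of ?s h1 h2] bond_shift_eq_cubic[of ?t h1 h2] bond_shift_eq_cubic[of ?u h1 h2]
    by simp_all
  have prod3: "(x / u) * (y / v) * (w / m) = x * y * w / (u * v * m)" for x y w u v m :: 'k by simp
  have "serre_sum z i j k = - R / (?D ?s * ?D ?t * ?D ?u) *
    (?p (z i - z j) * ?p (z i - z k) * ?p (z j - z k) * (z i - 2 * z j + z k)
       - ?p (z i - z k) * ?p (z i - z j) * ?p (z k - z j) * (z i - 2 * z k + z j)
       - ?p (z j - z i) * ?p (z j - z k) * ?p (z i - z k) * (z j - 2 * z i + z k)
       + ?p (z j - z k) * ?p (z j - z i) * ?p (z k - z i) * (z j - 2 * z k + z i)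
       + ?p (z k - z i) * ?p (z k - z j) * ?p (z i - z j) * (z k - 2 * z i + z j)
       - ?p (z k - z j) * ?p (z k - z i) * ?p (z j - z i) * (z k - 2 * z j + z i))"
    unfolding serre_sum_def terms after before prod3
    by (simp only: divide_inverse) algebra
  also have "\<dots> = 0" unfolding serre_cubic_identity[of h1 h2 "z i" "z j" "z k"] by simp
  finally show ?thesis .
qed

lemma serre_sum_swap: "serre_sum z i j k = serre_sum z j i k" "serre_sum z i j k = serre_sum z i k j"
  by (simp_all add: serre_sum_def add_ac)

text \<open>
  The sum is symmetric in the three rows, so they may be taken in increasing order; then either all are
  distinct or some coincide.
\<close>

lemma serre_sum_zero:
  assumes "i \<in> J" "j \<in> J" "k \<in> J" "spread h1 J z"
  shows "serre_sum z i j k = 0"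
proof -
  have two: "serre_sum z a a b = 0" if "a \<in> J" "b \<in> J" for a b
  proof -
    have "serre_sum z a a b = 2 * (serre_term z a a b + serre_term z a b a + serre_term z b a a)"
      by (simp add: serre_sum_def)
    also have "serre_term z a a b + serre_term z a b a + serre_term z b a a = 0"
    proof (cases "a = b")
      case True
      then show ?thesis by (simp add: serre_single_row)
    next
      case False
      then show ?thesis
        using serre_two_rows_lower[of a b z] serre_two_rows_upper[of b a z] lt_total[of a b] that assms(4) by auto
    qed
    also have "2 * 0 = (0::'k)" by simp
    finally show ?thesis .
  qed
  have three: "serre_sum z a b d = 0" if "lt a b" "lt b d" "{a, b, d} = {i, j, k}" for a b d
  proof -
    have "{a, b, d} \<subseteq> J" unfolding that(3) using assms by simp
    then show ?thesis using serre_three_rows[of a b d z] that(1,2) assms(4) by simp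
  qed
  consider "i = j" | "j = k" | "i = k" | "lt i j" "lt j k" | "lt i k" "lt k j" | "lt j i" "lt i k" | "lt j k" "lt k i"
    | "lt k i" "lt i j" | "lt k j" "lt j i"
    using lt_total by blast
  then show ?thesis
  proof cases
    case 1
    then show ?thesis using two assms by simp
  next
    case 2
    then show ?thesis using two[of k i] assms by (metis serre_sum_swap)
  next
    case 3
    then show ?thesis using two[of i j] assms by (metis serre_sum_swap)
  next
    case 4
    then show ?thesis using three[of i j k] by auto
  next
    case 5
    then show ?thesis using three[of i k j] by (metis serre_sum_swap insert_commute)
  next
    case 6
    then show ?thesis using three[of j i k] by (metis serre_sum_swap insert_commute)
  next
    case 7
    then show ?thesis using three[of j k i] by (metis serre_sum_swap insert_commute)
  next
    case 8
    then show ?thesis using three[of k i j] by (metis serre_sum_swap insert_commute)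
  next
    case 9
    then show ?thesis using three[of k j i] by (metis serre_sum_swap insert_commute)
  qed
qed

end

section \<open>The relations among raising operators\<close>

abbreviation lookup :: "('b \<Rightarrow>\<^sub>0 'k::zero) \<Rightarrow> 'b \<Rightarrow> 'k" where "lookup \<equiv> Poly_Mapping.lookup"

abbreviation keys :: "('b \<Rightarrow>\<^sub>0 'k::zero) \<Rightarrow> 'b set" where "keys \<equiv> Poly_Mapping.keys"

abbreviation linear_op :: "(('b, 'k::field) based_space \<Rightarrow> ('c, 'k) based_space) \<Rightarrow> bool" where
  "linear_op \<equiv> Vector_Spaces.linear vscale vscale"

text \<open>
  Adding boxes in rows \<open>i\<close> and \<open>j\<close> in either order leads to the same basis vector (the factor \<open>s\<close>), so
  only the symmetric part of the coefficients matters.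
\<close>

lemma symmetric_double_sum_eq_zero:
  fixes a s :: "'i \<Rightarrow> 'i \<Rightarrow> 'k::field"
  assumes "(2::'k) \<noteq> 0" and "\<And>i j. i \<in> J \<Longrightarrow> j \<in> J \<Longrightarrow> a i j + a j i = 0"
    and "\<And>i j. s i j = s j i"
  shows "(\<Sum>i\<in>J. \<Sum>j\<in>J. a i j * s i j) = 0"
proof -
  have "(\<Sum>i\<in>J. \<Sum>j\<in>J. a i j * s i j) = (\<Sum>i\<in>J. \<Sum>j\<in>J. a j i * s i j)"
    by (subst sum.swap) (simp add: assms(3))
  then have "2 * (\<Sum>i\<in>J. \<Sum>j\<in>J. a i j * s i j) = (\<Sum>i\<in>J. \<Sum>j\<in>J. (a i j + a j i) * s i j)"
    by (simp add: distrib_right sum.distrib)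
  also have "\<dots> = 0" using assms(2) by (intro sum.neutral ballI) simp
  finally show ?thesis using assms(1) by simp
qed

lemma symmetric_triple_sum_eq_zero:
  fixes a s :: "'i \<Rightarrow> 'i \<Rightarrow> 'i \<Rightarrow> 'k::field"
  assumes "(6::'k) \<noteq> 0"
    and "\<And>i j k. i \<in> J \<Longrightarrow> j \<in> J \<Longrightarrow> k \<in> J \<Longrightarrow> a i j k + a i k j + a j i k + a j k i + a k i j + a k j i = 0"
    and s: "\<And>i j k. s i j k = s j i k" "\<And>i j k. s i j k = s i k j"
  shows "(\<Sum>i\<in>J. \<Sum>j\<in>J. \<Sum>k\<in>J. a i j k * s i j k) = 0"
proof -
  let ?S = "\<lambda>f. (\<Sum>i\<in>J. \<Sum>j\<in>J. \<Sum>k\<in>J. f i j k * s i j k)"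
  have swap12: "?S (\<lambda>i j k. f j i k) = ?S f" for f
    by (subst sum.swap) (simp add: s(1))
  have swap23: "?S (\<lambda>i j k. f i k j) = ?S f" for f
    by (rule sum.cong[OF refl], subst sum.swap) (simp add: s(2))
  have "?S (\<lambda>i j k. a i k j) = ?S a" "?S (\<lambda>i j k. a j i k) = ?S a"
    by (rule swap23 swap12)+
  moreover have "?S (\<lambda>i j k. a k i j) = ?S a"
    using swap23[of "\<lambda>i j k. a j i k"] swap12[of a] by simp
  moreover have "?S (\<lambda>i j k. a j k i) = ?S a"
    using swap12[of "\<lambda>i j k. a i k j"] swap23[of a] by simp
  moreover have "?S (\<lambda>i j k. a k j i) = ?S a"
    using swap23[of "\<lambda>i j k. a j k i"] swap12[of "\<lambda>i j k. a i k j"] swap23[of a] by simp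
  ultimately have "6 * ?S a = ?S (\<lambda>i j k. a i j k + a i k j + a j i k + a j k i + a k i j + a k j i)"
    by (simp add: distrib_right sum.distrib)
  also have "\<dots> = 0" using assms(2) by (intro sum.neutral ballI) simp
  finally show ?thesis using assms(1) by simp
qed

lemma linear_vscale_sum:
  assumes "linear_op A"
  shows "A (\<Sum>i\<in>I. vscale (a i) (v i)) = (\<Sum>i\<in>I. vscale (a i) (A (v i)))"
proof -
  interpret Vector_Spaces.linear vscale vscale A by (rule assms)
  show ?thesis by (simp add: sum scale)
qed

lemma vscale_zero [simp]: "vscale 0 v = 0"
  by (rule poly_mapping_eqI) simp

definition op_commutator :: "('v \<Rightarrow> 'v) \<Rightarrow> ('v \<Rightarrow> 'v) \<Rightarrow> 'v \<Rightarrow> 'v::ab_group_add" where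
  "op_commutator A B v = A (B v) - B (A v)"

text \<open>
  The left-hand sides of the cubic and the Serre relations, for operators instead of elements of the free algebra.
  The six words in \<open>op_serre\<close> are the terms of the symmetrization.
\<close>

definition op_cubic ::
  "'k::field \<Rightarrow> (nat \<Rightarrow> ('b, 'k) based_space \<Rightarrow> ('b, 'k) based_space) \<Rightarrow>
   (nat \<Rightarrow> ('b, 'k) based_space \<Rightarrow> ('b, 'k) based_space) \<Rightarrow> nat \<Rightarrow> nat \<Rightarrow> ('b, 'k) based_space \<Rightarrow> ('b, 'k) based_space"
where
  "op_cubic \<sigma>2 A B i j v =
     op_commutator (A (i + 3)) (B j) v - vscale 3 (op_commutator (A (i + 2)) (B (j + 1)) v)
     + vscale 3 (op_commutator (A (i + 1)) (B (j + 2)) v) - op_commutator (A i) (B (j + 3)) v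
     + vscale \<sigma>2 (op_commutator (A (i + 1)) (B j) v - op_commutator (A i) (B (j + 1)) v)"

definition op_serre_word :: "(nat \<Rightarrow> 'v \<Rightarrow> 'v) \<Rightarrow> nat \<Rightarrow> nat \<Rightarrow> nat \<Rightarrow> 'v \<Rightarrow> 'v::ab_group_add" where
  "op_serre_word A p q r v =
     A p (A q (A (r + 1) v)) - A p (A (r + 1) (A q v)) - A q (A (r + 1) (A p v)) + A (r + 1) (A q (A p v))"

definition op_serre :: "(nat \<Rightarrow> 'v \<Rightarrow> 'v) \<Rightarrow> nat \<Rightarrow> nat \<Rightarrow> nat \<Rightarrow> 'v \<Rightarrow> 'v::ab_group_add" where
  "op_serre A p q r v =
     op_serre_word A p q r v + op_serre_word A p r q v + op_serre_word A q p r v +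
     op_serre_word A q r p v + op_serre_word A r p q v + op_serre_word A r q p v"

text \<open>
  Operators \<open>e p\<close> that act on the vectors \<open>K z\<close> by adding boxes. A description with finitely many rows is
  correct only as long as no box is added below the last of them; \<open>Y d\<close> is the set of those states for which \<open>d\<close> more
  steps are harmless. A function of the coordinates that need not come from a diagram can serve as \<open>K\<close>, because
  steps that leave the set of admissible states have coefficient 0.
\<close>

locale raising_operators = linearly_ordered_rows h1 h2 J lt c
  for h1 h2 :: "'k::field" and J :: "'i set" and lt c +
  fixes K :: "('i \<Rightarrow> 'k) \<Rightarrow> ('b, 'k) based_space"
    and e :: "nat \<Rightarrow> ('b, 'k) based_space \<Rightarrow> ('b, 'k) based_space"
    and Y :: "nat \<Rightarrow> ('i \<Rightarrow> 'k) set"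
  assumes linear_e: "linear_op (e p)"
    and action: "z \<in> Y (Suc d) \<Longrightarrow> e p (K z) = (\<Sum>i\<in>J. vscale (z i ^ p * row_coeff z i) (K (move z i)))"
    and closed: "z \<in> Y (Suc d) \<Longrightarrow> i \<in> J \<Longrightarrow> row_coeff z i \<noteq> 0 \<Longrightarrow> move z i \<in> Y d"
    and spread_Y: "z \<in> Y d \<Longrightarrow> spread h1 J z"
    and char_ne_2_3: "(2::'k) \<noteq> 0" "(3::'k) \<noteq> 0"
begin

lemma vscale_action:
  assumes "z \<in> Y (Suc (Suc d))" "i \<in> J"
  shows "vscale (t * row_coeff z i) (e p (K (move z i))) =
    vscale (t * row_coeff z i) (\<Sum>j\<in>J. vscale (move z i j ^ p * row_coeff (move z i) j) (K (move (move z i) j)))"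
  using closed[OF assms] action by (cases "row_coeff z i = 0") auto

lemma word2:
  assumes "z \<in> Y 2"
  shows "lookup (e a (e b (K z))) x =
    (\<Sum>i\<in>J. \<Sum>j\<in>J. (z i ^ b * move z i j ^ a) *
       (row_coeff z i * row_coeff (move z i) j * lookup (K (move (move z i) j)) x))"
proof -
  have z: "z \<in> Y (Suc (Suc 0))" using assms by (simp add: numeral_2_eq_2)
  have "e a (e b (K z)) = (\<Sum>i\<in>J. vscale (z i ^ b * row_coeff z i) (e a (K (move z i))))"
    by (simp only: action[OF z] linear_vscale_sum[OF linear_e])
  also have "\<dots> = (\<Sum>i\<in>J. vscale (z i ^ b * row_coeff z i)
     (\<Sum>j\<in>J. vscale (move z i j ^ a * row_coeff (move z i) j) (K (move (move z i) j))))"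
    by (rule sum.cong[OF refl]) (rule vscale_action[OF z])
  finally show ?thesis by (simp add: lookup_sum sum_distrib_left mult_ac)
qed

lemma word3:
  assumes "z \<in> Y 3"
  shows "lookup (e a (e b (e c' (K z)))) x =
    (\<Sum>i\<in>J. \<Sum>j\<in>J. \<Sum>k\<in>J. (z i ^ c' * move z i j ^ b * move (move z i) j k ^ a) *
       (row_coeff z i * row_coeff (move z i) j * row_coeff (move (move z i) j) k *
        lookup (K (move (move (move z i) j) k)) x))"
proof -
  have z: "z \<in> Y (Suc (Suc (Suc 0)))" using assms by (simp add: numeral_3_eq_3)
  have *: "t * row_coeff z i * lookup (e a (e b (K (move z i)))) x =
      t * row_coeff z i * (\<Sum>j\<in>J. \<Sum>k\<in>J. (move z i j ^ b * move (move z i) j k ^ a) *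
       (row_coeff (move z i) j * row_coeff (move (move z i) j) k * lookup (K (move (move (move z i) j) k)) x))"
    if "i \<in> J" for i t
    using closed[OF z that] word2[of "move z i" a b x] by (cases "row_coeff z i = 0") (auto simp: numeral_2_eq_2)
  have "e a (e b (e c' (K z))) = (\<Sum>i\<in>J. vscale (z i ^ c' * row_coeff z i) (e a (e b (K (move z i)))))"
    by (simp only: action[OF z] linear_vscale_sum[OF linear_e])
  then have "lookup (e a (e b (e c' (K z)))) x = (\<Sum>i\<in>J. z i ^ c' * row_coeff z i * lookup (e a (e b (K (move z i)))) x)"
    by (simp add: lookup_sum)
  also have "\<dots> = (\<Sum>i\<in>J. z i ^ c' * row_coeff z i * (\<Sum>j\<in>J. \<Sum>k\<in>J. (move z i j ^ b * move (move z i) j k ^ a) *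
       (row_coeff (move z i) j * row_coeff (move (move z i) j) k * lookup (K (move (move (move z i) j) k)) x)))"
    by (rule sum.cong[OF refl]) (rule *)
  finally show ?thesis by (simp add: sum_distrib_left mult_ac)
qed

text \<open>
  The coefficient of the state with boxes in rows \<open>i\<close> and \<open>j\<close> is a symmetric function of the two weights times
  the exchange identity. If \<open>i = j\<close>, the second weight exceeds the first by \<open>h1\<close>, a zero of the structure cubic.
\<close>

theorem cubic_relation:
  assumes "z \<in> Y 2"
  shows "op_cubic (sigma2 h1 h2 (- h1 - h2)) e e m n (K z) =
    vscale (sigma3 h1 h2 (- h1 - h2)) (e m (e n (K z)) + e n (e m (K z)))"
proof (rule poly_mapping_eqI)
  fix x
  let ?s2 = "sigma2 h1 h2 (- h1 - h2)" and ?s3 = "sigma3 h1 h2 (- h1 - h2)"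
  let ?W = "\<lambda>i j. row_coeff z i * row_coeff (move z i) j * lookup (K (move (move z i) j)) x"
  define T :: "('k \<Rightarrow> 'k \<Rightarrow> 'k) \<Rightarrow> 'k" where "T = (\<lambda>g. \<Sum>i\<in>J. \<Sum>j\<in>J. g (z i) (move z i j) * ?W i j)"
  have w: "lookup (e a (e b (K z))) x = T (\<lambda>u v. u ^ b * v ^ a)" for a b
    unfolding T_def by (rule word2[OF assms])
  have add: "T f + T g = T (\<lambda>u v. f u v + g u v)" for f g
    unfolding T_def by (simp add: distrib_right sum.distrib)
  have diff: "T f - T g = T (\<lambda>u v. f u v - g u v)" for f g
    unfolding T_def by (simp add: left_diff_distrib sum_subtractf)
  have scale: "t * T f = T (\<lambda>u v. t * f u v)" for f t
    unfolding T_def by (simp add: sum_distrib_left mult.assoc)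
  have "lookup (op_cubic ?s2 e e m n (K z)) x -
     lookup (vscale ?s3 (e m (e n (K z)) + e n (e m (K z)))) x =
    T (\<lambda>u v. (v ^ m * u ^ n + v ^ n * u ^ m) * structure_cubic h1 h2 (v - u))"
    unfolding op_cubic_def op_commutator_def lookup_add lookup_minus lookup_vscale w add diff scale
    by (rule arg_cong[where f = T], intro ext)
      (simp add: power_add structure_cubic_def sigma2_def sigma3_def eval_nat_numeral, algebra)
  also have "\<dots> = (\<Sum>i\<in>J. \<Sum>j\<in>J. (row_coeff z i * row_coeff (move z i) j * structure_cubic h1 h2 (move z i j - z i)) *
     ((move z i j ^ m * z i ^ n + move z i j ^ n * z i ^ m) * lookup (K (move (move z i) j)) x))"
    unfolding T_def by (simp only: mult_ac)
  also have "\<dots> = 0"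
  proof (rule symmetric_double_sum_eq_zero[OF char_ne_2_3(1)])
    fix i j assume "i \<in> J" "j \<in> J"
    show "row_coeff z i * row_coeff (move z i) j * structure_cubic h1 h2 (move z i j - z i) +
       row_coeff z j * row_coeff (move z j) i * structure_cubic h1 h2 (move z j i - z j) = 0"
    proof (cases "i = j")
      case True
      then show ?thesis by (simp add: structure_cubic_def)
    next
      case False
      then show ?thesis using exchange[of i j z] spread_Y[OF assms] \<open>i \<in> J\<close> \<open>j \<in> J\<close> by simp
    qed
  next
    fix i j
    show "(move z i j ^ m * z i ^ n + move z i j ^ n * z i ^ m) * lookup (K (move (move z i) j)) x =
      (move z j i ^ m * z j ^ n + move z j i ^ n * z j ^ m) * lookup (K (move (move z j) i)) x"
      unfolding shift_at_commute[of h1 h1 z i j]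
      by (cases "i = j") (simp_all add: add.commute mult.commute)
  qed
  finally show "lookup (op_cubic ?s2 e e m n (K z)) x =
     lookup (vscale ?s3 (e m (e n (K z)) + e n (e m (K z)))) x" by simp
qed

text \<open>
  As in the cubic relation: a symmetric function of the three weights splits off, and the remaining
  factor sums to 0 over the orders of adding the boxes.
\<close>

theorem serre_relation:
  assumes "z \<in> Y 3"
  shows "op_serre e p q r (K z) = 0"
proof (rule poly_mapping_eqI)
  fix x
  \<comment> \<open>the symmetrized monomial; it is insensitive to the order in which the boxes are added\<close>
  define sym where "sym = (\<lambda>u v w :: 'k. u ^ p * v ^ q * w ^ r + u ^ p * v ^ r * w ^ q + u ^ q * v ^ p * w ^ r +
     u ^ q * v ^ r * w ^ p + u ^ r * v ^ p * w ^ q + u ^ r * v ^ q * w ^ p)"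
  have sym_swap: "sym u v w = sym v u w" "sym u v w = sym u w v" for u v w
    unfolding sym_def by (simp_all add: ac_simps)
  let ?L = "\<lambda>i j k. lookup (K (move (move (move z i) j) k)) x"
  let ?W = "\<lambda>i j k. row_coeff z i * row_coeff (move z i) j * row_coeff (move (move z i) j) k * ?L i j k"
  define T :: "('k \<Rightarrow> 'k \<Rightarrow> 'k \<Rightarrow> 'k) \<Rightarrow> 'k" where "T = (\<lambda>g. \<Sum>i\<in>J. \<Sum>j\<in>J. \<Sum>k\<in>J. g (z i) (move z i j) (move (move z i) j k) * ?W i j k)"
  have w: "lookup (e a (e b (e c' (K z)))) x = T (\<lambda>u v w. u ^ c' * v ^ b * w ^ a)" for a b c'
    unfolding T_def by (rule word3[OF assms])
  have add: "T f + T g = T (\<lambda>u v w. f u v w + g u v w)" for f g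
    unfolding T_def by (simp add: distrib_right sum.distrib)
  have diff: "T f - T g = T (\<lambda>u v w. f u v w - g u v w)" for f g
    unfolding T_def by (simp add: left_diff_distrib sum_subtractf)
  have "lookup (op_serre e p q r (K z)) x = T (\<lambda>u v w. (u - 2 * v + w) * sym u v w)"
    unfolding op_serre_def op_serre_word_def lookup_add lookup_minus w add diff
    by (rule arg_cong[where f = T], intro ext) (simp add: sym_def power_add, algebra)
  also have "\<dots> = (\<Sum>i\<in>J. \<Sum>j\<in>J. \<Sum>k\<in>J. serre_term z i j k * (sym (z i) (move z i j) (move (move z i) j k) * ?L i j k))"
    unfolding T_def serre_term_def by (simp only: mult_ac)
  also have "\<dots> = 0"
  proof (rule symmetric_triple_sum_eq_zero)
    have "(6::'k) = 2 * 3" by simp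
    then show "(6::'k) \<noteq> 0" using char_ne_2_3 by (metis mult_eq_0_iff)
    show "serre_term z i j k + serre_term z i k j + serre_term z j i k + serre_term z j k i + serre_term z k i j +
       serre_term z k j i = 0" if "i \<in> J" "j \<in> J" "k \<in> J" for i j k
      using serre_sum_zero[OF that spread_Y[OF assms]] by (simp only: serre_sum_def)
    show "sym (z i) (move z i j) (move (move z i) j k) * ?L i j k =
      sym (z j) (move z j i) (move (move z j) i k) * ?L j i k" for i j k
      unfolding shift_at_commute[of h1 h1 z i j]
      by (cases "i = j") (auto simp: shift_at_def sym_swap(1))
    show "sym (z i) (move z i j) (move (move z i) j k) * ?L i j k =
      sym (z i) (move z i k) (move (move z i) k j) * ?L i k j" for i j k
      unfolding shift_at_commute[of h1 h1 "move z i" j k]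
      by (cases "j = k") (auto simp: shift_at_def sym_swap(2))
  qed
  finally show "lookup (op_serre e p q r (K z)) x = lookup 0 x" by simp
qed

end

section \<open>The Cartan series\<close>

definition lin_fps :: "'k::field \<Rightarrow> 'k fps" where
  "lin_fps a = 1 - fps_const a * fps_X"

lemma lin_delta_plus: "lin_fps b * delta_plus b = 1"
  using delta_plus_inverse[of b] by (simp add: lin_fps_def mult.commute)

lemma fps_nth_prod_0: "fps_nth (\<Prod>i\<in>I. A i) 0 = (\<Prod>i\<in>I. fps_nth (A i) 0 :: 'k::field)"
  by (induction I rule: infinite_finite_induct) simp_all

text \<open>
  Comparing coefficients in the equation \<open>B \<Prod>\<^sub>k (1 - (\<chi> + h\<^sub>k) X) = A \<Prod>\<^sub>k (1 - (\<chi> - h\<^sub>k) X)\<close>. As \<open>h\<^sub>1 + h\<^sub>2 + h\<^sub>3 = 0\<close>,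
  the two cubic polynomials in \<open>X\<close> differ only in the sign of \<open>\<sigma>\<^sub>3\<close> in their last coefficient.
\<close>

lemma psi_recursion_nth:
  fixes A B :: "'k::field fps" and \<chi> h1 h2 :: 'k
  defines "p2 \<equiv> sigma2 h1 h2 (- h1 - h2)" and "p3 \<equiv> sigma3 h1 h2 (- h1 - h2)"
  assumes rec: "B * (lin_fps (\<chi> + h1) * lin_fps (\<chi> + h2) * lin_fps (\<chi> - h1 - h2)) =
     A * (lin_fps (\<chi> - h1) * lin_fps (\<chi> - h2) * lin_fps (\<chi> + h1 + h2))"
  shows "fps_nth B 0 = fps_nth A 0"
    "fps_nth B 1 - 3 * \<chi> * fps_nth B 0 = fps_nth A 1 - 3 * \<chi> * fps_nth A 0"
    "fps_nth B 2 - 3 * \<chi> * fps_nth B 1 + (3 * \<chi>\<^sup>2 + p2) * fps_nth B 0 =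
       fps_nth A 2 - 3 * \<chi> * fps_nth A 1 + (3 * \<chi>\<^sup>2 + p2) * fps_nth A 0"
    "fps_nth B (n + 3) - 3 * \<chi> * fps_nth B (n + 2) + (3 * \<chi>\<^sup>2 + p2) * fps_nth B (n + 1) - (\<chi> ^ 3 + p2 * \<chi> + p3) * fps_nth B n =
       fps_nth A (n + 3) - 3 * \<chi> * fps_nth A (n + 2) + (3 * \<chi>\<^sup>2 + p2) * fps_nth A (n + 1) - (\<chi> ^ 3 + p2 * \<chi> - p3) * fps_nth A n"
proof -
  let ?X = "fps_X :: 'k fps"
  have expand: "lin_fps a * lin_fps b * lin_fps d =
    1 - fps_const (a + b + d) * ?X + fps_const (a * b + a * d + b * d) * (?X * ?X) - fps_const (a * b * d) * (?X * (?X * ?X))"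
    for a b d :: 'k
    unfolding lin_fps_def fps_const_add[symmetric] fps_const_mult[symmetric] by algebra
  have L: "lin_fps (\<chi> + h1) * lin_fps (\<chi> + h2) * lin_fps (\<chi> - h1 - h2) =
    1 - fps_const (3 * \<chi>) * ?X + fps_const (3 * \<chi>\<^sup>2 + p2) * (?X * ?X) - fps_const (\<chi> ^ 3 + p2 * \<chi> + p3) * (?X * (?X * ?X))"
  proof -
    have "\<chi> + h1 + (\<chi> + h2) + (\<chi> - h1 - h2) = 3 * \<chi>" by simp
    moreover have "(\<chi> + h1) * (\<chi> + h2) + (\<chi> + h1) * (\<chi> - h1 - h2) + (\<chi> + h2) * (\<chi> - h1 - h2) = 3 * \<chi>\<^sup>2 + p2"
      unfolding p2_def sigma2_def by algebra
    moreover have "(\<chi> + h1) * (\<chi> + h2) * (\<chi> - h1 - h2) = \<chi> ^ 3 + p2 * \<chi> + p3"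
      unfolding p2_def sigma2_def p3_def sigma3_def by algebra
    ultimately show ?thesis unfolding expand by simp
  qed
  have R: "lin_fps (\<chi> - h1) * lin_fps (\<chi> - h2) * lin_fps (\<chi> + h1 + h2) =
    1 - fps_const (3 * \<chi>) * ?X + fps_const (3 * \<chi>\<^sup>2 + p2) * (?X * ?X) - fps_const (\<chi> ^ 3 + p2 * \<chi> - p3) * (?X * (?X * ?X))"
  proof -
    have "\<chi> - h1 + (\<chi> - h2) + (\<chi> + h1 + h2) = 3 * \<chi>" by simp
    moreover have "(\<chi> - h1) * (\<chi> - h2) + (\<chi> - h1) * (\<chi> + h1 + h2) + (\<chi> - h2) * (\<chi> + h1 + h2) = 3 * \<chi>\<^sup>2 + p2"
      unfolding p2_def sigma2_def by algebra
    moreover have "(\<chi> - h1) * (\<chi> - h2) * (\<chi> + h1 + h2) = \<chi> ^ 3 + p2 * \<chi> - p3"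
      unfolding p2_def sigma2_def p3_def sigma3_def by algebra
    ultimately show ?thesis unfolding expand by simp
  qed
  have nth: "fps_nth (C * (1 - fps_const u * ?X + fps_const v * (?X * ?X) - fps_const w * (?X * (?X * ?X)))) m =
     fps_nth C m - u * (if m < 1 then 0 else fps_nth C (m - 1)) + v * (if m < 2 then 0 else fps_nth C (m - 2)) -
     w * (if m < 3 then 0 else fps_nth C (m - 3))" for C u v w m
  proof -
    have "C * (1 - fps_const u * ?X + fps_const v * (?X * ?X) - fps_const w * (?X * (?X * ?X))) =
      C - fps_const u * (C * ?X ^ 1) + fps_const v * (C * ?X ^ 2) - fps_const w * (C * ?X ^ 3)"
      by algebra
    then show ?thesis by (simp only: fps_add_nth fps_sub_nth fps_mult_left_const_nth fps_X_power_mult_right_nth)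
  qed
  have eq: "fps_nth (B * (lin_fps (\<chi> + h1) * lin_fps (\<chi> + h2) * lin_fps (\<chi> - h1 - h2))) m =
     fps_nth (A * (lin_fps (\<chi> - h1) * lin_fps (\<chi> - h2) * lin_fps (\<chi> + h1 + h2))) m" for m
    by (simp only: rec)
  note e = eq[unfolded L R nth]
  show "fps_nth B 0 = fps_nth A 0" using e[of 0] by simp
  show "fps_nth B 1 - 3 * \<chi> * fps_nth B 0 = fps_nth A 1 - 3 * \<chi> * fps_nth A 0" using e[of 1] by simp
  show "fps_nth B 2 - 3 * \<chi> * fps_nth B 1 + (3 * \<chi>\<^sup>2 + p2) * fps_nth B 0 =
       fps_nth A 2 - 3 * \<chi> * fps_nth A 1 + (3 * \<chi>\<^sup>2 + p2) * fps_nth A 0" using e[of 2] by simp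
  have "n + 3 - 1 = n + 2" "n + 3 - 2 = n + 1" by simp_all
  then show "fps_nth B (n + 3) - 3 * \<chi> * fps_nth B (n + 2) + (3 * \<chi>\<^sup>2 + p2) * fps_nth B (n + 1) - (\<chi> ^ 3 + p2 * \<chi> + p3) * fps_nth B n =
       fps_nth A (n + 3) - 3 * \<chi> * fps_nth A (n + 2) + (3 * \<chi>\<^sup>2 + p2) * fps_nth A (n + 1) - (\<chi> ^ 3 + p2 * \<chi> - p3) * fps_nth A n"
    using e[of "n + 3"] by simp
qed

text \<open>
  All relations between \<open>\<psi>\<close> and \<open>e\<close>, \<open>f\<close> come from this equation between the eigenvalues before (\<open>A\<close>) and after (\<open>B\<close>)
  a box of weight \<open>\<chi>\<close> has been added.
\<close>

lemma psi_recursion_modes: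
  fixes A B :: "'k::field fps" and \<chi> h1 h2 :: 'k
  defines "p2 \<equiv> sigma2 h1 h2 (- h1 - h2)" and "p3 \<equiv> sigma3 h1 h2 (- h1 - h2)"
  assumes rec: "B * (lin_fps (\<chi> + h1) * lin_fps (\<chi> + h2) * lin_fps (\<chi> - h1 - h2)) =
     A * (lin_fps (\<chi> - h1) * lin_fps (\<chi> - h2) * lin_fps (\<chi> + h1 + h2))"
    and A0: "fps_nth A 0 = 1" and p3: "p3 \<noteq> 0"
  defines "b \<equiv> psi_mode p3 B" and "a \<equiv> psi_mode p3 A"
  shows "b 0 = a 0" "b 1 = a 1" "b 2 = a 2 + 2"
    "(b (n + 3) - a (n + 3)) - 3 * ((b (n + 2) - a (n + 2)) * \<chi>) + 3 * ((b (n + 1) - a (n + 1)) * \<chi> ^ 2) -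
      (b n - a n) * \<chi> ^ 3 + p2 * ((b (n + 1) - a (n + 1)) - (b n - a n) * \<chi>) = p3 * (b n + a n)"
proof -
  note r = psi_recursion_nth[OF rec, folded p2_def p3_def]
  have nth: "fps_nth B (n + 1) = p3 * b n" "fps_nth A (n + 1) = p3 * a n" for n
    using p3 by (simp_all add: b_def a_def psi_mode_def mode_def)
  have n1: "fps_nth B 1 = p3 * b 0" "fps_nth A 1 = p3 * a 0" "fps_nth B 2 = p3 * b 1" "fps_nth A 2 = p3 * a 1"
    "fps_nth B 3 = p3 * b 2" "fps_nth A 3 = p3 * a 2"
    using nth[of 0] nth[of 1] nth[of 2] by (simp_all add: numeral_eq_Suc)
  have B0: "fps_nth B 0 = 1" using r(1) A0 by simp
  show b0: "b 0 = a 0" using r(2) p3 unfolding n1 B0 A0 by simp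
  show b1: "b 1 = a 1" using r(3) p3 unfolding n1 B0 A0 b0 by simp
  have "p3 * b 2 = p3 * (a 2 + 2)" using r(4)[of 0] unfolding add_0 n1 B0 A0 b0 b1 by algebra
  then show "b 2 = a 2 + 2" using p3 by simp
  have m: "n + 1 + 3 = (n + 3) + 1" "n + 1 + 2 = (n + 2) + 1" by simp_all
  have "p3 * ((b (n + 3) - a (n + 3)) - 3 * ((b (n + 2) - a (n + 2)) * \<chi>) + 3 * ((b (n + 1) - a (n + 1)) * \<chi> ^ 2) -
      (b n - a n) * \<chi> ^ 3 + p2 * ((b (n + 1) - a (n + 1)) - (b n - a n) * \<chi>)) = p3 * (p3 * (b n + a n))"
    using r(4)[of "n + 1"] unfolding m nth by algebra
  then show "(b (n + 3) - a (n + 3)) - 3 * ((b (n + 2) - a (n + 2)) * \<chi>) + 3 * ((b (n + 1) - a (n + 1)) * \<chi> ^ 2) -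
      (b n - a n) * \<chi> ^ 3 + p2 * ((b (n + 1) - a (n + 1)) - (b n - a n) * \<chi>) = p3 * (b n + a n)"
    using p3 by simp
qed

text \<open>
  The coefficient of removing a box sees the later rows instead of the earlier ones. The factor \<open>d i\<close> is
  evaluated at the weight \<open>y i - h1\<close> of the removed box.
\<close>

definition lowering_coeff ::
  "'k::field \<Rightarrow> 'k \<Rightarrow> 'i set \<Rightarrow> ('i \<Rightarrow> 'i \<Rightarrow> bool) \<Rightarrow> ('i \<Rightarrow> 'k \<Rightarrow> 'k) \<Rightarrow> ('i \<Rightarrow> 'k) \<Rightarrow> 'i \<Rightarrow> 'k" where
  "lowering_coeff h1 h2 J lt d y i = d i (y i - h1) * (\<Prod>j\<in>{j\<in>J. lt i j}. bond h1 h2 (y j - y i))"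

text \<open>
  The expansion at infinity of the product of the structure function over the rows in \<open>J\<close>, and of finitely
  many further simple fractions, which stand for the infinitely many empty rows below.
\<close>

definition rows_psi_series ::
  "'k::field \<Rightarrow> 'k \<Rightarrow> 'i set \<Rightarrow> 't set \<Rightarrow> ('t \<Rightarrow> 'k) \<Rightarrow> ('t \<Rightarrow> 'k) \<Rightarrow> ('i \<Rightarrow> 'k) \<Rightarrow> 'k fps" where
  "rows_psi_series h1 h2 J T tz tp y =
     (\<Prod>i\<in>J. lin_fps (y i + h2) * lin_fps (y i - h1 - h2) * (delta_plus (y i) * delta_plus (y i - h1))) *
     (\<Prod>t\<in>T. lin_fps (tz t) * delta_plus (tp t))"

text \<open>
  Commuting diagonal operators \<open>psi\<close> past operators \<open>x\<close> that change the eigenvalues from \<open>a\<close> to \<open>b i\<close>. This applies both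
  to \<open>e\<close> and to \<open>f\<close>.
\<close>

context
  fixes psi x :: "nat \<Rightarrow> ('b, 'k::field) based_space \<Rightarrow> ('b, 'k) based_space"
    and v :: "('b, 'k) based_space" and k :: "'i \<Rightarrow> ('b, 'k) based_space"
    and J :: "'i set" and \<chi> w :: "'i \<Rightarrow> 'k" and a :: "nat \<Rightarrow> 'k" and b :: "'i \<Rightarrow> nat \<Rightarrow> 'k"
  assumes lin: "linear_op (psi m)" "linear_op (x n)"
    and x_v: "x n v = (\<Sum>i\<in>J. vscale (\<chi> i ^ n * w i) (k i))"
    and psi_v: "psi m v = vscale (a m) v"
    and psi_k: "i \<in> J \<Longrightarrow> w i \<noteq> 0 \<Longrightarrow> psi m (k i) = vscale (b i m) (k i)"
begin

lemma diagonal_commutator: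
  "op_commutator (psi m) (x n) v = (\<Sum>i\<in>J. vscale ((b i m - a m) * \<chi> i ^ n * w i) (k i))"
  "psi m (x n v) + x n (psi m v) = (\<Sum>i\<in>J. vscale ((b i m + a m) * \<chi> i ^ n * w i) (k i))"
proof -
  have "psi m (x n v) = (\<Sum>i\<in>J. vscale (\<chi> i ^ n * w i) (psi m (k i)))"
    by (simp only: x_v linear_vscale_sum[OF lin(1)])
  also have "\<dots> = (\<Sum>i\<in>J. vscale (b i m * \<chi> i ^ n * w i) (k i))"
  proof (rule sum.cong[OF refl])
    fix i assume "i \<in> J"
    then show "vscale (\<chi> i ^ n * w i) (psi m (k i)) = vscale (b i m * \<chi> i ^ n * w i) (k i)"
      using psi_k[of i m] by (cases "w i = 0") (auto intro!: poly_mapping_eqI)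
  qed
  finally have 1: "psi m (x n v) = \<dots>" .
  have 2: "x n (psi m v) = (\<Sum>i\<in>J. vscale (a m * \<chi> i ^ n * w i) (k i))"
    using linear_vscale_sum[OF lin(2), of n "\<lambda>_. a m" "\<lambda>_. v" "{()}"]
    by (auto intro!: poly_mapping_eqI simp: psi_v x_v lookup_sum sum_distrib_left mult.assoc)
  show "op_commutator (psi m) (x n) v = (\<Sum>i\<in>J. vscale ((b i m - a m) * \<chi> i ^ n * w i) (k i))"
    "psi m (x n v) + x n (psi m v) = (\<Sum>i\<in>J. vscale ((b i m + a m) * \<chi> i ^ n * w i) (k i))"
    unfolding op_commutator_def 1 2
    by (auto intro!: poly_mapping_eqI simp: lookup_sum lookup_minus lookup_add left_diff_distrib distrib_right sum_subtractf sum.distrib)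
qed

lemma diagonal_cubic:
  assumes rec: "\<And>i. i \<in> J \<Longrightarrow> (b i (m + 3) - a (m + 3)) - 3 * ((b i (m + 2) - a (m + 2)) * \<chi> i) +
      3 * ((b i (m + 1) - a (m + 1)) * \<chi> i ^ 2) - (b i m - a m) * \<chi> i ^ 3 +
      r * ((b i (m + 1) - a (m + 1)) - (b i m - a m) * \<chi> i) = t * (b i m + a m)"
  shows "op_cubic r psi x m n v = vscale t (psi m (x n v) + x n (psi m v))"
proof (rule poly_mapping_eqI)
  fix l
  \<comment> \<open>the powers of the weight in the shifted modes of \<open>x\<close> are the coefficients in the recursion\<close>
  have regroup: "(b i (m + 3) - a (m + 3)) * \<chi> i ^ n * W * L - 3 * ((b i (m + 2) - a (m + 2)) * \<chi> i ^ (n + 1) * W * L) +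
      3 * ((b i (m + 1) - a (m + 1)) * \<chi> i ^ (n + 2) * W * L) - (b i m - a m) * \<chi> i ^ (n + 3) * W * L +
      r * ((b i (m + 1) - a (m + 1)) * \<chi> i ^ n * W * L - (b i m - a m) * \<chi> i ^ (n + 1) * W * L) =
     t * ((b i m + a m) * \<chi> i ^ n * W * L)" if "i \<in> J" for i W L
  proof -
    have "(b i (m + 3) - a (m + 3)) * \<chi> i ^ n * W * L - 3 * ((b i (m + 2) - a (m + 2)) * \<chi> i ^ (n + 1) * W * L) +
      3 * ((b i (m + 1) - a (m + 1)) * \<chi> i ^ (n + 2) * W * L) - (b i m - a m) * \<chi> i ^ (n + 3) * W * L +
      r * ((b i (m + 1) - a (m + 1)) * \<chi> i ^ n * W * L - (b i m - a m) * \<chi> i ^ (n + 1) * W * L) =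
     ((b i (m + 3) - a (m + 3)) - 3 * ((b i (m + 2) - a (m + 2)) * \<chi> i) +
      3 * ((b i (m + 1) - a (m + 1)) * \<chi> i ^ 2) - (b i m - a m) * \<chi> i ^ 3 +
      r * ((b i (m + 1) - a (m + 1)) - (b i m - a m) * \<chi> i)) * (\<chi> i ^ n * W * L)"
      unfolding power_add power_one_right by algebra
    then show ?thesis unfolding rec[OF that] by (simp only: mult.assoc)
  qed
  show "lookup (op_cubic r psi x m n v) l = lookup (vscale t (psi m (x n v) + x n (psi m v))) l"
    unfolding op_cubic_def diagonal_commutator lookup_sum lookup_minus lookup_add lookup_vscale
      sum_distrib_left sum_subtractf[symmetric] sum.distrib[symmetric]
    by (rule sum.cong[OF refl]) (rule regroup)
qed

lemma diagonal_initial: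
  assumes "\<And>i. i \<in> J \<Longrightarrow> b i m = a m + t"
  shows "op_commutator (psi m) (x n) v = vscale t (x n v)"
  unfolding diagonal_commutator x_v
  by (rule poly_mapping_eqI) (simp add: assms lookup_sum sum_distrib_left mult.assoc)

end

text \<open>
  The condition on \<open>cE\<close> and \<open>cF\<close> is what makes the diagonal coefficients of \<open>[e\<^sub>p, f\<^sub>q]\<close> residues of the Cartan series;
  it leaves the freedom to distribute the tail factors between raising and lowering. A pole of a tail factor is
  not a pole of the series, since the last row of \<open>J\<close> is empty and contributes a zero there.
\<close>

locale raising_lowering_operators = raising_operators h1 h2 J lt cE K e Y
  for h1 h2 :: "'k::field" and J :: "'i set" and lt cE
    and K :: "('i \<Rightarrow> 'k) \<Rightarrow> ('b, 'k) based_space" and e Y +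
  fixes cF :: "'i \<Rightarrow> 'k \<Rightarrow> 'k" and T :: "'t set" and tail_zero tail_pole :: "'t \<Rightarrow> 'k"
    and f psi :: "nat \<Rightarrow> ('b, 'k) based_space \<Rightarrow> ('b, 'k) based_space"
  assumes linear_f: "linear_op (f p)"
    and linear_psi: "linear_op (psi p)"
    and action_f: "y \<in> Y (Suc d) \<Longrightarrow> f p (K y) =
       (\<Sum>i\<in>J. vscale ((y i - h1) ^ p * lowering_coeff h1 h2 J lt cF y i) (K (shift_at (- h1) y i)))"
    and closed_f: "y \<in> Y (Suc d) \<Longrightarrow> i \<in> J \<Longrightarrow> lowering_coeff h1 h2 J lt cF y i \<noteq> 0 \<Longrightarrow>
       shift_at (- h1) y i \<in> Y d"
    and action_psi: "y \<in> Y d \<Longrightarrow> psi p (K y) = vscale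
       (psi_mode (sigma3 h1 h2 (- h1 - h2)) (rows_psi_series h1 h2 J T tail_zero tail_pole y) p) (K y)"
    and finite_T: "finite T"
    and cE_cF: "i \<in> J \<Longrightarrow> cE i v * cF i v = - (\<Prod>t\<in>T. (v - tail_zero t) / (v - tail_pole t)) / h1\<^sup>2"
    and inj_tail: "inj_on tail_pole T"
    and tail_pole_cancels: "y \<in> Y d \<Longrightarrow> t \<in> T \<Longrightarrow> \<exists>i\<in>J. tail_pole t = y i + h2"
    and tail_pole_new: "y \<in> Y d \<Longrightarrow> t \<in> T \<Longrightarrow> i \<in> J \<Longrightarrow> tail_pole t \<noteq> y i \<and> tail_pole t \<noteq> y i - h1"
    and sigma3_nz: "sigma3 h1 h2 (- h1 - h2) \<noteq> 0"
begin

abbreviation lower_coeff where "lower_coeff \<equiv> lowering_coeff h1 h2 J lt cF"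
abbreviation psi_series where "psi_series \<equiv> rows_psi_series h1 h2 J T tail_zero tail_pole"
abbreviation \<sigma>2 :: 'k where "\<sigma>2 \<equiv> sigma2 h1 h2 (- h1 - h2)"
abbreviation \<sigma>3 :: 'k where "\<sigma>3 \<equiv> sigma3 h1 h2 (- h1 - h2)"
abbreviation unmove :: "('i \<Rightarrow> 'k) \<Rightarrow> 'i \<Rightarrow> 'i \<Rightarrow> 'k" where "unmove \<equiv> shift_at (- h1)"

lemma h1_nz: "h1 \<noteq> 0" using sigma3_nz by (auto simp: sigma3_def)

lemma psi_series_0: "fps_nth (psi_series y) 0 = 1"
  by (simp add: rows_psi_series_def lin_fps_def delta_plus_def fps_nth_prod_0)

text \<open>
  Only the factor of row \<open>i\<close> changes, and two of its four linear factors cancel.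
\<close>

lemma psi_series_move:
  assumes "i \<in> J"
  shows "psi_series (move y i) * (lin_fps (y i + h1) * lin_fps (y i + h2) * lin_fps (y i - h1 - h2)) =
     psi_series y * (lin_fps (y i - h1) * lin_fps (y i - h2) * lin_fps (y i + h1 + h2))"
proof -
  define P where "P = (\<lambda>x. lin_fps (x + h2) * lin_fps (x - h1 - h2) * (delta_plus x * delta_plus (x - h1)))"
  define R where "R = (\<Prod>j\<in>J - {i}. P (y j)) * (\<Prod>t\<in>T. lin_fps (tail_zero t) * delta_plus (tail_pole t))"
  have s: "psi_series y' = P (y' i) * ((\<Prod>j\<in>J - {i}. P (y' j)) *
      (\<Prod>t\<in>T. lin_fps (tail_zero t) * delta_plus (tail_pole t)))" for y'
    unfolding rows_psi_series_def P_def by (subst prod.remove[OF finite_J assms]) (simp only: mult.assoc)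
  have 1: "psi_series y = P (y i) * R" unfolding R_def by (rule s)
  have "(\<Prod>j\<in>J - {i}. P (move y i j)) = (\<Prod>j\<in>J - {i}. P (y j))" by (rule prod.cong) auto
  then have 2: "psi_series (move y i) = P (y i + h1) * R" unfolding R_def s by simp
  have sh: "y i + h1 - h1 = y i" "y i + h1 - h1 - h2 = y i - h2" by simp_all
  have "P (y i + h1) * (lin_fps (y i + h1) * lin_fps (y i + h2) * lin_fps (y i - h1 - h2)) =
    (lin_fps (y i + h1) * delta_plus (y i + h1)) * (lin_fps (y i + h1 + h2) * lin_fps (y i - h2) * delta_plus (y i) *
      lin_fps (y i + h2) * lin_fps (y i - h1 - h2))"
    unfolding P_def sh by (simp only: mult_ac)
  also have "\<dots> = lin_fps (y i + h1 + h2) * lin_fps (y i - h2) * delta_plus (y i) *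
      lin_fps (y i + h2) * lin_fps (y i - h1 - h2) * (lin_fps (y i - h1) * delta_plus (y i - h1))"
    by (simp only: lin_delta_plus mult_1_left mult_1_right)
  also have "\<dots> = P (y i) * (lin_fps (y i - h1) * lin_fps (y i - h2) * lin_fps (y i + h1 + h2))"
    unfolding P_def by (simp only: mult_ac)
  finally show ?thesis unfolding 1 2 by (simp only: mult_ac)
qed

theorem psi_e_relation:
  assumes "y \<in> Y (Suc d)"
  shows "op_cubic \<sigma>2 psi e m n (K y) = vscale \<sigma>3 (psi m (e n (K y)) + e n (psi m (K y)))"
  by (rule diagonal_cubic[OF linear_psi linear_e action[OF assms] action_psi[OF assms] action_psi[OF closed[OF assms]]], assumption+)
    (rule psi_recursion_modes(4)[OF psi_series_move psi_series_0 sigma3_nz])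

theorem psi_e_initial:
  assumes "y \<in> Y (Suc d)"
  shows "op_commutator (psi 0) (e n) (K y) = 0" "op_commutator (psi 1) (e n) (K y) = 0"
    "op_commutator (psi 2) (e n) (K y) = vscale 2 (e n (K y))"
proof -
  let ?m = "\<lambda>z. psi_mode \<sigma>3 (psi_series z)"
  have r: "?m (move y i) 0 = ?m y 0 + 0" "?m (move y i) 1 = ?m y 1 + 0" "?m (move y i) 2 = ?m y 2 + 2" if "i \<in> J" for i
    using psi_recursion_modes(1-3)[OF psi_series_move[OF that] psi_series_0 sigma3_nz, of y] by simp_all
  note d = diagonal_initial[OF linear_psi linear_e action[OF assms] action_psi[OF assms] action_psi[OF closed[OF assms]]]
  have "op_commutator (psi 0) (e n) (K y) = vscale 0 (e n (K y))" "op_commutator (psi 1) (e n) (K y) = vscale 0 (e n (K y))"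
    "op_commutator (psi 2) (e n) (K y) = vscale 2 (e n (K y))"
    by (rule d, assumption+, rule r, assumption)+
  then show "op_commutator (psi 0) (e n) (K y) = 0" "op_commutator (psi 1) (e n) (K y) = 0"
    "op_commutator (psi 2) (e n) (K y) = vscale 2 (e n (K y))" by simp_all
qed

end

section \<open>The lowering operators\<close>

lemma linear_vscale:
  assumes "linear_op A"
  shows "A (vscale t v) = vscale t (A v)"
  using linear_vscale_sum[OF assms, of "\<lambda>_. t" "\<lambda>_. v" "{()}"] by simp

lemma vscale_vscale: "vscale a (vscale b v) = vscale (a * b) v"
  by (rule poly_mapping_eqI) (simp add: mult.assoc)

lemma linear_vscale_comp:
  assumes "linear_op A"
  shows "linear_op (\<lambda>v. vscale t (A v))"
proof -
  interpret Vector_Spaces.linear vscale vscale A by (rule assms)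
  show ?thesis
    by unfold_locales (auto intro!: poly_mapping_eqI simp: add scale lookup_add algebra_simps)
qed

text \<open>
  Removing boxes becomes adding boxes in the coordinates \<open>z = h1 - y\<close> with the order of the rows reversed. The weight
  of the box changes its sign, which is absorbed by the sign \<open>(- 1) ^ p\<close>.
\<close>

definition twist :: "(nat \<Rightarrow> ('b, 'k::field) based_space \<Rightarrow> ('b, 'k) based_space) \<Rightarrow> nat \<Rightarrow> ('b, 'k) based_space \<Rightarrow> ('b, 'k) based_space" where
  "twist A p v = vscale ((- 1) ^ p) (A p v)"

lemma twist_commutator:
  assumes "\<And>p. linear_op (A p)"
  shows "op_commutator (twist A m) (twist A n) v = vscale ((- 1) ^ (m + n)) (op_commutator (A m) (A n) v)"
  by (rule poly_mapping_eqI)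
    (simp add: op_commutator_def twist_def linear_vscale[OF assms] lookup_minus power_add algebra_simps)

lemma twist_cubic:
  assumes "\<And>p. linear_op (A p)"
  shows "op_cubic t (twist A) (twist A) m n v = vscale ((- 1) ^ (m + n + 1)) (op_cubic t A A m n v)"
  by (rule poly_mapping_eqI)
    (simp add: op_cubic_def twist_commutator[OF assms] lookup_minus lookup_add power_add algebra_simps eval_nat_numeral)

lemma twist_serre_word:
  assumes "\<And>p. linear_op (A p)"
  shows "op_serre_word (twist A) p q r v = vscale ((- 1) ^ (p + q + r + 1)) (op_serre_word A p q r v)"
  by (rule poly_mapping_eqI)
    (simp add: op_serre_word_def twist_def linear_vscale[OF assms] lookup_minus lookup_add power_add algebra_simps)

lemma twist_serre:
  assumes "\<And>p. linear_op (A p)"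
  shows "op_serre (twist A) p q r v = vscale ((- 1) ^ (p + q + r + 1)) (op_serre A p q r v)"
  by (rule poly_mapping_eqI)
    (simp add: op_serre_def twist_serre_word[OF assms] lookup_add algebra_simps)

lemma vscale_zero_right [simp]: "vscale t 0 = 0"
  by (rule poly_mapping_eqI) simp

lemma vscale_cancel:
  assumes "vscale t v = vscale t w" "t \<noteq> 0"
  shows "v = w"
  by (rule poly_mapping_eqI) (use assms in \<open>metis lookup_vscale mult_cancel_left\<close>)

context raising_lowering_operators
begin

lemma psi_series_unmove:
  assumes "i \<in> J"
  shows "psi_series y * (lin_fps (y i - h1 + h1) * lin_fps (y i - h1 + h2) * lin_fps (y i - h1 - h1 - h2)) =
     psi_series (unmove y i) * (lin_fps (y i - h1 - h1) * lin_fps (y i - h1 - h2) * lin_fps (y i - h1 + h1 + h2))"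
proof -
  have "move (unmove y i) i = y" by (auto simp: shift_at_def)
  then show ?thesis using psi_series_move[OF assms, of "unmove y i"] by simp
qed

theorem psi_f_relation:
  assumes "y \<in> Y (Suc d)"
  shows "op_cubic \<sigma>2 psi f m n (K y) = vscale (- \<sigma>3) (psi m (f n (K y)) + f n (psi m (K y)))"
proof (rule diagonal_cubic[OF linear_psi linear_f action_f[OF assms] action_psi[OF assms] action_psi[OF closed_f[OF assms]]], assumption+)
  fix i assume "i \<in> J"
  let ?a = "psi_mode \<sigma>3 (psi_series (unmove y i))" and ?b = "psi_mode \<sigma>3 (psi_series y)" and ?c = "y i - h1"
  show "(?a (m + 3) - ?b (m + 3)) - 3 * ((?a (m + 2) - ?b (m + 2)) * ?c) + 3 * ((?a (m + 1) - ?b (m + 1)) * ?c ^ 2) -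
      (?a m - ?b m) * ?c ^ 3 + \<sigma>2 * ((?a (m + 1) - ?b (m + 1)) - (?a m - ?b m) * ?c) = - \<sigma>3 * (?a m + ?b m)"
    using psi_recursion_modes(4)[OF psi_series_unmove[OF \<open>i \<in> J\<close>, of y] psi_series_0 sigma3_nz, of m] by algebra
qed

theorem psi_f_initial:
  assumes "y \<in> Y (Suc d)"
  shows "op_commutator (psi 0) (f n) (K y) = 0" "op_commutator (psi 1) (f n) (K y) = 0"
    "op_commutator (psi 2) (f n) (K y) = vscale (- 2) (f n (K y))"
proof -
  let ?m = "\<lambda>z. psi_mode \<sigma>3 (psi_series z)"
  have r: "?m (unmove y i) 0 = ?m y 0 + 0" "?m (unmove y i) 1 = ?m y 1 + 0" "?m (unmove y i) 2 = ?m y 2 + - 2" if "i \<in> J" for i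
    using psi_recursion_modes(1-3)[OF psi_series_unmove[OF that] psi_series_0 sigma3_nz, of y] by simp_all
  note d = diagonal_initial[OF linear_psi linear_f action_f[OF assms] action_psi[OF assms] action_psi[OF closed_f[OF assms]]]
  have "op_commutator (psi 0) (f n) (K y) = vscale 0 (f n (K y))" "op_commutator (psi 1) (f n) (K y) = vscale 0 (f n (K y))"
    "op_commutator (psi 2) (f n) (K y) = vscale (- 2) (f n (K y))"
    by (rule d, assumption+, rule r, assumption)+
  then show "op_commutator (psi 0) (f n) (K y) = 0" "op_commutator (psi 1) (f n) (K y) = 0"
    "op_commutator (psi 2) (f n) (K y) = vscale (- 2) (f n (K y))" by simp_all
qed

text \<open>
  The structure function depends on \<open>y j - y i = z i - z j\<close>, so it takes the required form in the new
  coordinates. The relations among the \<open>f\<^sub>j\<close> thus follow from those among the \<open>e\<^sub>j\<close>.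
\<close>

lemma lowering_as_raising:
  "raising_operators h1 h2 J (\<lambda>i j. lt j i) (\<lambda>i v. cF i (- v)) (\<lambda>z. K (\<lambda>i. h1 - z i)) (twist f)
     (\<lambda>d. {z. (\<lambda>i. h1 - z i) \<in> Y d})"
proof -
  interpret L: linearly_ordered_rows h1 h2 J "\<lambda>i j. lt j i" "\<lambda>i v. cF i (- v)"
    using finite_J lt_asym lt_trans lt_total by unfold_locales blast+
  have coeff: "L.row_coeff z i = lower_coeff (\<lambda>i. h1 - z i) i" for z i
    by (simp add: L.row_coeff_def lowering_coeff_def)
  have step: "(\<lambda>j. h1 - move z i j) = unmove (\<lambda>j. h1 - z j) i" for z i
    by (auto simp: shift_at_def)
  have act: "twist f p (K (\<lambda>i. h1 - z i)) = (\<Sum>i\<in>J. vscale (z i ^ p * L.row_coeff z i) (K (\<lambda>j. h1 - move z i j)))"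
    if z: "(\<lambda>i. h1 - z i) \<in> Y (Suc d)" for z d p
  proof -
    have sgn: "(- 1) ^ p * (- z i) ^ p = z i ^ p" for i
      by (simp flip: power_mult_distrib)
    have "twist f p (K (\<lambda>i. h1 - z i)) = (\<Sum>i\<in>J. vscale ((- 1) ^ p)
        (vscale ((- z i) ^ p * L.row_coeff z i) (K (\<lambda>j. h1 - move z i j))))"
      unfolding twist_def action_f[OF z] step coeff
      by (rule poly_mapping_eqI) (simp add: lookup_sum sum_distrib_left)
    then show ?thesis by (simp only: vscale_vscale sgn mult.assoc[symmetric])
  qed
  have cl: "(\<lambda>j. h1 - move z i j) \<in> Y d"
    if "(\<lambda>i. h1 - z i) \<in> Y (Suc d)" "i \<in> J" "L.row_coeff z i \<noteq> 0" for z d i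
    unfolding step by (rule closed_f[OF that(1,2)]) (use that(3) coeff in simp)
  have sp: "spread h1 J z" if "(\<lambda>i. h1 - z i) \<in> Y d" for z d
  proof -
    have "h1 - z j - (h1 - z i) \<noteq> of_int n * h1" if "i \<in> J" "j \<in> J" "i \<noteq> j" for i j n
      using that spread_Y[OF \<open>(\<lambda>i. h1 - z i) \<in> Y d\<close>] unfolding spread_def by metis
    then show ?thesis unfolding spread_def by simp
  qed
  have lin: "linear_op (twist f p)" for p
    unfolding twist_def[abs_def] by (rule linear_vscale_comp[OF linear_f])
  show ?thesis
  proof (rule raising_operators.intro[OF L.linearly_ordered_rows_axioms], rule raising_operators_axioms.intro, goal_cases)
    case (1 p)
    show ?case by (rule lin)
  next
    case (2 z d p)
    show ?case by (rule act) (use 2 in simp)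
  next
    case (3 z d i)
    then show ?case unfolding mem_Collect_eq by (rule cl)
  next
    case (4 z d)
    then show ?case unfolding mem_Collect_eq by (rule sp)
  next
    case 5
    show ?case by (rule char_ne_2_3)
  next
    case 6
    show ?case by (rule char_ne_2_3)
  qed
qed

text \<open>
  The twist changes the sign of the cubic side, which is odd in the exponents, but not that of the anticommutator: this
  is the sign by which the relation for \<open>f\<close> differs from that for \<open>e\<close>.
\<close>

theorem f_cubic_relation:
  assumes "y \<in> Y 2"
  shows "op_cubic \<sigma>2 f f m n (K y) = vscale (- \<sigma>3) (f m (f n (K y)) + f n (f m (K y)))"
proof -
  interpret L: raising_operators h1 h2 J "\<lambda>i j. lt j i" "\<lambda>i v. cF i (- v)" "\<lambda>z. K (\<lambda>i. h1 - z i)" "twist f"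
     "\<lambda>d. {z. (\<lambda>i. h1 - z i) \<in> Y d}"
    by (rule lowering_as_raising)
  have "op_cubic \<sigma>2 (twist f) (twist f) m n (K y) = vscale \<sigma>3 (twist f m (twist f n (K y)) + twist f n (twist f m (K y)))"
    using L.cubic_relation[of "\<lambda>i. h1 - y i"] assms by simp
  also have "\<dots> = vscale ((- 1) ^ (m + n + 1)) (vscale (- \<sigma>3) (f m (f n (K y)) + f n (f m (K y))))"
    by (rule poly_mapping_eqI) (simp add: twist_def linear_vscale[OF linear_f] lookup_add power_add algebra_simps)
  finally show ?thesis unfolding twist_cubic[OF linear_f] by (rule vscale_cancel) simp
qed

theorem f_serre_relation:
  assumes "y \<in> Y 3"
  shows "op_serre f p q r (K y) = 0"
proof -
  interpret L: raising_operators h1 h2 J "\<lambda>i j. lt j i" "\<lambda>i v. cF i (- v)" "\<lambda>z. K (\<lambda>i. h1 - z i)" "twist f"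
     "\<lambda>d. {z. (\<lambda>i. h1 - z i) \<in> Y d}"
    by (rule lowering_as_raising)
  have "op_serre (twist f) p q r (K y) = vscale ((- 1) ^ (p + q + r + 1)) 0"
    using L.serre_relation[of "\<lambda>i. h1 - y i"] assms by simp
  then show ?thesis unfolding twist_serre[OF linear_f] by (rule vscale_cancel) simp
qed

section \<open>The commutator of \<open>e\<close> and \<open>f\<close>\<close>

text \<open>
  If \<open>i\<close> comes before \<open>j\<close>, each of the two operations sees the other row, and performing it after the
  other one shifts the argument of the structure function in the same way. Otherwise neither sees the other.
\<close>

lemma ef_offdiagonal:
  assumes "i \<noteq> j" "i \<in> J" "j \<in> J"
  shows "lower_coeff y i * row_coeff (unmove y i) j = row_coeff y j * lower_coeff (move y j) i"
proof (cases "lt i j")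
  case True
  have s: "{l\<in>J. lt l j} = insert i ({l\<in>J. lt l j} - {i})" "{l\<in>J. lt i l} = insert j ({l\<in>J. lt i l} - {j})"
    using True assms by auto
  let ?A = "\<Prod>l\<in>{l\<in>J. lt l j} - {i}. bond h1 h2 (y j - y l)"
  let ?B = "\<Prod>l\<in>{l\<in>J. lt i l} - {j}. bond h1 h2 (y l - y i)"
  have cong: "(\<Prod>l\<in>{l\<in>J. lt l j} - {i}. bond h1 h2 (y j - unmove y i l)) = ?A"
    "(\<Prod>l\<in>{l\<in>J. lt i l} - {j}. bond h1 h2 (move y j l - y i)) = ?B"
    by (auto intro!: prod.cong)
  have "row_coeff y j = cE j (y j) * (bond h1 h2 (y j - y i) * ?A)"
    unfolding row_coeff_def by (subst s(1), subst prod.insert) (use finite_J in auto)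
  moreover have "row_coeff (unmove y i) j = cE j (y j) * (bond h1 h2 (y j - y i + h1) * ?A)"
    unfolding row_coeff_def using assms(1)
    by (subst s(1), subst prod.insert) (use finite_J cong in \<open>auto simp: algebra_simps\<close>)
  moreover have "lower_coeff y i = cF i (y i - h1) * (bond h1 h2 (y j - y i) * ?B)"
    unfolding lowering_coeff_def by (subst s(2), subst prod.insert) (use finite_J in auto)
  moreover have "lower_coeff (move y j) i = cF i (y i - h1) * (bond h1 h2 (y j - y i + h1) * ?B)"
    unfolding lowering_coeff_def using assms(1)
    by (subst s(2), subst prod.insert) (use finite_J cong in \<open>auto simp: algebra_simps\<close>)
  ultimately show ?thesis by (simp only: mult_ac)
next
  case False
  have "row_coeff (unmove y i) j = row_coeff y j"
    unfolding row_coeff_def using False assms(1) by (auto intro!: arg_cong2[where f = "(*)"] prod.cong simp: shift_at_def)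
  moreover have "lower_coeff (move y j) i = lower_coeff y i"
    unfolding lowering_coeff_def using False assms(1) by (auto intro!: arg_cong2[where f = "(*)"] prod.cong simp: shift_at_def)
  ultimately show ?thesis by simp
qed

definition tail_value :: "'k \<Rightarrow> 'k" where
  "tail_value v = (\<Prod>t\<in>T. (v - tail_zero t) / (v - tail_pole t))"

lemma prod_lt_gt:
  assumes "i \<in> J"
  shows "(\<Prod>j\<in>{j\<in>J. lt j i}. g j) * (\<Prod>j\<in>{j\<in>J. lt i j}. g j) = (\<Prod>j\<in>J - {i}. g j :: 'k)"
proof -
  have "J - {i} = {j\<in>J. lt j i} \<union> {j\<in>J. lt i j}" using lt_total by auto
  moreover have "{j\<in>J. lt j i} \<inter> {j\<in>J. lt i j} = {}" using lt_asym by auto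
  ultimately show ?thesis using finite_J by (simp add: prod.union_disjoint)
qed

text \<open>
  The earlier rows enter through the raising, the later ones through the lowering coefficient, and by
  \<open>bond_reflect\<close> in the same way; together they make up the residue of the Cartan series at \<open>y i\<close>, up to a constant.
\<close>

lemma add_then_remove:
  assumes "i \<in> J"
  shows "row_coeff y i * lower_coeff (move y i) i = - (tail_value (y i) * (\<Prod>j\<in>J - {i}. bond h1 h2 (y i - y j))) / h1\<^sup>2"
proof -
  have b: "bond h1 h2 (y j - (y i + h1)) = bond h1 h2 (y i - y j)" for j
    using bond_reflect[of h1 h2 "y i - y j"] by (simp add: algebra_simps)
  have "lower_coeff (move y i) i = cF i (y i) * (\<Prod>j\<in>{j\<in>J. lt i j}. bond h1 h2 (y i - y j))"
    unfolding lowering_coeff_def b[symmetric]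
    by (auto intro!: arg_cong2[where f = "(*)"] prod.cong simp: shift_at_def)
  then have "row_coeff y i * lower_coeff (move y i) i = (cE i (y i) * cF i (y i)) *
     ((\<Prod>j\<in>{j\<in>J. lt j i}. bond h1 h2 (y i - y j)) * (\<Prod>j\<in>{j\<in>J. lt i j}. bond h1 h2 (y i - y j)))"
    unfolding row_coeff_def by (simp only: mult_ac)
  then show ?thesis unfolding cE_cF[OF assms] prod_lt_gt[OF assms] tail_value_def by simp
qed

lemma remove_then_add:
  assumes "i \<in> J"
  shows "lower_coeff y i * row_coeff (unmove y i) i = - (tail_value (y i - h1) * (\<Prod>j\<in>J - {i}. bond h1 h2 (y j - y i))) / h1\<^sup>2"
proof -
  have "move (unmove y i) i = y" by (auto simp: shift_at_def)
  moreover have "(\<Prod>j\<in>J - {i}. bond h1 h2 (unmove y i i - unmove y i j)) = (\<Prod>j\<in>J - {i}. bond h1 h2 (y j - y i))"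
  proof (rule prod.cong[OF refl])
    fix j assume "j \<in> J - {i}"
    then show "bond h1 h2 (unmove y i i - unmove y i j) = bond h1 h2 (y j - y i)"
      using bond_reflect[of h1 h2 "y j - y i"] by (auto simp: algebra_simps)
  qed
  ultimately show ?thesis using add_then_remove[OF assms, of "unmove y i"] by (simp add: mult.commute)
qed

text \<open>
  The zeros and the poles of the Cartan series are indexed together: two for each row (distinguished by a truth
  value) and one for each tail factor.
\<close>

definition psi_zero :: "('i \<Rightarrow> 'k) \<Rightarrow> ('i \<times> bool) + 't \<Rightarrow> 'k" where
  "psi_zero y s = (case s of Inl (i, u) \<Rightarrow> if u then y i + h2 else y i - h1 - h2 | Inr t \<Rightarrow> tail_zero t)"

definition psi_pole :: "('i \<Rightarrow> 'k) \<Rightarrow> ('i \<times> bool) + 't \<Rightarrow> 'k" where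
  "psi_pole y s = (case s of Inl (i, u) \<Rightarrow> if u then y i else y i - h1 | Inr t \<Rightarrow> tail_pole t)"

lemma psi_index_prod:
  "(\<Prod>s\<in>(A \<times> UNIV) <+> T. g s) = (\<Prod>i\<in>A. g (Inl (i, True)) * g (Inl (i, False))) * (\<Prod>t\<in>T. g (Inr t) :: 'k fps)"
  if "finite A" for A :: "'i set"
proof -
  have "(\<Prod>s\<in>A \<times> UNIV. g (Inl s)) = (\<Prod>i\<in>A. \<Prod>u\<in>UNIV. g (Inl (i, u)))"
    by (simp add: prod.cartesian_product split_def)
  then show ?thesis using that finite_T by (simp add: prod.Plus UNIV_bool mult.commute)
qed

lemma psi_index_prod_value:
  "(\<Prod>s\<in>(A \<times> UNIV) <+> T. g s) = (\<Prod>i\<in>A. g (Inl (i, True)) * g (Inl (i, False))) * (\<Prod>t\<in>T. g (Inr t) :: 'k)"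
  if "finite A" for A :: "'i set"
proof -
  have "(\<Prod>s\<in>A \<times> UNIV. g (Inl s)) = (\<Prod>i\<in>A. \<Prod>u\<in>UNIV. g (Inl (i, u)))"
    by (simp add: prod.cartesian_product split_def)
  then show ?thesis using that finite_T by (simp add: prod.Plus UNIV_bool mult.commute)
qed

lemma psi_index_sum:
  "(\<Sum>s\<in>(J \<times> UNIV) <+> T. g s) = (\<Sum>i\<in>J. g (Inl (i, True)) + g (Inl (i, False))) + (\<Sum>t\<in>T. g (Inr t) :: 'k)"
proof -
  have "(\<Sum>s\<in>J \<times> UNIV. g (Inl s)) = (\<Sum>i\<in>J. \<Sum>u\<in>UNIV. g (Inl (i, u)))"
    by (simp add: sum.cartesian_product split_def)
  then show ?thesis using finite_J finite_T by (simp add: sum.Plus UNIV_bool add.commute)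
qed

lemma psi_pole_inj:
  assumes "y \<in> Y d"
  shows "inj_on (psi_pole y) ((J \<times> UNIV) <+> T)"
proof -
  have *: "y i \<noteq> y j" "y i - h1 \<noteq> y j" "y i \<noteq> y j - h1" if "i \<in> J" "j \<in> J" "i \<noteq> j" for i j
    using spreadD[OF spread_Y[OF assms] that] by (auto simp: algebra_simps)
  show ?thesis
  proof (rule inj_onI)
    fix s s' assume s: "s \<in> (J \<times> UNIV) <+> T" and s': "s' \<in> (J \<times> UNIV) <+> T" and eq: "psi_pole y s = psi_pole y s'"
    have mixed: "psi_pole y (Inl (i, u)) \<noteq> psi_pole y (Inr t)" if "i \<in> J" "t \<in> T" for i u t
      using tail_pole_new[OF assms that(2,1)] by (auto simp: psi_pole_def)
    from s consider i u where "s = Inl (i, u)" "i \<in> J" | t where "s = Inr t" "t \<in> T" by auto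
    then show "s = s'"
    proof cases
      case 1
      note s1 = this
      from s' consider j v where "s' = Inl (j, v)" "j \<in> J" | t where "s' = Inr t" "t \<in> T" by auto
      then show ?thesis
      proof cases
        case 1
        show ?thesis
        proof (cases "i = j")
          case True
          then show ?thesis using eq h1_nz by (cases u; cases v) (simp_all add: s1 1 psi_pole_def)
        next
          case False
          then show ?thesis using eq *[OF s1(2) 1(2) False] by (cases u; cases v) (simp_all add: s1(1) 1(1) psi_pole_def)
        qed
      next
        case 2
        then show ?thesis using mixed[OF s1(2) 2(2)] eq s1(1) by simp
      qed
    next
      case 2
      note s2 = this
      from s' consider j v where "s' = Inl (j, v)" "j \<in> J" | t where "s' = Inr t" "t \<in> T" by auto
      then show ?thesis
      proof cases
        case 1
        then show ?thesis using mixed[OF 1(2) s2(2)] eq s2(1) by metis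
      next
        case 2
        then show ?thesis using inj_tail eq s2 by (simp add: psi_pole_def inj_on_def)
      qed
    qed
  qed
qed

definition psi_residue :: "('i \<Rightarrow> 'k) \<Rightarrow> ('i \<times> bool) + 't \<Rightarrow> 'k" where
  "psi_residue y s = (psi_pole y s - psi_zero y s) *
     (\<Prod>s'\<in>((J \<times> UNIV) <+> T) - {s}. (psi_pole y s - psi_zero y s') / (psi_pole y s - psi_pole y s'))"

lemma psi_series_partial_fractions:
  assumes "y \<in> Y d"
  shows "psi_mode \<sigma>3 (psi_series y) n = (\<Sum>s\<in>(J \<times> UNIV) <+> T. psi_residue y s * psi_pole y s ^ n) / \<sigma>3"
proof -
  have "psi_series y = (\<Prod>s\<in>(J \<times> UNIV) <+> T. (1 - fps_const (psi_zero y s) * fps_X) * delta_plus (psi_pole y s))"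
    unfolding psi_index_prod[OF finite_J] by (simp add: rows_psi_series_def psi_zero_def psi_pole_def lin_fps_def mult_ac)
  also have "\<dots> = 1 + (\<Sum>s\<in>(J \<times> UNIV) <+> T. fps_const (psi_residue y s) * fps_X * delta_plus (psi_pole y s))"
    unfolding psi_residue_def using finite_J finite_T
    by (intro partial_fractions_fps psi_pole_inj[OF assms]) auto
  finally show ?thesis
    by (simp add: psi_mode_def mode_def fps_sum_nth mult.assoc delta_plus_def)
qed

lemma psi_residue_tail:
  assumes "y \<in> Y d" "t \<in> T"
  shows "psi_residue y (Inr t) = 0"
proof -
  obtain i where i: "i \<in> J" "tail_pole t = y i + h2" using tail_pole_cancels[OF assms] by blast
  then have "psi_pole y (Inr t) - psi_zero y (Inl (i, True)) = 0" by (simp add: psi_pole_def psi_zero_def)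
  moreover have "Inl (i, True) \<in> ((J \<times> UNIV) <+> T) - {Inr t}" using i by auto
  ultimately show ?thesis unfolding psi_residue_def using finite_J finite_T
    by (intro mult_eq_0_iff[THEN iffD2] disjI2) (rule prod_zero, auto)
qed

text \<open>
  The two residues attached to a row: the first belongs to the box that can be added, the second to the last box
  of the row.
\<close>

lemma psi_residue_row:
  assumes "i \<in> J"
  shows "psi_residue y (Inl (i, True)) = h2 * (h1 + h2) / (- h1) * ((\<Prod>j\<in>J - {i}. bond h1 h2 (y i - y j)) * tail_value (y i))"
    "psi_residue y (Inl (i, False)) = h2 * (h1 + h2) / h1 * ((\<Prod>j\<in>J - {i}. bond h1 h2 (y j - y i)) * tail_value (y i - h1))"
proof -
  let ?q = "\<lambda>v s. (v - psi_zero y s) / (v - psi_pole y s)"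
  have split: "((J \<times> UNIV) <+> T) - {Inl (i, u)} = insert (Inl (i, \<not> u)) (((J - {i}) \<times> UNIV) <+> T)" for u :: bool
    using assms by (cases u) auto
  have rest: "(\<Prod>s\<in>((J \<times> UNIV) <+> T) - {Inl (i, u)}. ?q v s) =
     ?q v (Inl (i, \<not> u)) * ((\<Prod>j\<in>J - {i}. bond h1 h2 (v - y j)) * tail_value v)" for u v
  proof -
    have q: "?q v (Inl (j, True)) * ?q v (Inl (j, False)) = bond h1 h2 (v - y j)" for j
      by (simp add: psi_zero_def psi_pole_def bond_def diff_diff_eq2 diff_diff_eq algebra_simps)
    have "(\<Prod>s\<in>((J \<times> UNIV) <+> T) - {Inl (i, u)}. ?q v s) =
       ?q v (Inl (i, \<not> u)) * (\<Prod>s\<in>((J - {i}) \<times> UNIV) <+> T. ?q v s)"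
      unfolding split using finite_J finite_T by (subst prod.insert) auto
    also have "(\<Prod>s\<in>((J - {i}) \<times> UNIV) <+> T. ?q v s) = (\<Prod>j\<in>J - {i}. bond h1 h2 (v - y j)) * tail_value v"
      using finite_J by (subst psi_index_prod_value) (simp_all only: q finite_Diff, simp add: tail_value_def psi_zero_def psi_pole_def)
    finally show ?thesis .
  qed
  have 1: "psi_pole y (Inl (i, True)) = y i" "psi_pole y (Inl (i, False)) = y i - h1"
    "psi_zero y (Inl (i, True)) = y i + h2" "psi_zero y (Inl (i, False)) = y i - h1 - h2"
    by (simp_all add: psi_pole_def psi_zero_def)
  show "psi_residue y (Inl (i, True)) = h2 * (h1 + h2) / (- h1) * ((\<Prod>j\<in>J - {i}. bond h1 h2 (y i - y j)) * tail_value (y i))"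
    unfolding psi_residue_def 1(1) rest by (simp add: 1)
  have b: "bond h1 h2 (y i - h1 - y j) = bond h1 h2 (y j - y i)" for j
  proof -
    have "y i - h1 - y j = - (y j - y i) - h1" by simp
    then show ?thesis by (simp only: bond_reflect)
  qed
  show "psi_residue y (Inl (i, False)) = h2 * (h1 + h2) / h1 * ((\<Prod>j\<in>J - {i}. bond h1 h2 (y j - y i)) * tail_value (y i - h1))"
    unfolding psi_residue_def 1(2) rest b using h1_nz by (simp add: 1 divide_simps) algebra
qed

text \<open>
  The off-diagonal coefficients cancel. The diagonal ones are the residues of \<open>\<psi>(z) / \<sigma>\<^sub>3\<close>, multiplied by the powers of
  the weights, so that the claim is the partial fraction decomposition of \<open>\<psi>(z)\<close>.
\<close>

theorem e_f_relation:
  assumes "y \<in> Y 2"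
  shows "op_commutator (e p) (f q) (K y) = psi (p + q) (K y)"
proof (rule poly_mapping_eqI)
  fix x
  have y: "y \<in> Y (Suc (Suc 0))" using assms by (simp add: numeral_2_eq_2)
  let ?k = "lookup (K y) x"
  have "e p (f q (K y)) = (\<Sum>i\<in>J. vscale ((y i - h1) ^ q * lower_coeff y i) (e p (K (unmove y i))))"
    by (simp only: action_f[OF y] linear_vscale_sum[OF linear_e])
  also have "\<dots> = (\<Sum>i\<in>J. vscale ((y i - h1) ^ q * lower_coeff y i)
      (\<Sum>j\<in>J. vscale (unmove y i j ^ p * row_coeff (unmove y i) j) (K (move (unmove y i) j))))"
  proof (rule sum.cong[OF refl])
    fix i assume "i \<in> J"
    then show "vscale ((y i - h1) ^ q * lower_coeff y i) (e p (K (unmove y i))) = vscale ((y i - h1) ^ q * lower_coeff y i)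
      (\<Sum>j\<in>J. vscale (unmove y i j ^ p * row_coeff (unmove y i) j) (K (move (unmove y i) j)))"
      using closed_f[OF y, of i] action[of "unmove y i" 0 p] by (cases "lower_coeff y i = 0") auto
  qed
  finally have ef: "lookup (e p (f q (K y))) x = (\<Sum>i\<in>J. \<Sum>j\<in>J. ((y i - h1) ^ q * unmove y i j ^ p) *
      (lower_coeff y i * row_coeff (unmove y i) j) * lookup (K (move (unmove y i) j)) x)"
    by (simp add: lookup_sum sum_distrib_left mult_ac)
  have "f q (e p (K y)) = (\<Sum>j\<in>J. vscale (y j ^ p * row_coeff y j) (f q (K (move y j))))"
    by (simp only: action[OF y] linear_vscale_sum[OF linear_f])
  also have "\<dots> = (\<Sum>j\<in>J. vscale (y j ^ p * row_coeff y j)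
      (\<Sum>i\<in>J. vscale ((move y j i - h1) ^ q * lower_coeff (move y j) i) (K (unmove (move y j) i))))"
  proof (rule sum.cong[OF refl])
    fix j assume "j \<in> J"
    then show "vscale (y j ^ p * row_coeff y j) (f q (K (move y j))) = vscale (y j ^ p * row_coeff y j)
      (\<Sum>i\<in>J. vscale ((move y j i - h1) ^ q * lower_coeff (move y j) i) (K (unmove (move y j) i)))"
      using closed[OF y, of j] action_f[of "move y j" 0 q] by (cases "row_coeff y j = 0") auto
  qed
  finally have "lookup (f q (e p (K y))) x = (\<Sum>j\<in>J. \<Sum>i\<in>J. ((move y j i - h1) ^ q * y j ^ p) *
      (row_coeff y j * lower_coeff (move y j) i) * lookup (K (unmove (move y j) i)) x)"
    by (simp add: lookup_sum sum_distrib_left mult_ac)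
  also have "\<dots> = (\<Sum>i\<in>J. \<Sum>j\<in>J. ((move y j i - h1) ^ q * y j ^ p) *
      (row_coeff y j * lower_coeff (move y j) i) * lookup (K (unmove (move y j) i)) x)"
    by (rule sum.swap)
  finally have fe: "lookup (f q (e p (K y))) x = \<dots>" .
  \<comment> \<open>the diagonal contribution of row \<open>i\<close>: remove its last box and add it again, minus the opposite order\<close>
  let ?D = "\<lambda>i. (y i - h1) ^ (p + q) * (lower_coeff y i * row_coeff (unmove y i) i) -
     y i ^ (p + q) * (row_coeff y i * lower_coeff (move y i) i)"
  have undo: "move (unmove y i) i = y" "unmove (move y i) i = y" for i
    by (simp_all add: shift_at_def)
  have "lookup (op_commutator (e p) (f q) (K y)) x = (\<Sum>i\<in>J. \<Sum>j\<in>J. if i = j then ?D i * ?k else 0)"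
    unfolding op_commutator_def lookup_minus ef fe sum_subtractf[symmetric]
  proof (intro sum.cong refl)
    fix i j assume "i \<in> J" "j \<in> J"
    show "((y i - h1) ^ q * unmove y i j ^ p) * (lower_coeff y i * row_coeff (unmove y i) j) *
        lookup (K (move (unmove y i) j)) x -
      ((move y j i - h1) ^ q * y j ^ p) * (row_coeff y j * lower_coeff (move y j) i) *
        lookup (K (unmove (move y j) i)) x = (if i = j then ?D i * ?k else 0)"
    proof (cases "i = j")
      case True
      then show ?thesis by (simp add: undo power_add algebra_simps)
    next
      case False
      then show ?thesis
        using ef_offdiagonal[OF False \<open>i \<in> J\<close> \<open>j \<in> J\<close>, of y]
        by (simp add: shift_at_commute[of h1 "- h1" y i j])
    qed
  qed
  also have "\<dots> = (\<Sum>i\<in>J. ?D i) * ?k"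
    by (simp add: finite_J sum_distrib_right)
  also have "(\<Sum>i\<in>J. ?D i) = psi_mode \<sigma>3 (psi_series y) (p + q)"
  proof -
    have "(\<Sum>s\<in>(J \<times> UNIV) <+> T. psi_residue y s * psi_pole y s ^ (p + q)) = (\<Sum>i\<in>J. \<sigma>3 * ?D i)"
      unfolding psi_index_sum
    proof -
      have "(\<Sum>t\<in>T. psi_residue y (Inr t) * psi_pole y (Inr t) ^ (p + q)) = 0"
        by (intro sum.neutral ballI) (simp add: psi_residue_tail[OF assms])
      moreover have "psi_residue y (Inl (i, True)) * psi_pole y (Inl (i, True)) ^ (p + q) +
         psi_residue y (Inl (i, False)) * psi_pole y (Inl (i, False)) ^ (p + q) = \<sigma>3 * ?D i" if "i \<in> J" for i
        unfolding psi_residue_row[OF that] add_then_remove[OF that] remove_then_add[OF that]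
        using h1_nz by (simp add: psi_pole_def sigma3_def power2_eq_square divide_simps) algebra
      ultimately show "(\<Sum>i\<in>J. psi_residue y (Inl (i, True)) * psi_pole y (Inl (i, True)) ^ (p + q) +
         psi_residue y (Inl (i, False)) * psi_pole y (Inl (i, False)) ^ (p + q)) +
         (\<Sum>t\<in>T. psi_residue y (Inr t) * psi_pole y (Inr t) ^ (p + q)) = (\<Sum>i\<in>J. \<sigma>3 * ?D i)"
        by simp
    qed
    then show ?thesis
      unfolding psi_series_partial_fractions[OF assms] sum_distrib_left[symmetric] using sigma3_nz by simp
  qed
  finally show "lookup (op_commutator (e p) (f q) (K y)) x = lookup (psi (p + q) (K y)) x"
    unfolding action_psi[OF assms] by simp
qed

end

section \<open>Representations of the Yangian from operators satisfying its relations\<close>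

definition word_action :: "(ygen \<Rightarrow> 'v \<Rightarrow> 'v) \<Rightarrow> ygen free_monoid \<Rightarrow> 'v \<Rightarrow> 'v" where
  "word_action A w = foldr A (letters w)"

text \<open>
  The linear extension of the action of the words, hence the action of the free algebra that is determined by operators
  for the generators.
\<close>

definition free_action ::
  "(ygen \<Rightarrow> ('b, 'k::field) based_space \<Rightarrow> ('b, 'k) based_space) \<Rightarrow> 'k ygen_free_alg \<Rightarrow>
   ('b, 'k) based_space \<Rightarrow> ('b, 'k) based_space" where
  "free_action A a v = (\<Sum>w\<in>keys a. vscale (lookup a w) (word_action A w v))"

lemma poly_mapping_eq_sum_single:
  "a = (\<Sum>w\<in>keys a. Poly_Mapping.single w (lookup a w))"
proof (rule poly_mapping_eqI)
  fix u
  have "(\<Sum>w\<in>keys a. lookup (Poly_Mapping.single w (lookup a w)) u) =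
    (\<Sum>w\<in>keys a. if w = u then lookup a w else 0)"
    by (rule sum.cong[OF refl]) (simp add: lookup_single when_def)
  then show "lookup a u = lookup (\<Sum>w\<in>keys a. Poly_Mapping.single w (lookup a w)) u"
    by (simp add: lookup_sum in_keys_iff)
qed

lemma vscale_add_left: "vscale (a + b) v = vscale a v + vscale b v"
  by (rule poly_mapping_eqI) (simp add: lookup_add distrib_right)

lemma vscale_add_right: "vscale a (v + w) = vscale a v + vscale a w"
  by (rule poly_mapping_eqI) (simp add: lookup_add distrib_left)

lemma vscale_one [simp]: "vscale 1 v = v"
  by (rule poly_mapping_eqI) simp

lemma vscale_sum_right: "vscale a (\<Sum>i\<in>I. v i) = (\<Sum>i\<in>I. vscale a (v i))"
  by (rule poly_mapping_eqI) (simp add: lookup_sum sum_distrib_left)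

lemma free_action_superset:
  assumes "finite S" "keys a \<subseteq> S"
  shows "free_action A a v = (\<Sum>w\<in>S. vscale (lookup a w) (word_action A w v))"
  unfolding free_action_def
  by (rule sum.mono_neutral_left) (use assms in \<open>auto simp: in_keys_iff\<close>)

lemma free_action_add: "free_action A (a + b) v = free_action A a v + free_action A b v"
proof -
  let ?S = "keys a \<union> keys b"
  have "free_action A (a + b) v = (\<Sum>w\<in>?S. vscale (lookup (a + b) w) (word_action A w v))"
    by (rule free_action_superset) (use keys_add[of a b] in auto)
  also have "\<dots> = (\<Sum>w\<in>?S. vscale (lookup a w) (word_action A w v)) +
     (\<Sum>w\<in>?S. vscale (lookup b w) (word_action A w v))"
    by (simp add: lookup_add vscale_add_left sum.distrib)
  also have "\<dots> = free_action A a v + free_action A b v"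
    by (subst (1 2) free_action_superset[of ?S]) auto
  finally show ?thesis .
qed

lemma free_action_zero [simp]: "free_action A 0 v = 0"
  by (simp add: free_action_def)

lemma free_action_uminus: "free_action A (- a) v = - free_action A a v"
  using free_action_add[of A "- a" a v] by (simp add: eq_neg_iff_add_eq_0)

lemma free_action_diff: "free_action A (a - b) v = free_action A a v - free_action A b v"
  using free_action_add[of A a "- b" v] by (simp add: free_action_uminus)

lemma free_action_sum: "free_action A (\<Sum>i\<in>I. a i) v = (\<Sum>i\<in>I. free_action A (a i) v)"
  by (induction I rule: infinite_finite_induct) (simp_all add: free_action_add)

lemma free_action_single: "free_action A (Poly_Mapping.single w t) v = vscale t (word_action A w v)"
  by (simp add: free_action_superset[of "{w}"])

lemma word_action_plus: "word_action A (u + w) v = word_action A u (word_action A w v)"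
  by (simp add: word_action_def plus_free_monoid_def)

lemma linear_word_action:
  assumes "\<And>g. linear_op (A g)"
  shows "linear_op (word_action A w)"
proof -
  have "word_action A (Word gs) (v + v') = word_action A (Word gs) v + word_action A (Word gs) v'"
    "word_action A (Word gs) (vscale t v) = vscale t (word_action A (Word gs) v)" for gs v v' t
    by (induction gs)
      (use assms in \<open>simp_all add: word_action_def Vector_Spaces.linear_iff\<close>)
  then show ?thesis
    using assms[of "GenE 0"] unfolding Vector_Spaces.linear_iff by (metis free_monoid.exhaust)
qed

lemma linear_sum_vscale:
  assumes "\<And>i. linear_op (A i)"
  shows "linear_op (\<lambda>v. \<Sum>i\<in>I. vscale (t i) (A i v))"
  using assms vector_space_vscale
  by (simp add: Vector_Spaces.linear_iff vscale_add_right sum.distrib vscale_sum_right vscale_vscale mult.commute)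

lemma linear_free_action:
  assumes "\<And>g. linear_op (A g)"
  shows "linear_op (free_action A a)"
  unfolding free_action_def[abs_def] by (rule linear_sum_vscale, rule linear_word_action, rule assms)

lemma free_action_mult:
  assumes "\<And>g. linear_op (A g)"
  shows "free_action A (a * b) v = free_action A a (free_action A b v)"
proof -
  let ?la = "lookup a" and ?lb = "lookup b"
  have "a * b = (\<Sum>w\<in>keys a. Poly_Mapping.single w (?la w)) * (\<Sum>u\<in>keys b. Poly_Mapping.single u (?lb u))"
    by (simp flip: poly_mapping_eq_sum_single)
  also have "\<dots> = (\<Sum>w\<in>keys a. \<Sum>u\<in>keys b. Poly_Mapping.single (w + u) (?la w * ?lb u))"
    by (simp add: sum_product mult_single)
  finally have "free_action A (a * b) v =
     (\<Sum>w\<in>keys a. \<Sum>u\<in>keys b. vscale (?la w * ?lb u) (word_action A w (word_action A u v)))"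
    by (simp add: free_action_sum free_action_single word_action_plus)
  also have "\<dots> = free_action A a (free_action A b v)"
    unfolding free_action_def linear_vscale_sum[OF linear_word_action[OF assms]] vscale_sum_right vscale_vscale ..
  finally show ?thesis .
qed

lemma sum_permutes_three:
  fixes h :: "nat \<Rightarrow> nat \<Rightarrow> nat \<Rightarrow> 'a::comm_monoid_add"
  shows "(\<Sum>\<pi> | \<pi> permutes {1, 2, 3}. h (\<pi> 1) (\<pi> 2) (\<pi> 3)) =
    h 1 2 3 + h 1 3 2 + h 2 1 3 + h 2 3 1 + h 3 1 2 + h 3 2 1"
proof -
  have f: "finite {2::nat, 3}" "1 \<notin> {2::nat, 3}" "finite {3::nat}" "2 \<notin> {3::nat}" "finite ({}::nat set)" "3 \<notin> ({}::nat set)"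
    by auto
  show ?thesis
    unfolding sum_over_permutations_insert[OF f(1,2)] sum_over_permutations_insert[OF f(3,4)]
      sum_over_permutations_insert[OF f(5,6)] permutes_sing
    by (simp add: permutes_empty transpose_def ac_simps)
qed

locale generator_action =
  fixes e f psi :: "nat \<Rightarrow> ('b, 'r::linorder ratfun) based_space \<Rightarrow> ('b, 'r ratfun) based_space"
  assumes lin: "linear_op (e n)" "linear_op (f n)"
    "linear_op (psi n)"
begin

fun generator_op :: "ygen \<Rightarrow> ('b, 'r ratfun) based_space \<Rightarrow> ('b, 'r ratfun) based_space" where
  "generator_op (GenE n) = e n"
| "generator_op (GenF n) = f n"
| "generator_op (GenPsi n) = psi n"

lemma linear_generator_op: "linear_op (generator_op g)"
  by (cases g) (simp_all add: lin)

abbreviation "\<rho> \<equiv> free_action generator_op"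

lemmas rho_mult = free_action_mult[of generator_op, OF linear_generator_op]

lemma rho_gen: "\<rho> (gen_e n) = e n" "\<rho> (gen_f n) = f n" "\<rho> (gen_psi n) = psi n"
  by (rule ext, simp add: free_gen_def free_action_single word_action_def)+

lemma rho_scalar: "\<rho> (free_scalar t * a) v = vscale t (\<rho> a v)"
  by (simp add: rho_mult free_scalar_def free_action_single word_action_def zero_free_monoid_def)

lemma rho_numeral: "\<rho> (2 * a) v = vscale 2 (\<rho> a v)" "\<rho> (3 * a) v = vscale 3 (\<rho> a v)"
proof -
  have "2 * a = a + a" "3 * a = a + a + a" for a :: "'r ratfun ygen_free_alg"
  proof -
    show two: "2 * a = a + a" by (rule mult_2)
    have "3 * a = (2 + 1) * a" by simp
    then show "3 * a = a + a + a" by (simp only: distrib_right two mult_1_left)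
  qed
  then show "\<rho> (2 * a) v = vscale 2 (\<rho> a v)" "\<rho> (3 * a) v = vscale 3 (\<rho> a v)"
    by (auto intro!: poly_mapping_eqI simp: free_action_add lookup_add)
qed

lemma rho_commutator: "\<rho> (commutator a b) v = op_commutator (\<rho> a) (\<rho> b) v"
  by (simp add: commutator_def op_commutator_def free_action_diff rho_mult)

lemma rho_anticommutator: "\<rho> (anticommutator a b) v = \<rho> a (\<rho> b v) + \<rho> b (\<rho> a v)"
  by (simp add: anticommutator_def free_action_add rho_mult)

lemma rho_cubic: "\<rho> (cubic_lhs t a b i j) v = op_cubic t (\<lambda>n. \<rho> (a n)) (\<lambda>n. \<rho> (b n)) i j v"
  by (simp add: cubic_lhs_def op_cubic_def free_action_add free_action_diff rho_numeral rho_scalar rho_commutator)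

lemma rho_serre: "\<rho> (serre_lhs a i) v = op_serre (\<lambda>n. \<rho> (a n)) (i 1) (i 2) (i 3) v"
proof -
  have "\<rho> (commutator (a p) (commutator (a q) (a (r + 1)))) v = op_serre_word (\<lambda>n. \<rho> (a n)) p q r v" for p q r
  proof -
    interpret Vector_Spaces.linear vscale vscale "\<rho> (a p)"
      by (rule linear_free_action[OF linear_generator_op])
    show ?thesis by (simp add: rho_commutator op_commutator_def op_serre_word_def diff algebra_simps)
  qed
  then show ?thesis unfolding serre_lhs_def free_action_sum
    by (simp only: sum_permutes_three[of "\<lambda>x y z. op_serre_word (\<lambda>n. \<rho> (a n)) (i x) (i y) (i z) v"] op_serre_def)
qed

end

lemma linear_zero_on_kets:
  assumes "linear_op A" "\<And>b. A (ket b) = 0"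
  shows "A v = 0"
proof -
  have "v = (\<Sum>b\<in>keys v. vscale (lookup v b) (ket b))"
  proof -
    have *: "vscale t (ket b) = Poly_Mapping.single b t" for t b
      by (rule poly_mapping_eqI) (simp add: ket_def lookup_single when_def)
    show ?thesis unfolding * by (rule poly_mapping_eq_sum_single)
  qed
  then have "A v = (\<Sum>b\<in>keys v. vscale (lookup v b) (A (ket b)))"
    using linear_vscale_sum[OF assms(1)] by metis
  then show ?thesis using assms(2) by simp
qed

text \<open>
  The defining relations are needed on basis vectors only: every relator acts by a linear operator.
\<close>

locale yangian_action = generator_action e f psi
  for e f psi :: "nat \<Rightarrow> ('b, 'r::linorder ratfun) based_space \<Rightarrow> ('b, 'r ratfun) based_space" +
  assumes psi_psi: "op_commutator (psi i) (psi j) (ket b) = 0"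
    and e_f: "op_commutator (e i) (f j) (ket b) = psi (i + j) (ket b)"
    and e_e: "op_cubic (sigma2 s1 s2 s3) e e i j (ket b) = vscale (sigma3 s1 s2 s3) (e i (e j (ket b)) + e j (e i (ket b)))"
    and f_f: "op_cubic (sigma2 s1 s2 s3) f f i j (ket b) = vscale (- sigma3 s1 s2 s3) (f i (f j (ket b)) + f j (f i (ket b)))"
    and psi_e: "op_cubic (sigma2 s1 s2 s3) psi e i j (ket b) = vscale (sigma3 s1 s2 s3) (psi i (e j (ket b)) + e j (psi i (ket b)))"
    and psi_f: "op_cubic (sigma2 s1 s2 s3) psi f i j (ket b) = vscale (- sigma3 s1 s2 s3) (psi i (f j (ket b)) + f j (psi i (ket b)))"
    and psi_e_low: "op_commutator (psi 0) (e j) (ket b) = 0" "op_commutator (psi 1) (e j) (ket b) = 0"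
      "op_commutator (psi 2) (e j) (ket b) = vscale 2 (e j (ket b))"
    and psi_f_low: "op_commutator (psi 0) (f j) (ket b) = 0" "op_commutator (psi 1) (f j) (ket b) = 0"
      "op_commutator (psi 2) (f j) (ket b) = vscale (- 2) (f j (ket b))"
    and serre_e: "op_serre e p q r (ket b) = 0"
    and serre_f: "op_serre f p q r (ket b) = 0"
begin

lemma rho_relator: "a \<in> yangian_relators s1 s2 s3 \<Longrightarrow> \<rho> a v = 0"
proof (rule linear_zero_on_kets[OF linear_free_action[OF linear_generator_op]])
  have neg: "vscale (- t) w + vscale t w = 0" for t :: "'r ratfun" and w :: "('b, 'r ratfun) based_space"
    by (rule poly_mapping_eqI) (simp add: lookup_add)
  fix b assume "a \<in> yangian_relators s1 s2 s3"
  then show "\<rho> a (ket b) = 0"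
    by cases
      (simp_all only: rho_commutator rho_cubic rho_serre rho_gen rho_scalar rho_anticommutator rho_numeral
        free_action_add free_action_diff psi_psi e_f e_e f_f psi_e psi_f psi_e_low psi_f_low serre_e serre_f neg diff_self)
qed

lemma rho_ideal: "a \<in> two_sided_ideal (yangian_relators s1 s2 s3) \<Longrightarrow> \<rho> a v = 0"
proof (induction arbitrary: v rule: two_sided_ideal.induct)
  case (ideal_base a)
  then show ?case by (rule rho_relator)
next
  case (ideal_mult_left a b)
  interpret Vector_Spaces.linear vscale vscale "\<rho> b" by (rule linear_free_action[OF linear_generator_op])
  show ?case by (simp add: rho_mult ideal_mult_left.IH zero)
qed (simp_all add: free_action_add rho_mult)

definition yangian_operator :: "'r yangian \<Rightarrow> ('b, 'r ratfun) based_space \<Rightarrow> ('b, 'r ratfun) based_space" where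
  "yangian_operator y = \<rho> (rep_yangian y)"

lemma yangian_operator_abs: "yangian_operator (abs_yangian a) = \<rho> a"
proof
  fix v
  have "yangian_cong (rep_yangian (abs_yangian a)) a"
    using Quotient_yangian equivp_yangian_cong by (metis Quotient_rep_abs equivp_reflp)
  then have "\<rho> (rep_yangian (abs_yangian a) - a) v = 0" unfolding yangian_cong_def by (rule rho_ideal)
  then show "yangian_operator (abs_yangian a) v = \<rho> a v"
    by (simp add: yangian_operator_def free_action_diff)
qed

lemma abs_yangian_cases: obtains a where "y = abs_yangian a"
  using Quotient_yangian by (metis Quotient_abs_rep)

text \<open>
  Relators act as 0, hence so does the ideal, and the action of the free algebra descends to the quotient.
\<close>

theorem yangian_operator_rep: "yangian_rep_given_by e f psi yangian_operator"
proof -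
  have "\<exists>a. y = abs_yangian a" for y :: "'r yangian" using abs_yangian_cases by blast
  then have all: "(\<And>a. P (abs_yangian a)) \<Longrightarrow> P y" for P and y :: "'r yangian" by metis
  have lin: "linear_op (yangian_operator y)" for y
    unfolding yangian_operator_def by (rule linear_free_action[OF linear_generator_op])
  have add: "yangian_operator (y + z) v = yangian_operator y v + yangian_operator z v" for y z v
    by (rule all[of _ y], rule all[of _ z])
      (simp add: yangian_operator_abs plus_yangian.abs_eq free_action_add)
  have mult: "yangian_operator (y * z) v = yangian_operator y (yangian_operator z v)" for y z v
    by (rule all[of _ y], rule all[of _ z])
      (simp add: yangian_operator_abs times_yangian.abs_eq rho_mult)
  have one: "yangian_operator 1 v = v" for v
  proof -
    have "(1 :: 'r ratfun ygen_free_alg) = Poly_Mapping.single (Word []) 1"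
      by (simp flip: zero_free_monoid_def)
    then have "\<rho> 1 v = \<rho> (Poly_Mapping.single (Word []) 1) v" by simp
    then show ?thesis
      unfolding one_yangian.abs_eq yangian_operator_abs free_action_single by (simp add: word_action_def)
  qed
  have scale: "yangian_operator (yangian_scale t y) v = vscale t (yangian_operator y v)" for t y v
    by (rule all[of _ y])
      (simp add: yangian_scale_def yangian_operator_abs times_yangian.abs_eq rho_scalar)
  have gen: "yangian_operator (yangian_gen g) = \<rho> (free_gen g)" for g
    by (simp add: yangian_gen.abs_eq yangian_operator_abs)
  show ?thesis
    unfolding yangian_rep_given_by_def yangian_rep_def
    by (simp add: lin add mult one scale gen rho_gen)
qed

end

section \<open>Young diagrams\<close>

lemma row_0 [simp]: "row \<mu> 0 = 0"
  using row[of \<mu>] by simp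

lemma row_Suc_le: "1 \<le> k \<Longrightarrow> row \<mu> (Suc k) \<le> row \<mu> k"
  using row[of \<mu>] by simp

lemma row_antimono:
  assumes "1 \<le> i" "i \<le> j"
  shows "row \<mu> j \<le> row \<mu> i"
  using assms(2)
proof (induction j rule: dec_induct)
  case (step n)
  then show ?case using row_Suc_le[of n \<mu>] assms(1) by simp
qed simp

lemma nonzero_rows: "{k. row \<mu> k \<noteq> 0} = {1..num_rows \<mu>}"
proof -
  let ?S = "{k. row \<mu> k \<noteq> 0}"
  have "\<exists>n. ?S = {1..n}"
  proof (cases "?S = {}")
    case True
    then show ?thesis by (intro exI[of _ 0]) auto
  next
    case False
    have "?S = {1..Max ?S}"
    proof
      show "?S \<subseteq> {1..Max ?S}"
      proof
        fix k assume k: "k \<in> ?S"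
        then have "k \<le> Max ?S" using finite_rows by (intro Max_ge) auto
        moreover have "k \<noteq> 0" using k by (metis (mono_tags) mem_Collect_eq row_0)
        ultimately show "k \<in> {1..Max ?S}" by simp
      qed
      have "Max ?S \<in> ?S" using finite_rows False by (rule Max_in)
      then show "{1..Max ?S} \<subseteq> ?S" using row_antimono[of _ "Max ?S" \<mu>] by fastforce
    qed
    then show ?thesis by blast
  qed
  then obtain n where n: "?S = {1..n}" by blast
  moreover have "num_rows \<mu> = n" unfolding num_rows_def n by simp
  ultimately show ?thesis by simp
qed

lemma row_eq_0_iff: "row \<mu> k = 0 \<longleftrightarrow> k = 0 \<or> num_rows \<mu> < k"
proof -
  have "row \<mu> k \<noteq> 0 \<longleftrightarrow> k \<in> {1..num_rows \<mu>}" using nonzero_rows[of \<mu>] by blast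
  then show ?thesis by (cases "k = 0") auto
qed

lemma addable_bounds: "i \<in> addable \<mu> \<Longrightarrow> 1 \<le> i \<and> i \<le> num_rows \<mu> + 1"
  using row_eq_0_iff[of \<mu> "i - 1"] by (auto simp: addable_def)

lemma removable_bounds: "i \<in> removable \<mu> \<Longrightarrow> 1 \<le> i \<and> i \<le> num_rows \<mu>"
  using row_eq_0_iff[of \<mu> i] by (auto simp: removable_def not_le)

lemma row_add_box:
  assumes "i \<in> addable \<mu>"
  shows "row (add_box \<mu> i) = (row \<mu>)(i := row \<mu> i + 1)"
proof -
  have "((row \<mu>)(i := row \<mu> i + 1)) (k + 1) \<le> ((row \<mu>)(i := row \<mu> i + 1)) k" if "1 \<le> k" for k
    using assms row_Suc_le[OF that, of \<mu>] that by (auto simp: addable_def)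
  moreover have "finite {k. ((row \<mu>)(i := row \<mu> i + 1)) k \<noteq> 0}"
    by (rule finite_subset[of _ "insert i {k. row \<mu> k \<noteq> 0}"]) (use finite_rows[of \<mu>] in auto)
  ultimately show ?thesis
    unfolding add_box_def using assms by (subst Abs_young_inverse) (auto simp: addable_def)
qed

lemma row_remove_box:
  assumes "i \<in> removable \<mu>"
  shows "row (remove_box \<mu> i) = (row \<mu>)(i := row \<mu> i - 1)"
proof -
  have "((row \<mu>)(i := row \<mu> i - 1)) (k + 1) \<le> ((row \<mu>)(i := row \<mu> i - 1)) k" if "1 \<le> k" for k
    using assms row_Suc_le[OF that, of \<mu>] that by (auto simp: removable_def)
  moreover have "finite {k. ((row \<mu>)(i := row \<mu> i - 1)) k \<noteq> 0}"
    by (rule finite_subset[of _ "{k. row \<mu> k \<noteq> 0}"]) (use finite_rows[of \<mu>] in auto)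
  ultimately show ?thesis
    unfolding remove_box_def using assms by (subst Abs_young_inverse) (auto simp: removable_def)
qed

lemma num_rows_le: "(\<And>k. n < k \<Longrightarrow> row \<mu> k = 0) \<Longrightarrow> num_rows \<mu> \<le> n"
  using row_eq_0_iff[of \<mu> "num_rows \<mu>"] by (metis linorder_not_less not_less_zero order_less_irrefl)

lemma num_rows_add_box: "i \<in> addable \<mu> \<Longrightarrow> num_rows (add_box \<mu> i) \<le> num_rows \<mu> + 1"
  using addable_bounds[of i \<mu>] by (intro num_rows_le) (auto simp: row_add_box row_eq_0_iff)

lemma num_rows_remove_box: "i \<in> removable \<mu> \<Longrightarrow> num_rows (remove_box \<mu> i) \<le> num_rows \<mu>"
proof (rule num_rows_le)
  fix k assume "i \<in> removable \<mu>" "num_rows \<mu> < k"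
  moreover from this have "row \<mu> k = 0" by (simp add: row_eq_0_iff)
  ultimately show "row (remove_box \<mu> i) k = 0" by (cases "k = i") (simp_all add: row_remove_box)
qed

lemma young_eqI: "(\<And>k. 1 \<le> k \<Longrightarrow> row \<mu> k = row \<nu> k) \<Longrightarrow> \<mu> = \<nu>"
  by (metis One_nat_def Suc_leI ext gr0I row_0 row_inject)

lemma removable_add_box: "i \<in> addable \<mu> \<Longrightarrow> i \<in> removable (add_box \<mu> i)"
  using row_Suc_le[of i \<mu>] by (auto simp: removable_def addable_def row_add_box)

lemma remove_add_box: "i \<in> addable \<mu> \<Longrightarrow> remove_box (add_box \<mu> i) i = \<mu>"
  by (rule young_eqI) (simp add: row_remove_box removable_add_box row_add_box)

lemma addable_remove_box:
  assumes "i \<in> removable \<mu>"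
  shows "i \<in> addable (remove_box \<mu> i)"
proof -
  have "row \<mu> i \<le> row \<mu> (i - 1)" "1 \<le> row \<mu> i" if "2 \<le> i"
    using row_Suc_le[of "i - 1" \<mu>] that assms by (auto simp: removable_def)
  then show ?thesis using assms by (fastforce simp: addable_def removable_def row_remove_box[OF assms])
qed

lemma add_remove_box: "i \<in> removable \<mu> \<Longrightarrow> add_box (remove_box \<mu> i) i = \<mu>"
  by (rule young_eqI) (auto simp: row_remove_box addable_remove_box row_add_box removable_def)

section \<open>Expansions of products of linear factors\<close>

abbreviation lin_poly :: "'k::field \<Rightarrow> 'k poly" where "lin_poly a \<equiv> [:- a, 1:]"

text \<open>
  The expansion of \<open>p(z) / z ^ degree p\<close> in \<open>X = z\<^sup>-\<^sup>1\<close>. It is multiplicative, so identities of polynomials yield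
  identities of expansions.
\<close>

definition inf_fps :: "'k::field poly \<Rightarrow> 'k fps" where
  "inf_fps p = fps_of_poly (reflect_poly p)"

lemma inf_fps_mult: "inf_fps (p * q) = inf_fps p * inf_fps q"
  by (simp add: inf_fps_def reflect_poly_mult fps_of_poly_mult)

lemma inf_fps_prod: "inf_fps (\<Prod>i\<in>I. p i) = (\<Prod>i\<in>I. inf_fps (p i))"
  by (induction I rule: infinite_finite_induct) (simp_all add: inf_fps_mult, simp_all add: inf_fps_def)

lemma inf_fps_lin: "inf_fps (lin_poly a) = lin_fps a"
proof -
  have "coeff (reflect_poly (lin_poly a)) n = coeff [:1, - a:] n" for n
    by (auto simp: coeff_reflect_poly coeff_pCons split: nat.split)
  then have "reflect_poly (lin_poly a) = [:1, - a:]" by (rule poly_eqI)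
  then show ?thesis by (simp add: inf_fps_def lin_fps_def fps_of_poly_pCons)
qed

lemma inf_fps_nz: "p \<noteq> 0 \<Longrightarrow> inf_fps p \<noteq> 0"
  by (simp add: inf_fps_def)

lemma expand_inf_eqI:
  assumes "degree p = degree q" "q \<noteq> 0" "A * inf_fps q = inf_fps p"
  shows "expand_inf p q = A"
proof -
  have "expand_inf p q = A * inf_fps q / inf_fps q"
    using assms by (simp add: expand_inf_def inf_fps_def)
  then show ?thesis using inf_fps_nz[OF assms(2)] by simp
qed

lemma prod_lin_poly: "degree (\<Prod>i\<in>I. lin_poly (a i)) = card I" "(\<Prod>i\<in>I. lin_poly (a i)) \<noteq> 0"
proof -
  show nz: "(\<Prod>i\<in>I. lin_poly (a i)) \<noteq> 0"
    by (induction I rule: infinite_finite_induct) (simp_all del: mult_pCons_left mult_pCons_right)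
  show "degree (\<Prod>i\<in>I. lin_poly (a i)) = card I"
    by (cases "finite I") (simp_all add: degree_prod_eq_sum_degree)
qed


section \<open>Coordinates of the rows\<close>

lemma linear_extension_superset:
  assumes "finite S" "keys v \<subseteq> S"
  shows "linear_extension g v = (\<Sum>b\<in>S. vscale (lookup v b) (g b))"
  unfolding linear_extension_def
  by (rule sum.mono_neutral_left) (use assms in \<open>auto simp: in_keys_iff\<close>)

lemma linear_extension_ket: "linear_extension g (ket b) = g b"
  by (simp add: linear_extension_superset[of "{b}"] ket_def)

lemma linear_linear_extension: "linear_op (linear_extension g)"
proof -
  have add: "linear_extension g (v + w) = linear_extension g v + linear_extension g w" for v w
  proof -
    let ?S = "keys v \<union> keys w"
    have "linear_extension g (v + w) = (\<Sum>b\<in>?S. vscale (lookup (v + w) b) (g b))"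
      by (rule linear_extension_superset) (use keys_add[of v w] in auto)
    also have "\<dots> = linear_extension g v + linear_extension g w"
      by (subst (1 2) linear_extension_superset[of ?S]) (auto simp: lookup_add vscale_add_left sum.distrib)
    finally show ?thesis .
  qed
  have scale: "linear_extension g (vscale t v) = vscale t (linear_extension g v)" for t v
  proof -
    have "linear_extension g (vscale t v) = (\<Sum>b\<in>keys v. vscale (lookup (vscale t v) b) (g b))"
      by (rule linear_extension_superset) (auto simp: in_keys_iff)
    then show ?thesis by (simp add: linear_extension_def vscale_sum_right vscale_vscale)
  qed
  show ?thesis using add scale by (simp add: Vector_Spaces.linear_iff vector_space_vscale)
qed

definition lex_less :: "'r::linorder \<times> nat \<Rightarrow> 'r \<times> nat \<Rightarrow> bool" where
  "lex_less b b' \<longleftrightarrow> fst b < fst b' \<or> fst b = fst b' \<and> snd b < snd b'"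

text \<open>
  Parameters for which the weights of different boxes are different, also across the tensor factors.
  The first condition also forces characteristic 0.
\<close>

locale generic_parameters =
  fixes h1 h2 :: "'k::field" and u :: "'r::{finite,linorder} \<Rightarrow> 'k"
  assumes independent: "of_int m * h1 + of_int n * h2 = 0 \<Longrightarrow> m = 0 \<and> n = 0"
    and u_generic: "a \<noteq> b \<Longrightarrow> u a - u b \<noteq> of_int m * h1 + of_int n * h2"
begin

text \<open>
  All coordinates, shifted coordinates and zeros and poles of the tails are of this form, so that inequalities
  between them are decided by the next lemma.
\<close>

definition lattice_point :: "'r \<Rightarrow> int \<Rightarrow> int \<Rightarrow> 'k" where
  "lattice_point a m n = of_int m * h1 + of_int n * h2 + u a"

lemma lattice_point_eq_iff: "lattice_point a m n = lattice_point b m' n' \<longleftrightarrow> a = b \<and> m = m' \<and> n = n'"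
proof
  assume eq: "lattice_point a m n = lattice_point b m' n'"
  then have *: "u a - u b = of_int (m' - m) * h1 + of_int (n' - n) * h2"
    by (simp add: lattice_point_def algebra_simps)
  then have "a = b" using u_generic by blast
  then show "a = b \<and> m = m' \<and> n = n'" using * independent[of "m' - m" "n' - n"] by simp
qed simp

lemma h_nz: "h1 \<noteq> 0" "h2 \<noteq> 0" "h1 + h2 \<noteq> 0" "(2::'k) \<noteq> 0" "(3::'k) \<noteq> 0"
  using independent[of 1 0] independent[of 0 1] independent[of 1 1] independent[of 2 0] independent[of 3 0] by auto

text \<open>
  The coordinate of a row is the weight of the box that would be added to it.
\<close>

definition coords :: "('r \<Rightarrow> young) \<Rightarrow> 'r \<times> nat \<Rightarrow> 'k" where
  "coords \<Lambda> b = rowk (\<Lambda> (fst b)) (snd b) * h1 + (of_nat (snd b) - 1) * h2 + u (fst b)"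

lemma coords_point: "coords \<Lambda> b = lattice_point (fst b) (int (row (\<Lambda> (fst b)) (snd b))) (int (snd b) - 1)"
  by (simp add: coords_def lattice_point_def)

lemma lattice_point_shift:
  "lattice_point a m n + h1 = lattice_point a (m + 1) n" "lattice_point a m n - h1 = lattice_point a (m - 1) n"
  "lattice_point a m n + h2 = lattice_point a m (n + 1)" "lattice_point a m n - h2 = lattice_point a m (n - 1)"
  "lattice_point a m n + of_int k * h1 = lattice_point a (m + k) n"
  by (simp_all add: lattice_point_def algebra_simps)

lemma inj_coords: "inj coords"
proof (rule injI)
  fix \<Lambda> M assume eq: "coords \<Lambda> = coords M"
  show "\<Lambda> = M"
  proof (rule ext, rule young_eqI)
    fix a k
    show "row (\<Lambda> a) k = row (M a) k"
      using fun_cong[OF eq, of "(a, k)"] by (simp add: coords_point lattice_point_eq_iff)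
  qed
qed

text \<open>
  The basis vector as a function of the coordinates, extended by 0 to coordinates that do not come from diagrams.
\<close>

definition row_ket :: "('r \<times> nat \<Rightarrow> 'k) \<Rightarrow> ('r \<Rightarrow> young, 'k) based_space" where
  "row_ket y = (if y \<in> range coords then ket (inv coords y) else 0)"

lemma row_ket_coords: "row_ket (coords \<Lambda>) = ket \<Lambda>"
  by (simp add: row_ket_def inv_f_f[OF inj_coords])

definition rows_upto :: "nat \<Rightarrow> ('r \<times> nat) set" where
  "rows_upto N = UNIV \<times> {1..N}"

lemma finite_rows_upto: "finite (rows_upto N)"
  by (simp add: rows_upto_def)

lemma coords_add_box:
  assumes "i \<in> addable (\<Lambda> a)"
  shows "coords (\<Lambda>(a := add_box (\<Lambda> a) i)) = shift_at h1 (coords \<Lambda>) (a, i)"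
  using assms by (auto simp: fun_eq_iff shift_at_def coords_def row_add_box algebra_simps)

lemma coords_remove_box:
  assumes "i \<in> removable (\<Lambda> a)"
  shows "coords (\<Lambda>(a := remove_box (\<Lambda> a) i)) = shift_at (- h1) (coords \<Lambda>) (a, i)"
proof -
  have "1 \<le> row (\<Lambda> a) i" using assms by (auto simp: removable_def)
  then show ?thesis
    using assms by (auto simp: fun_eq_iff shift_at_def coords_def row_remove_box of_nat_diff algebra_simps)
qed

lemma spread_coords: "spread h1 (rows_upto N) (coords \<Lambda>)"
  unfolding spread_def
proof (intro ballI impI allI)
  fix b b' n assume "b \<in> rows_upto N" "b' \<in> rows_upto N" "b \<noteq> b'"
  then show "coords \<Lambda> b - coords \<Lambda> b' \<noteq> of_int n * h1"
    unfolding coords_point diff_eq_eq add.commute[of "of_int n * h1"] lattice_point_shift lattice_point_eq_iff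
    by (auto simp: prod_eq_iff)
qed

text \<open>
  The rows below the \<open>N\<close>-th are empty, with coordinates in arithmetic progression, and their factors in the infinite
  products telescope to \<open>(z - tail_zero N a) / (z - tail_pole N a)\<close>, where \<open>tail_pole N a\<close> is the coordinate of the
  row \<open>N + 1\<close>.
\<close>

definition tail_pole :: "nat \<Rightarrow> 'r \<Rightarrow> 'k" where
  "tail_pole N a = of_nat N * h2 + u a"

definition tail_zero :: "nat \<Rightarrow> 'r \<Rightarrow> 'k" where
  "tail_zero N a = of_nat N * h2 + u a - h1 - h2"

text \<open>
  The factors of a row \<open>b\<close> that come from the tails: raising sees the tails of the earlier tensor factors, lowering
  those of its own and of the later ones. Together they see each tail once.
\<close>

definition raise_factor :: "nat \<Rightarrow> 'r \<times> nat \<Rightarrow> 'k \<Rightarrow> 'k" where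
  "raise_factor N b v = (\<Prod>a\<in>{..<fst b}. (v - tail_zero N a) / (v - tail_pole N a)) / h1"

definition lower_factor :: "nat \<Rightarrow> 'r \<times> nat \<Rightarrow> 'k \<Rightarrow> 'k" where
  "lower_factor N b v = - (\<Prod>a\<in>{fst b..}. (v - tail_zero N a) / (v - tail_pole N a)) / h1"

section \<open>Telescoping\<close>

text \<open>
  Numerator and denominator of \<open>\<gamma>\<close> with the rows up to \<open>N\<close> written separately. For \<open>N = num_rows (\<Lambda> a)\<close> they are the
  given ones; for larger \<open>N\<close> both acquire the same further factors.
\<close>

definition row_num :: "nat \<Rightarrow> ('r \<Rightarrow> young) \<Rightarrow> 'r \<Rightarrow> 'k poly" where
  "row_num N \<Lambda> a = (\<Prod>i=1..N. lin_poly (coords \<Lambda> (a, i) + h2) * lin_poly (coords \<Lambda> (a, i) - h1 - h2)) * lin_poly (tail_zero N a)"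

definition row_den :: "nat \<Rightarrow> ('r \<Rightarrow> young) \<Rightarrow> 'r \<Rightarrow> 'k poly" where
  "row_den N \<Lambda> a = (\<Prod>i=1..N. lin_poly (coords \<Lambda> (a, i)) * lin_poly (coords \<Lambda> (a, i) - h1)) * lin_poly (tail_pole N a)"

lemma coords_tail: "num_rows (\<Lambda> a) < i \<Longrightarrow> coords \<Lambda> (a, i) = tail_pole (i - 1) a"
  using row_eq_0_iff[of "\<Lambda> a" i] by (cases i) (simp_all add: coords_def tail_pole_def)

text \<open>
  In \<open>\<gamma>\<close> the factors are grouped by neighbouring rows \<open>i\<close> and \<open>i + 1\<close>; this regroups them by rows.
\<close>

lemma shift_prod: "(\<Prod>i=1..n. F (Suc i)) * F 1 = (\<Prod>i=1..n. F i) * (F (Suc n) :: 'a::comm_monoid_mult)"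
proof (induction n)
  case (Suc n)
  have "(\<Prod>i=1..Suc n. F (Suc i)) * F 1 = ((\<Prod>i=1..n. F (Suc i)) * F 1) * F (Suc (Suc n))"
    by (simp add: mult_ac)
  also have "\<dots> = (\<Prod>i=1..Suc n. F i) * F (Suc (Suc n))"
    unfolding Suc.IH by simp
  finally show ?case .
qed simp

lemma gamma_num_eq: "gamma_num h1 h2 (\<Lambda> a) (u a) = row_num (num_rows (\<Lambda> a)) \<Lambda> a"
proof -
  let ?y = "\<lambda>i. coords \<Lambda> (a, i)" and ?n = "num_rows (\<Lambda> a)"
  let ?F = "\<lambda>i. lin_poly (?y i - h1 - h2)"
  have 1: "(rowk (\<Lambda> a) 1 - 1) * h1 - h2 + u a = ?y 1 - h1 - h2" by (simp add: coords_def algebra_simps)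
  have 2: "rowk (\<Lambda> a) i * h1 + of_nat i * h2 + u a = ?y i + h2" for i by (simp add: coords_def algebra_simps)
  have 3: "(rowk (\<Lambda> a) (i + 1) - 1) * h1 + (of_nat i - 1) * h2 + u a = ?y (Suc i) - h1 - h2" for i
    by (simp add: coords_def algebra_simps)
  have "gamma_num h1 h2 (\<Lambda> a) (u a) = ((\<Prod>i=1..?n. ?F (Suc i)) * ?F 1) * (\<Prod>i=1..?n. lin_poly (?y i + h2))"
    unfolding gamma_num_def 1 2 3 prod.distrib by (simp only: mult_ac)
  also have "\<dots> = row_num ?n \<Lambda> a"
    unfolding shift_prod[of ?F] row_num_def prod.distrib
    by (simp only: coords_tail[of \<Lambda> a "Suc ?n"] lessI tail_zero_def tail_pole_def diff_Suc_1 mult_ac)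
  finally show ?thesis .
qed

lemma gamma_den_eq: "gamma_den h1 h2 (\<Lambda> a) (u a) = row_den (num_rows (\<Lambda> a)) \<Lambda> a"
proof -
  let ?y = "\<lambda>i. coords \<Lambda> (a, i)" and ?n = "num_rows (\<Lambda> a)"
  let ?F = "\<lambda>i. lin_poly (?y i)"
  have 1: "rowk (\<Lambda> a) 1 * h1 + u a = ?y 1" by (simp add: coords_def algebra_simps)
  have 2: "rowk (\<Lambda> a) (i + 1) * h1 + of_nat i * h2 + u a = ?y (Suc i)" for i by (simp add: coords_def algebra_simps)
  have 3: "(rowk (\<Lambda> a) i - 1) * h1 + (of_nat i - 1) * h2 + u a = ?y i - h1" for i
    by (simp add: coords_def algebra_simps)
  have "gamma_den h1 h2 (\<Lambda> a) (u a) = ((\<Prod>i=1..?n. ?F (Suc i)) * ?F 1) * (\<Prod>i=1..?n. lin_poly (?y i - h1))"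
    unfolding gamma_den_def 1 2 3 prod.distrib by (simp only: mult_ac)
  also have "\<dots> = row_den ?n \<Lambda> a"
    unfolding shift_prod[of ?F] row_den_def prod.distrib
    by (simp only: coords_tail[of \<Lambda> a "Suc ?n"] lessI diff_Suc_1 mult_ac)
  finally show ?thesis .
qed

lemma row_num_den_cofactor:
  assumes "num_rows (\<Lambda> a) \<le> N"
  shows "\<exists>R. R \<noteq> 0 \<and> row_num N \<Lambda> a = gamma_num h1 h2 (\<Lambda> a) (u a) * R \<and> row_den N \<Lambda> a = gamma_den h1 h2 (\<Lambda> a) (u a) * R"
  using assms
proof (induction N rule: dec_induct)
  case base
  then show ?case by (intro exI[of _ 1]) (simp add: gamma_num_eq gamma_den_eq)
next
  case (step N)
  then obtain R where R: "R \<noteq> 0" "row_num N \<Lambda> a = gamma_num h1 h2 (\<Lambda> a) (u a) * R"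
      "row_den N \<Lambda> a = gamma_den h1 h2 (\<Lambda> a) (u a) * R" by blast
  let ?Q = "lin_poly (tail_pole N a + h2) * lin_poly (tail_pole N a - h1)"
  have y: "coords \<Lambda> (a, Suc N) = tail_pole N a" using coords_tail[of \<Lambda> a "Suc N"] step.hyps by simp
  have t: "tail_zero (Suc N) a = tail_pole N a - h1" "tail_pole (Suc N) a = tail_pole N a + h2"
    "tail_pole N a - h1 - h2 = tail_zero N a"
    by (simp_all add: tail_zero_def tail_pole_def algebra_simps)
  have "row_num (Suc N) \<Lambda> a = row_num N \<Lambda> a * ?Q" "row_den (Suc N) \<Lambda> a = row_den N \<Lambda> a * ?Q"
    unfolding row_num_def row_den_def
    by (simp_all only: prod.nat_ivl_Suc' One_nat_def le_add1 plus_1_eq_Suc Suc_le_mono le0 y t mult_ac)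
  moreover have "R * ?Q \<noteq> 0" using R(1) by (simp del: mult_pCons_left mult_pCons_right)
  ultimately show ?case using R(2,3) by (intro exI[of _ "R * ?Q"]) (simp only: mult_ac simp_thms)
qed

lemma gamma_value:
  assumes "num_rows (\<Lambda> a) \<le> N" "poly (row_den N \<Lambda> a) \<chi> \<noteq> 0"
  shows "gamma h1 h2 (\<Lambda> a) (u a) \<chi> =
    (\<Prod>i=1..N. bond h1 h2 (\<chi> - coords \<Lambda> (a, i))) * ((\<chi> - tail_zero N a) / (\<chi> - tail_pole N a))"
proof -
  obtain R where R: "row_num N \<Lambda> a = gamma_num h1 h2 (\<Lambda> a) (u a) * R"
      "row_den N \<Lambda> a = gamma_den h1 h2 (\<Lambda> a) (u a) * R"
    using row_num_den_cofactor[of \<Lambda> a N, OF assms(1)] by blast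
  have "poly R \<chi> \<noteq> 0" using assms(2) by (simp add: R(2))
  then have "gamma h1 h2 (\<Lambda> a) (u a) \<chi> = poly (row_num N \<Lambda> a) \<chi> / poly (row_den N \<Lambda> a) \<chi>"
    by (simp add: gamma_def R)
  also have "\<dots> = (\<Prod>i=1..N. bond h1 h2 (\<chi> - coords \<Lambda> (a, i))) * ((\<chi> - tail_zero N a) / (\<chi> - tail_pole N a))"
    by (simp add: row_num_def row_den_def poly_prod bond_def prod_dividef diff_diff_eq2 algebra_simps)
  finally show ?thesis .
qed

lemma expand_gamma:
  assumes "num_rows (\<Lambda> a) \<le> N"
  shows "expand_inf (gamma_num h1 h2 (\<Lambda> a) (u a)) (gamma_den h1 h2 (\<Lambda> a) (u a)) =
    (\<Prod>i=1..N. lin_fps (coords \<Lambda> (a, i) + h2) * lin_fps (coords \<Lambda> (a, i) - h1 - h2) *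
       (delta_plus (coords \<Lambda> (a, i)) * delta_plus (coords \<Lambda> (a, i) - h1))) *
    (lin_fps (tail_zero N a) * delta_plus (tail_pole N a))" (is "_ = ?A")
proof (rule expand_inf_eqI)
  obtain R where R: "R \<noteq> 0" "row_num N \<Lambda> a = gamma_num h1 h2 (\<Lambda> a) (u a) * R"
      "row_den N \<Lambda> a = gamma_den h1 h2 (\<Lambda> a) (u a) * R"
    using row_num_den_cofactor[of \<Lambda> a N, OF assms(1)] by blast
  have nz: "row_num n \<Lambda> a \<noteq> 0" "row_den n \<Lambda> a \<noteq> 0" for n
    unfolding row_num_def row_den_def prod.distrib mult_eq_0_iff using prod_lin_poly(2) by auto
  have d: "degree ((\<Prod>i=1..n. lin_poly (v i)) * (\<Prod>i=1..n. lin_poly (w i)) * lin_poly t) = 2 * n + 1" for n v w and t :: 'k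
    using prod_lin_poly[of v "{1..n}"] prod_lin_poly[of w "{1..n}"]
    by (simp add: degree_mult_eq del: mult_pCons_left mult_pCons_right)
  have deg: "degree (row_num n \<Lambda> a) = 2 * n + 1" "degree (row_den n \<Lambda> a) = 2 * n + 1" for n
    unfolding row_num_def row_den_def prod.distrib by (rule d)+
  show "degree (gamma_num h1 h2 (\<Lambda> a) (u a)) = degree (gamma_den h1 h2 (\<Lambda> a) (u a))"
    unfolding gamma_num_eq gamma_den_eq deg ..
  show "gamma_den h1 h2 (\<Lambda> a) (u a) \<noteq> 0" unfolding gamma_den_eq by (rule nz)
  have "?A * inf_fps (row_den N \<Lambda> a) = (\<Prod>i=1..N. lin_fps (coords \<Lambda> (a, i) + h2) * lin_fps (coords \<Lambda> (a, i) - h1 - h2) *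
       ((lin_fps (coords \<Lambda> (a, i)) * delta_plus (coords \<Lambda> (a, i))) * (lin_fps (coords \<Lambda> (a, i) - h1) * delta_plus (coords \<Lambda> (a, i) - h1)))) *
    (lin_fps (tail_zero N a) * (lin_fps (tail_pole N a) * delta_plus (tail_pole N a)))"
    unfolding row_den_def inf_fps_mult inf_fps_prod inf_fps_lin prod.distrib by (simp only: mult_ac)
  also have "\<dots> = inf_fps (row_num N \<Lambda> a)"
    unfolding lin_delta_plus row_num_def inf_fps_mult inf_fps_prod inf_fps_lin by simp
  finally have "?A * inf_fps (gamma_den h1 h2 (\<Lambda> a) (u a)) * inf_fps R = inf_fps (gamma_num h1 h2 (\<Lambda> a) (u a)) * inf_fps R"
    unfolding R inf_fps_mult by (simp only: mult.assoc)
  then show "?A * inf_fps (gamma_den h1 h2 (\<Lambda> a) (u a)) = inf_fps (gamma_num h1 h2 (\<Lambda> a) (u a))"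
    using inf_fps_nz[OF R(1)] by simp
qed

end

section \<open>The tensor product of Fock modules\<close>

lemma linearly_ordered_rows_lex: "finite J \<Longrightarrow> linearly_ordered_rows J (lex_less :: 'r::linorder \<times> nat \<Rightarrow> _)"
  by unfold_locales (auto simp: lex_less_def prod_eq_iff not_less)

lemma prod_Times: "(\<Prod>x\<in>A \<times> B. g x) = (\<Prod>a\<in>A. \<Prod>b\<in>B. g (a, b))"
  by (simp add: prod.cartesian_product split_def)

context generic_parameters
begin

lemma row_den_nz:
  assumes "a \<noteq> l"
  shows "poly (row_den N \<Lambda> l) (lattice_point a m n) \<noteq> 0"
proof -
  have "tail_pole N l = lattice_point l 0 (int N)" by (simp add: tail_pole_def lattice_point_def)
  then show ?thesis
    using assms unfolding row_den_def poly_mult poly_prod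
    by (simp add: coords_point lattice_point_shift lattice_point_eq_iff del: mult_pCons_left mult_pCons_right)
qed

abbreviation fock_e where "fock_e \<equiv> fock_tensor_e h1 h2 u"
abbreviation fock_f where "fock_f \<equiv> fock_tensor_f h1 h2 u"
abbreviation fock_psi where "fock_psi \<equiv> fock_tensor_psi h1 h2 u"

abbreviation e_coeff :: "nat \<Rightarrow> ('r \<times> nat \<Rightarrow> 'k) \<Rightarrow> 'r \<times> nat \<Rightarrow> 'k" where
  "e_coeff N \<equiv> linearly_ordered_rows.row_coeff h1 h2 (rows_upto N) lex_less (raise_factor N)"

abbreviation f_coeff :: "nat \<Rightarrow> ('r \<times> nat \<Rightarrow> 'k) \<Rightarrow> 'r \<times> nat \<Rightarrow> 'k" where
  "f_coeff N \<equiv> lowering_coeff h1 h2 (rows_upto N) lex_less (lower_factor N)"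

abbreviation psi_coeff :: "nat \<Rightarrow> ('r \<times> nat \<Rightarrow> 'k) \<Rightarrow> 'k fps" where
  "psi_coeff N \<equiv> rows_psi_series h1 h2 (rows_upto N) UNIV (tail_zero N) (tail_pole N)"

lemmas e_coeff_def = linearly_ordered_rows.row_coeff_def[OF linearly_ordered_rows_lex[OF finite_rows_upto]]

lemma fock_e_point_eq: "fock_e_point h1 h2 (u a) (\<Lambda> a) i = coords \<Lambda> (a, i)"
  by (simp add: fock_e_point_def coords_def)

lemma fock_f_point_eq: "fock_f_point h1 h2 (u a) (\<Lambda> a) i = coords \<Lambda> (a, i) - h1"
  by (simp add: fock_f_point_def coords_def algebra_simps)

lemma bond_diff: "bond h1 h2 (y - x) = bond h1 h2 (x - h1 - y)"
proof -
  have "x - h1 - y = - (y - x) - h1" by simp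
  then show ?thesis by (simp only: bond_reflect)
qed

text \<open>
  The functions \<open>\<gamma>\<close> of the earlier tensor factors and the product in the Fock module are one product of structure
  functions over all rows that precede \<open>(k, i)\<close> in the lexicographic order.
\<close>

lemma fock_e_coeff:
  assumes "\<And>a. num_rows (\<Lambda> a) < N" "i \<in> {1..N}"
  shows "mode (fps_const (\<Prod>l\<in>{..<k}. gamma h1 h2 (\<Lambda> l) (u l) (fock_e_point h1 h2 (u k) (\<Lambda> k) i)) *
      fock_e_series h1 h2 (u k) (\<Lambda> k) i) p = coords \<Lambda> (k, i) ^ p * e_coeff N (coords \<Lambda>) (k, i)"
proof -
  let ?x = "coords \<Lambda> (k, i)"
  let ?b = "\<lambda>l j. bond h1 h2 (?x - coords \<Lambda> (l, j))"
  have x: "?x = lattice_point k (int (row (\<Lambda> k) i)) (int i - 1)" by (simp add: coords_point)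
  have "gamma h1 h2 (\<Lambda> l) (u l) ?x = (\<Prod>j=1..N. ?b l j) * ((?x - tail_zero N l) / (?x - tail_pole N l))" if "l \<in> {..<k}" for l
    using that assms(1)[of l] by (intro gamma_value) (auto simp: x intro!: row_den_nz)
  then have g: "(\<Prod>l\<in>{..<k}. gamma h1 h2 (\<Lambda> l) (u l) ?x) =
     (\<Prod>l\<in>{..<k}. \<Prod>j=1..N. ?b l j) * (\<Prod>l\<in>{..<k}. (?x - tail_zero N l) / (?x - tail_pole N l))"
    by (simp only: prod.distrib cong: prod.cong)
  have e: "fock_e_prod h1 h2 (\<Lambda> k) i = (\<Prod>j=1..<i. ?b k j)"
    unfolding fock_e_prod_def
  proof (rule prod.cong[OF refl])
    fix j
    let ?t = "?x - coords \<Lambda> (k, j)" and ?d = "rowk (\<Lambda> k) i - rowk (\<Lambda> k) j :: 'k"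
    have "?d * h1 + (of_nat i - of_nat j - 1) * h2 = ?t - h2" "(?d + 1) * h1 + (of_nat i - of_nat j + 1) * h2 = ?t + h1 + h2"
      "?d * h1 + (of_nat i - of_nat j) * h2 = ?t" "(?d + 1) * h1 + (of_nat i - of_nat j) * h2 = ?t + h1"
      by (simp_all add: coords_def algebra_simps)
    then show "(?d * h1 + (of_nat i - of_nat j - 1) * h2) * ((?d + 1) * h1 + (of_nat i - of_nat j + 1) * h2) /
      ((?d * h1 + (of_nat i - of_nat j) * h2) * ((?d + 1) * h1 + (of_nat i - of_nat j) * h2)) = ?b k j"
      by (simp only: bond_def)
  qed
  have set: "{j\<in>rows_upto N. lex_less j (k, i)} = {..<k} \<times> {1..N} \<union> {k} \<times> {1..<i}"
    using assms(2) by (auto simp: rows_upto_def lex_less_def)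
  have "(\<Prod>j\<in>{j\<in>rows_upto N. lex_less j (k, i)}. bond h1 h2 (?x - coords \<Lambda> j)) =
     (\<Prod>l\<in>{..<k}. \<Prod>j=1..N. ?b l j) * (\<Prod>j=1..<i. ?b k j)"
    unfolding set
    by (subst prod.union_disjoint) (auto simp: prod_Times)
  then have "e_coeff N (coords \<Lambda>) (k, i) = (\<Prod>l\<in>{..<k}. gamma h1 h2 (\<Lambda> l) (u l) ?x) * fock_e_prod h1 h2 (\<Lambda> k) i / h1"
    unfolding e_coeff_def raise_factor_def g e by simp
  then show ?thesis
    unfolding fock_e_point_eq fock_e_series_def mode_def delta_plus_def by (simp add: mult_ac)
qed

text \<open>
  The given product pairs \<open>j\<close> with \<open>j + 1\<close>; moving the second halves by one step gives the structure function of each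
  row and a last factor, which is the tail.
\<close>

lemma fock_f_prod_telescope:
  assumes "\<And>a. num_rows (\<Lambda> a) < N" "i \<in> {1..N}"
  shows "fock_f_prod h1 h2 (\<Lambda> k) i = (\<Prod>j\<in>{i<..N}. bond h1 h2 (coords \<Lambda> (k, j) - coords \<Lambda> (k, i))) *
     ((coords \<Lambda> (k, i) - h1 - tail_zero N k) / (coords \<Lambda> (k, i) - h1 - tail_pole N k))"
proof -
  let ?t = "\<lambda>j. coords \<Lambda> (k, j) - coords \<Lambda> (k, i)"
  let ?F = "\<lambda>j. ((?t j + h1 + h2) * (?t (Suc j) - h2)) / ((?t (Suc j) + h1) * ?t j)"
  let ?n = "num_rows (\<Lambda> k)"
  have tail_factor: "?F j = 1" if j: "j \<in> {i + 1..N} - {i + 1..?n}" for j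
  proof -
    have "?n < j" "i < j" using j by auto
    then have "?t (Suc j) = ?t j + h2" using coords_tail[of \<Lambda> k j] coords_tail[of \<Lambda> k "Suc j"]
      by (cases j) (simp_all add: tail_pole_def algebra_simps)
    moreover have "?t j \<noteq> 0" "?t (Suc j) + h1 \<noteq> 0"
      using \<open>i < j\<close> unfolding diff_add_eq[symmetric] diff_eq_eq
      by (auto simp: coords_point lattice_point_shift lattice_point_eq_iff diff_add_eq)
    moreover have "(t + h1 + h2) * (t + h2 - h2) / ((t + h2 + h1) * t) = 1" if "t \<noteq> 0" "t + h2 + h1 \<noteq> 0" for t
    proof -
      have "(t + h1 + h2) * (t + h2 - h2) = (t + h2 + h1) * t" by (simp add: add_ac)
      then show ?thesis using that by simp
    qed
    ultimately show ?thesis by simp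
  qed
  have H: "(?t (i + 1) - h2) / (?t (i + 1) + h1) * (\<Prod>j=i+1..n. ?F j) =
      (\<Prod>j\<in>{i<..n}. bond h1 h2 (?t j)) * ((?t (Suc n) - h2) / (?t (Suc n) + h1))" if "i \<le> n" for n
    using that
  proof (induction n rule: dec_induct)
    case base
    then show ?case by simp
  next
    case (step n)
    have "{i<..Suc n} = insert (Suc n) {i<..n}" using step.hyps by auto
    then show ?case using step.hyps step.IH
      by (simp add: bond_def mult_ac)
  qed
  have "fock_f_prod h1 h2 (\<Lambda> k) i = (?t (i + 1) - h2) / (?t (i + 1) + h1) * (\<Prod>j=i+1..?n. ?F j)"
  proof -
    let ?r = "\<lambda>j. rowk (\<Lambda> k) j :: 'k"
    have head: "(?r (i + 1) - ?r i) * h1 = ?t (i + 1) - h2" "(?r (i + 1) - ?r i + 1) * h1 + h2 = ?t (i + 1) + h1"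
      by (simp_all add: coords_def algebra_simps)
    have "(?r j - ?r i + 1) * h1 + (of_nat j - of_nat i + 1) * h2 = ?t j + h1 + h2"
      "(?r (j + 1) - ?r i) * h1 + (of_nat j - of_nat i) * h2 = ?t (Suc j) - h2"
      "(?r (j + 1) - ?r i + 1) * h1 + (of_nat j - of_nat i + 1) * h2 = ?t (Suc j) + h1"
      "(?r j - ?r i) * h1 + (of_nat j - of_nat i) * h2 = ?t j" for j
      by (simp_all add: coords_def algebra_simps)
    then show ?thesis unfolding fock_f_prod_def head by (simp only:)
  qed
  also have "(\<Prod>j=i+1..?n. ?F j) = (\<Prod>j=i+1..N. ?F j)"
    using assms(1)[of k] by (intro prod.mono_neutral_left ballI tail_factor) auto
  also have "(?t (i + 1) - h2) / (?t (i + 1) + h1) * (\<Prod>j=i+1..N. ?F j) =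
      (\<Prod>j\<in>{i<..N}. bond h1 h2 (?t j)) * ((?t (Suc N) - h2) / (?t (Suc N) + h1))"
    using assms(2) by (intro H) auto
  also have "(?t (Suc N) - h2) / (?t (Suc N) + h1) = (- (?t (Suc N) - h2)) / (- (?t (Suc N) + h1))"
    by (simp only: minus_divide_divide)
  also have "\<dots> = (coords \<Lambda> (k, i) - h1 - tail_zero N k) / (coords \<Lambda> (k, i) - h1 - tail_pole N k)"
    using assms(1)[of k] coords_tail[of \<Lambda> k "Suc N"] by (simp add: tail_zero_def tail_pole_def algebra_simps)
  finally show ?thesis .
qed

lemma fock_f_coeff:
  assumes "\<And>a. num_rows (\<Lambda> a) < N" "i \<in> {1..N}"
  shows "mode (fps_const (\<Prod>l\<in>{k<..}. gamma h1 h2 (\<Lambda> l) (u l) (fock_f_point h1 h2 (u k) (\<Lambda> k) i)) *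
      fock_f_series h1 h2 (u k) (\<Lambda> k) i) p = (coords \<Lambda> (k, i) - h1) ^ p * f_coeff N (coords \<Lambda>) (k, i)"
proof -
  let ?y = "coords \<Lambda> (k, i)"
  let ?x = "?y - h1"
  let ?b = "\<lambda>l j. bond h1 h2 (coords \<Lambda> (l, j) - ?y)"
  let ?q = "\<lambda>l. (?x - tail_zero N l) / (?x - tail_pole N l)"
  have x: "?x = lattice_point k (int (row (\<Lambda> k) i) - 1) (int i - 1)" by (simp add: coords_point lattice_point_shift)
  have "gamma h1 h2 (\<Lambda> l) (u l) ?x = (\<Prod>j=1..N. ?b l j) * ?q l" if "l \<in> {k<..}" for l
    using that assms(1)[of l] unfolding bond_diff[of _ "coords \<Lambda> (k, i)"] by (intro gamma_value) (auto simp: x intro!: row_den_nz)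
  then have g: "(\<Prod>l\<in>{k<..}. gamma h1 h2 (\<Lambda> l) (u l) ?x) = (\<Prod>l\<in>{k<..}. \<Prod>j=1..N. ?b l j) * (\<Prod>l\<in>{k<..}. ?q l)"
    by (simp only: prod.distrib cong: prod.cong)
  have set: "{j\<in>rows_upto N. lex_less (k, i) j} = {k<..} \<times> {1..N} \<union> {k} \<times> {i<..N}"
    using assms(2) by (auto simp: rows_upto_def lex_less_def)
  have bonds: "(\<Prod>j\<in>{j\<in>rows_upto N. lex_less (k, i) j}. bond h1 h2 (coords \<Lambda> j - ?y)) =
     (\<Prod>l\<in>{k<..}. \<Prod>j=1..N. ?b l j) * (\<Prod>j\<in>{i<..N}. ?b k j)"
    unfolding set
    by (subst prod.union_disjoint) (auto simp: prod_Times)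
  have "{k..} = insert k {k<..}" by auto
  then have "lower_factor N (k, i) ?x = - (?q k * (\<Prod>l\<in>{k<..}. ?q l)) / h1"
    by (simp add: lower_factor_def)
  then have "f_coeff N (coords \<Lambda>) (k, i) = - ((\<Prod>l\<in>{k<..}. gamma h1 h2 (\<Lambda> l) (u l) ?x) * fock_f_prod h1 h2 (\<Lambda> k) i / h1)"
    unfolding lowering_coeff_def bonds g fock_f_prod_telescope[of \<Lambda> N i k, OF assms] by (simp add: mult_ac)
  then show ?thesis
    unfolding fock_f_point_eq fock_f_series_def mode_def delta_plus_def by (simp add: mult_ac)
qed

text \<open>
  A box cannot be added to a row that is as long as the previous one; then the difference of the coordinates is \<open>h2\<close>, a
  zero of the structure function.
\<close>

lemma e_coeff_not_addable:
  assumes "i \<in> {1..N}" "i \<notin> addable (\<Lambda> k)"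
  shows "e_coeff N (coords \<Lambda>) (k, i) = 0"
proof -
  have i: "2 \<le> i" "row (\<Lambda> k) i = row (\<Lambda> k) (i - 1)"
    using assms row_Suc_le[of "i - 1" "\<Lambda> k"] by (auto simp: addable_def)
  then have "coords \<Lambda> (k, i) - coords \<Lambda> (k, i - 1) = h2" by (simp add: coords_def of_nat_diff algebra_simps)
  then have "bond h1 h2 (coords \<Lambda> (k, i) - coords \<Lambda> (k, i - 1)) = 0" by (simp add: bond_def)
  moreover have "(k, i - 1) \<in> {j\<in>rows_upto N. lex_less j (k, i)}" using i assms(1) by (auto simp: rows_upto_def lex_less_def)
  ultimately have "(\<Prod>j\<in>{j\<in>rows_upto N. lex_less j (k, i)}. bond h1 h2 (coords \<Lambda> (k, i) - coords \<Lambda> j)) = 0"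
    using finite_rows_upto by (intro prod_zero) auto
  then show ?thesis unfolding e_coeff_def by simp
qed

lemma f_coeff_not_removable:
  assumes "\<And>a. num_rows (\<Lambda> a) < N" "i \<in> {1..N}" "i \<notin> removable (\<Lambda> k)"
  shows "f_coeff N (coords \<Lambda>) (k, i) = 0"
proof -
  have i: "row (\<Lambda> k) (i + 1) = row (\<Lambda> k) i"
    using assms row_Suc_le[of i "\<Lambda> k"] by (auto simp: removable_def)
  then have d: "coords \<Lambda> (k, i + 1) - coords \<Lambda> (k, i) = h2" by (simp add: coords_def algebra_simps)
  show ?thesis
  proof (cases "i = N")
    case True
    \<comment> \<open>the next row is not among the first \<open>N\<close>; its contribution is the zero of the tail\<close>
    have "coords \<Lambda> (k, i + 1) = tail_pole N k" using assms(1)[of k] True by (simp add: coords_tail)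
    then have "coords \<Lambda> (k, i) - h1 - tail_zero N k = 0"
      using d by (simp add: tail_zero_def tail_pole_def algebra_simps)
    then have "(\<Prod>a\<in>{k..}. (coords \<Lambda> (k, i) - h1 - tail_zero N a) / (coords \<Lambda> (k, i) - h1 - tail_pole N a)) = 0"
      by (intro prod_zero) auto
    then show ?thesis by (simp add: lowering_coeff_def lower_factor_def)
  next
    case False
    have "bond h1 h2 (coords \<Lambda> (k, i + 1) - coords \<Lambda> (k, i)) = 0" unfolding d by (simp add: bond_def)
    moreover have "(k, i + 1) \<in> {j\<in>rows_upto N. lex_less (k, i) j}"
      using False assms(2) by (auto simp: rows_upto_def lex_less_def)
    ultimately have "(\<Prod>j\<in>{j\<in>rows_upto N. lex_less (k, i) j}. bond h1 h2 (coords \<Lambda> j - coords \<Lambda> (k, i))) = 0"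
      using finite_rows_upto by (intro prod_zero) auto
    then show ?thesis by (simp add: lowering_coeff_def)
  qed
qed

text \<open>
  The states in which \<open>d\<close> further steps do not reach the rows below the \<open>N\<close>-th; at least one of the first \<open>N\<close>
  rows then remains empty.
\<close>

definition states :: "nat \<Rightarrow> nat \<Rightarrow> ('r \<times> nat \<Rightarrow> 'k) set" where
  "states N d = coords ` {\<Lambda>. \<forall>a. num_rows (\<Lambda> a) + d < N}"

text \<open>
  The sum over the addable rows may be extended to all rows, as the other coefficients vanish.
\<close>

lemma fock_e_action:
  assumes "\<And>a. num_rows (\<Lambda> a) < N"
  shows "fock_e p (row_ket (coords \<Lambda>)) =
    (\<Sum>b\<in>rows_upto N. vscale (coords \<Lambda> b ^ p * e_coeff N (coords \<Lambda>) b) (row_ket (shift_at h1 (coords \<Lambda>) b)))"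
proof -
  have "fock_e p (row_ket (coords \<Lambda>)) = (\<Sum>k\<in>UNIV. \<Sum>i\<in>addable (\<Lambda> k).
      vscale (coords \<Lambda> (k, i) ^ p * e_coeff N (coords \<Lambda>) (k, i)) (row_ket (shift_at h1 (coords \<Lambda>) (k, i))))"
    unfolding row_ket_coords fock_tensor_e_def linear_extension_ket
  proof (intro sum.cong refl)
    fix k i assume i: "i \<in> addable (\<Lambda> k)"
    have "i \<in> {1..N}" using addable_bounds[OF i] assms[of k] by auto
    show "vscale (mode (fps_const (\<Prod>l\<in>{..<k}. gamma h1 h2 (\<Lambda> l) (u l) (fock_e_point h1 h2 (u k) (\<Lambda> k) i)) *
        fock_e_series h1 h2 (u k) (\<Lambda> k) i) p) (ket (\<Lambda>(k := add_box (\<Lambda> k) i))) =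
      vscale (coords \<Lambda> (k, i) ^ p * e_coeff N (coords \<Lambda>) (k, i)) (row_ket (shift_at h1 (coords \<Lambda>) (k, i)))"
      unfolding fock_e_coeff[of \<Lambda>, OF assms \<open>i \<in> {1..N}\<close>] coords_add_box[of i \<Lambda> k, OF i, symmetric] row_ket_coords ..
  qed
  also have "\<dots> = (\<Sum>k\<in>UNIV. \<Sum>i\<in>{1..N}.
      vscale (coords \<Lambda> (k, i) ^ p * e_coeff N (coords \<Lambda>) (k, i)) (row_ket (shift_at h1 (coords \<Lambda>) (k, i))))"
  proof (rule sum.cong[OF refl], rule sum.mono_neutral_left)
    show "addable (\<Lambda> k) \<subseteq> {1..N}" for k using addable_bounds[of _ "\<Lambda> k"] assms[of k] by fastforce
  qed (auto simp: e_coeff_not_addable)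
  also have "\<dots> = (\<Sum>b\<in>rows_upto N. vscale (coords \<Lambda> b ^ p * e_coeff N (coords \<Lambda>) b) (row_ket (shift_at h1 (coords \<Lambda>) b)))"
    unfolding rows_upto_def by (simp add: sum.cartesian_product split_def)
  finally show ?thesis .
qed

lemma fock_f_action:
  assumes "\<And>a. num_rows (\<Lambda> a) < N"
  shows "fock_f p (row_ket (coords \<Lambda>)) =
    (\<Sum>b\<in>rows_upto N. vscale ((coords \<Lambda> b - h1) ^ p * f_coeff N (coords \<Lambda>) b) (row_ket (shift_at (- h1) (coords \<Lambda>) b)))"
proof -
  have "fock_f p (row_ket (coords \<Lambda>)) = (\<Sum>k\<in>UNIV. \<Sum>i\<in>removable (\<Lambda> k).
      vscale ((coords \<Lambda> (k, i) - h1) ^ p * f_coeff N (coords \<Lambda>) (k, i)) (row_ket (shift_at (- h1) (coords \<Lambda>) (k, i))))"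
    unfolding row_ket_coords fock_tensor_f_def linear_extension_ket
  proof (intro sum.cong refl)
    fix k i assume i: "i \<in> removable (\<Lambda> k)"
    have "i \<in> {1..N}" using removable_bounds[OF i] assms[of k] by auto
    show "vscale (mode (fps_const (\<Prod>l\<in>{k<..}. gamma h1 h2 (\<Lambda> l) (u l) (fock_f_point h1 h2 (u k) (\<Lambda> k) i)) *
        fock_f_series h1 h2 (u k) (\<Lambda> k) i) p) (ket (\<Lambda>(k := remove_box (\<Lambda> k) i))) =
      vscale ((coords \<Lambda> (k, i) - h1) ^ p * f_coeff N (coords \<Lambda>) (k, i)) (row_ket (shift_at (- h1) (coords \<Lambda>) (k, i)))"
      unfolding fock_f_coeff[of \<Lambda>, OF assms \<open>i \<in> {1..N}\<close>] coords_remove_box[of i \<Lambda> k, OF i, symmetric] row_ket_coords ..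
  qed
  also have "\<dots> = (\<Sum>k\<in>UNIV. \<Sum>i\<in>{1..N}.
      vscale ((coords \<Lambda> (k, i) - h1) ^ p * f_coeff N (coords \<Lambda>) (k, i)) (row_ket (shift_at (- h1) (coords \<Lambda>) (k, i))))"
  proof (rule sum.cong[OF refl], rule sum.mono_neutral_left)
    show "removable (\<Lambda> k) \<subseteq> {1..N}" for k using removable_bounds[of _ "\<Lambda> k"] assms[of k] by fastforce
  next
    fix k
    show "\<forall>i\<in>{1..N} - removable (\<Lambda> k). vscale ((coords \<Lambda> (k, i) - h1) ^ p * f_coeff N (coords \<Lambda>) (k, i))
       (row_ket (shift_at (- h1) (coords \<Lambda>) (k, i))) = 0"
      by (intro ballI, subst f_coeff_not_removable[OF assms]) auto
  qed simp
  also have "\<dots> = (\<Sum>b\<in>rows_upto N. vscale ((coords \<Lambda> b - h1) ^ p * f_coeff N (coords \<Lambda>) b) (row_ket (shift_at (- h1) (coords \<Lambda>) b)))"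
    unfolding rows_upto_def by (simp add: sum.cartesian_product split_def)
  finally show ?thesis .
qed

lemma raising_operators_fock:
  "raising_operators h1 h2 (rows_upto N) lex_less (raise_factor N) row_ket fock_e (states N)"
proof -
  interpret linearly_ordered_rows h1 h2 "rows_upto N" lex_less "raise_factor N"
    by (rule linearly_ordered_rows_lex[OF finite_rows_upto])
  show ?thesis
  proof (rule raising_operators.intro[OF linearly_ordered_rows_axioms], rule raising_operators_axioms.intro, goal_cases)
    case (1 p)
    show ?case unfolding fock_tensor_e_def by (rule linear_linear_extension)
  next
    case (2 z d p)
    then obtain \<Lambda> where \<Lambda>: "z = coords \<Lambda>" "\<And>a. num_rows (\<Lambda> a) + Suc d < N" by (auto simp: states_def)
    show ?case unfolding \<Lambda>(1) by (rule fock_e_action) (use \<Lambda>(2) add_lessD1 in blast)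
  next
    case (3 z d b)
    then obtain \<Lambda> where \<Lambda>: "z = coords \<Lambda>" "\<And>a. num_rows (\<Lambda> a) + Suc d < N" by (auto simp: states_def)
    obtain k i where b: "b = (k, i)" "i \<in> {1..N}" using 3(2) by (auto simp: rows_upto_def)
    have i: "i \<in> addable (\<Lambda> k)" using 3(3) e_coeff_not_addable b unfolding \<Lambda>(1) by blast
    have "num_rows ((\<Lambda>(k := add_box (\<Lambda> k) i)) a) + d < N" for a
      using \<Lambda>(2)[of a] num_rows_add_box[OF i] by auto
    then show ?case unfolding \<Lambda>(1) b(1) coords_add_box[of i \<Lambda> k, OF i, symmetric] states_def by blast
  next
    case (4 z d)
    then show ?case by (auto simp: states_def spread_coords)
  next
    case 5
    show ?case by (rule h_nz)
  next
    case 6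
    show ?case by (rule h_nz)
  qed
qed

end

context generic_parameters
begin

lemma prod_rows_upto: "(\<Prod>b\<in>rows_upto N. g b) = (\<Prod>a\<in>UNIV. \<Prod>i=1..N. g (a, i))"
  unfolding rows_upto_def by (rule prod_Times)

lemma sigma3_nz: "sigma3 h1 h2 (- h1 - h2) \<noteq> 0"
proof -
  have "- h1 - h2 = - (h1 + h2)" by simp
  then have "- h1 - h2 \<noteq> 0" using h_nz(3) by (metis neg_equal_0_iff_equal)
  then show ?thesis using h_nz(1,2) by (simp add: sigma3_def)
qed

lemma fock_psi_action:
  assumes "\<And>a. num_rows (\<Lambda> a) < N"
  shows "fock_psi p (row_ket (coords \<Lambda>)) =
    vscale (psi_mode (sigma3 h1 h2 (- h1 - h2)) (psi_coeff N (coords \<Lambda>)) p) (row_ket (coords \<Lambda>))"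
proof -
  have "(\<Prod>k\<in>UNIV. expand_inf (gamma_num h1 h2 (\<Lambda> k) (u k)) (gamma_den h1 h2 (\<Lambda> k) (u k))) =
    (\<Prod>a\<in>UNIV. (\<Prod>i=1..N. lin_fps (coords \<Lambda> (a, i) + h2) * lin_fps (coords \<Lambda> (a, i) - h1 - h2) *
       (delta_plus (coords \<Lambda> (a, i)) * delta_plus (coords \<Lambda> (a, i) - h1))) *
    (lin_fps (tail_zero N a) * delta_plus (tail_pole N a)))"
    using assms by (intro prod.cong refl expand_gamma less_imp_le) auto
  then show ?thesis
    unfolding row_ket_coords fock_tensor_psi_def linear_extension_ket rows_psi_series_def prod_rows_upto
    by (simp only: prod.distrib)
qed

lemma raising_lowering_operators_fock:
  "raising_lowering_operators h1 h2 (rows_upto N) lex_less (raise_factor N) row_ket fock_e (states N)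
     (lower_factor N) UNIV (tail_zero N) (tail_pole N) fock_f fock_psi"
proof (rule raising_lowering_operators.intro[OF raising_operators_fock],
    rule raising_lowering_operators_axioms.intro, goal_cases)
  case (1 p)
  show ?case unfolding fock_tensor_f_def by (rule linear_linear_extension)
next
  case (2 p)
  show ?case unfolding fock_tensor_psi_def by (rule linear_linear_extension)
next
  case (3 y d p)
  then obtain \<Lambda> where \<Lambda>: "y = coords \<Lambda>" "\<And>a. num_rows (\<Lambda> a) + Suc d < N" by (auto simp: states_def)
  show ?case unfolding \<Lambda>(1) by (rule fock_f_action) (use \<Lambda>(2) add_lessD1 in blast)
next
  case (4 y d b)
  then obtain \<Lambda> where \<Lambda>: "y = coords \<Lambda>" "\<And>a. num_rows (\<Lambda> a) + Suc d < N" by (auto simp: states_def)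
  obtain k i where b: "b = (k, i)" "i \<in> {1..N}" using 4(2) by (auto simp: rows_upto_def)
  have N: "num_rows (\<Lambda> a) < N" for a using \<Lambda>(2)[of a] by simp
  have i: "i \<in> removable (\<Lambda> k)" using 4(3) f_coeff_not_removable[of \<Lambda> N i k, OF N b(2)] b(1) unfolding \<Lambda>(1) by blast
  have "num_rows ((\<Lambda>(k := remove_box (\<Lambda> k) i)) a) + d < N" for a
    using \<Lambda>(2)[of a] num_rows_remove_box[OF i] by auto
  then show ?case unfolding \<Lambda>(1) b(1) coords_remove_box[of i \<Lambda> k, OF i, symmetric] states_def by blast
next
  case (5 y d p)
  then obtain \<Lambda> where \<Lambda>: "y = coords \<Lambda>" "\<And>a. num_rows (\<Lambda> a) + d < N" by (auto simp: states_def)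
  show ?case unfolding \<Lambda>(1) by (rule fock_psi_action) (use \<Lambda>(2) add_lessD1 in blast)
next
  case 6
  show ?case by simp
next
  case (7 b v)
  let ?q = "\<lambda>a. (v - tail_zero N a) / (v - tail_pole N a)"
  have "(\<Prod>a\<in>{..<fst b}. ?q a) * (\<Prod>a\<in>{fst b..}. ?q a) = (\<Prod>a\<in>{..<fst b} \<union> {fst b..}. ?q a)"
    by (rule prod.union_disjoint[symmetric]) auto
  also have "{..<fst b} \<union> {fst b..} = UNIV" by auto
  finally have "(\<Prod>a\<in>{..<fst b}. ?q a) * (\<Prod>a\<in>{fst b..}. ?q a) = (\<Prod>a\<in>UNIV. ?q a)" .
  then show ?case by (simp only: raise_factor_def lower_factor_def power2_eq_square minus_divide_left[symmetric]
      times_divide_times_eq mult_minus_right)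
next
  case 8
  have "tail_pole N a = lattice_point a 0 (int N)" for a by (simp add: tail_pole_def lattice_point_def)
  then show ?case by (simp add: inj_on_def lattice_point_eq_iff)
next
  case (9 y d a)
  then obtain \<Lambda> where \<Lambda>: "y = coords \<Lambda>" "\<And>a. num_rows (\<Lambda> a) + d < N" by (auto simp: states_def)
  have N: "num_rows (\<Lambda> a) < N" using \<Lambda>(2)[of a] by simp
  then have "coords \<Lambda> (a, N) = tail_pole (N - 1) a" by (rule coords_tail)
  then have "tail_pole N a = coords \<Lambda> (a, N) + h2"
    using N by (cases N) (simp_all add: tail_pole_def algebra_simps)
  moreover have "(a, N) \<in> rows_upto N" using N by (simp add: rows_upto_def)
  ultimately show ?case unfolding \<Lambda>(1) by blast
next
  case (10 y d a b)
  then obtain \<Lambda> where \<Lambda>: "y = coords \<Lambda>" by (auto simp: states_def)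
  have "tail_pole N a = lattice_point a 0 (int N)" by (simp add: tail_pole_def lattice_point_def)
  then show ?case using 10(3) unfolding \<Lambda> coords_point lattice_point_shift lattice_point_eq_iff
    by (auto simp: rows_upto_def lattice_point_eq_iff)
next
  case 11
  show ?case by (rule sigma3_nz)
qed

text \<open>
  No defining relation involves more than three steps.
\<close>

lemma coords_in_states:
  fixes \<Lambda> :: "'r \<Rightarrow> young"
  obtains N where "\<And>d. d \<le> 3 \<Longrightarrow> coords \<Lambda> \<in> states N d"
proof
  fix d :: nat assume "d \<le> 3"
  moreover have "num_rows (\<Lambda> a) \<le> (\<Sum>a\<in>UNIV. num_rows (\<Lambda> a))" for a
    by (rule member_le_sum) auto
  \<comment> \<open>three steps, and one more row that stays empty\<close>
  ultimately have "num_rows (\<Lambda> a) + d < (\<Sum>a\<in>UNIV. num_rows (\<Lambda> a)) + 4" for a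
    by (meson add_le_less_mono order_le_less_trans less_add_same_cancel2 add_le_mono numeral_less_iff semiring_norm)
  then show "coords \<Lambda> \<in> states ((\<Sum>a\<in>UNIV. num_rows (\<Lambda> a)) + 4) d"
    unfolding states_def by blast
qed

text \<open>
  For a given basis vector the number \<open>N\<close> of rows is chosen large enough.
\<close>

theorem fock_relations:
  fixes \<Lambda> :: "'r \<Rightarrow> young"
  defines "t2 \<equiv> sigma2 h1 h2 (- h1 - h2)" and "t3 \<equiv> sigma3 h1 h2 (- h1 - h2)" and "v \<equiv> ket \<Lambda>"
  shows "op_commutator (fock_psi i) (fock_psi j) v = 0"
    "op_commutator (fock_e i) (fock_f j) v = fock_psi (i + j) v"
    "op_cubic t2 fock_e fock_e i j v = vscale t3 (fock_e i (fock_e j v) + fock_e j (fock_e i v))"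
    "op_cubic t2 fock_f fock_f i j v = vscale (- t3) (fock_f i (fock_f j v) + fock_f j (fock_f i v))"
    "op_cubic t2 fock_psi fock_e i j v = vscale t3 (fock_psi i (fock_e j v) + fock_e j (fock_psi i v))"
    "op_cubic t2 fock_psi fock_f i j v = vscale (- t3) (fock_psi i (fock_f j v) + fock_f j (fock_psi i v))"
    "op_commutator (fock_psi 0) (fock_e j) v = 0" "op_commutator (fock_psi 1) (fock_e j) v = 0"
    "op_commutator (fock_psi 2) (fock_e j) v = vscale 2 (fock_e j v)"
    "op_commutator (fock_psi 0) (fock_f j) v = 0" "op_commutator (fock_psi 1) (fock_f j) v = 0"
    "op_commutator (fock_psi 2) (fock_f j) v = vscale (- 2) (fock_f j v)"
    "op_serre fock_e p q r v = 0" "op_serre fock_f p q r v = 0"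
proof -
  obtain N where N: "\<And>d. d \<le> 3 \<Longrightarrow> coords \<Lambda> \<in> states N d"
    using coords_in_states[of \<Lambda>] by blast
  have s: "coords \<Lambda> \<in> states N (Suc 0)" "coords \<Lambda> \<in> states N 2" "coords \<Lambda> \<in> states N 3"
    by (rule N, simp)+
  interpret raising_lowering_operators h1 h2 "rows_upto N" lex_less "raise_factor N" row_ket fock_e "states N"
    "lower_factor N" UNIV "tail_zero N" "tail_pole N" fock_f fock_psi
    by (rule raising_lowering_operators_fock)
  note k = row_ket_coords[of \<Lambda>]
  show "op_commutator (fock_psi i) (fock_psi j) v = 0"
    unfolding v_def op_commutator_def fock_tensor_psi_def linear_extension_ket linear_vscale[OF linear_linear_extension]
    by (simp add: vscale_vscale mult.commute)
  show "op_commutator (fock_e i) (fock_f j) v = fock_psi (i + j) v"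
    unfolding v_def using e_f_relation[OF s(2)] by (simp only: k)
  show "op_cubic t2 fock_e fock_e i j v = vscale t3 (fock_e i (fock_e j v) + fock_e j (fock_e i v))"
    unfolding v_def t2_def t3_def using cubic_relation[OF s(2)] by (simp only: k)
  show "op_cubic t2 fock_f fock_f i j v = vscale (- t3) (fock_f i (fock_f j v) + fock_f j (fock_f i v))"
    unfolding v_def t2_def t3_def using f_cubic_relation[OF s(2)] by (simp only: k)
  show "op_cubic t2 fock_psi fock_e i j v = vscale t3 (fock_psi i (fock_e j v) + fock_e j (fock_psi i v))"
    unfolding v_def t2_def t3_def using psi_e_relation[OF s(1)] by (simp only: k)
  show "op_cubic t2 fock_psi fock_f i j v = vscale (- t3) (fock_psi i (fock_f j v) + fock_f j (fock_psi i v))"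
    unfolding v_def t2_def t3_def using psi_f_relation[OF s(1)] by (simp only: k)
  show "op_commutator (fock_psi 0) (fock_e j) v = 0" "op_commutator (fock_psi 1) (fock_e j) v = 0"
    "op_commutator (fock_psi 2) (fock_e j) v = vscale 2 (fock_e j v)"
    unfolding v_def using psi_e_initial[OF s(1)] by (simp_all only: k)
  show "op_commutator (fock_psi 0) (fock_f j) v = 0" "op_commutator (fock_psi 1) (fock_f j) v = 0"
    "op_commutator (fock_psi 2) (fock_f j) v = vscale (- 2) (fock_f j v)"
    unfolding v_def using psi_f_initial[OF s(1)] by (simp_all only: k)
  show "op_serre fock_e p q r v = 0" unfolding v_def using serre_relation[OF s(3)] by (simp only: k)
  show "op_serre fock_f p q r v = 0" unfolding v_def using f_serre_relation[OF s(3)] by (simp only: k)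
qed

end

section \<open>The base field\<close>

lemma indet_monomial_eq_iff:
  "Poly_Mapping.single v (1::nat) = Poly_Mapping.single w 1 \<longleftrightarrow> v = w"
  by (metis lookup_single_eq lookup_single_not_eq zero_neq_one)

lemma of_int_fract: "of_int m = Fract (of_int m) (1::'a::idom)"
proof -
  have n: "of_nat k = Fract (of_nat k) (1::'a)" for k
    by (induction k) (simp_all add: Zero_fract_def One_fract_def add.commute)
  show ?thesis by (cases m rule: int_diff_cases) (simp add: n)
qed

definition linear_form :: "('r::linorder indet \<Rightarrow> int) \<Rightarrow> 'r indet set \<Rightarrow> ('r indet \<Rightarrow>\<^sub>0 nat) \<Rightarrow>\<^sub>0 complex" where
  "linear_form m S = (\<Sum>v\<in>S. Poly_Mapping.single (Poly_Mapping.single v 1) (of_int (m v)))"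

text \<open>
  The numerators of such combinations are polynomials of degree 1, whose coefficients can be read off.
\<close>

lemma indeterminates_independent:
  fixes m :: "'r::linorder indet \<Rightarrow> int"
  assumes "finite S" "(\<Sum>v\<in>S. of_int (m v) * indeterminate v) = 0" "w \<in> S"
  shows "m w = 0"
proof -
  have "(\<Sum>v\<in>S. of_int (m v) * indeterminate v) = Fract (linear_form m S) 1"
    using assms(1)
  proof (induction S)
    case empty
    then show ?case by (simp add: linear_form_def Zero_fract_def)
  next
    case (insert v S)
    have "of_int (m v) * indeterminate v = Fract (Poly_Mapping.single (Poly_Mapping.single v 1) (of_int (m v))) 1"
      unfolding indeterminate_def of_int_fract by (simp add: mult_single flip: single_of_int)
    then show ?case using insert by (simp add: linear_form_def)
  qed
  then have "linear_form m S = 0" using assms(2) by (simp add: Zero_fract_def eq_fract)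
  then have "0 = lookup (linear_form m S) (Poly_Mapping.single w 1)" by simp
  also have "\<dots> = (\<Sum>v\<in>S. if v = w then of_int (m v) else 0)"
    unfolding linear_form_def lookup_sum
    by (intro sum.cong refl) (simp add: lookup_single indet_monomial_eq_iff[unfolded One_nat_def] when_def)
  also have "\<dots> = of_int (m w)" using assms by simp
  finally show ?thesis by simp
qed

lemma generic_parameters_indeterminates:
  "generic_parameters (s1 :: 'r::{finite,linorder} ratfun) s2 (\<lambda>a. - xvar a :: 'r ratfun)"
proof
  fix m n :: int
  show "m = 0 \<and> n = 0" if eq: "of_int m * s1 + of_int n * s2 = (0 :: 'r ratfun)"
  proof -
    let ?m = "\<lambda>v :: 'r indet. if v = S1 then m else n"
    have "(\<Sum>v\<in>{S1, S2}. of_int (?m v) * indeterminate v) = (0 :: 'r ratfun)" using eq by simp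
    then have "?m v = 0" if "v \<in> {S1, S2}" for v
      using indeterminates_independent[of "{S1, S2}" ?m v] that by blast
    from this[of S1] this[of S2] show ?thesis by simp
  qed
  fix a b :: 'r
  assume ab: "a \<noteq> b"
  show "- xvar a - - xvar b \<noteq> of_int m * s1 + of_int n * s2"
  proof
    assume eq: "- xvar a - - xvar b = of_int m * s1 + of_int n * s2"
    let ?m = "\<lambda>v :: 'r indet. if v = S1 then m else if v = S2 then n else if v = X a then 1 else -1"
    have "(\<Sum>v\<in>{S1, S2, X a, X b}. of_int (?m v) * indeterminate v) = (of_int m * s1 + of_int n * s2) + xvar a - xvar b"
      using ab by (simp add: algebra_simps)
    also have "\<dots> = 0" unfolding eq[symmetric] by simp
    finally have "?m (X a) = 0"
      using indeterminates_independent[of "{S1, S2, X a, X b}" ?m "X a"] by blast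
    then show False by simp
  qed
qed

interpretation indets: generic_parameters "s1 :: 'r::{finite,linorder} ratfun" s2 "\<lambda>a. - xvar a"
  by (rule generic_parameters_indeterminates)

lemma linear_fock_tensor:
  "linear_op (fock_tensor_e h1 h2 u n)"
  "linear_op (fock_tensor_f h1 h2 u n)"
  "linear_op (fock_tensor_psi h1 h2 u n)"
  unfolding fock_tensor_e_def fock_tensor_f_def fock_tensor_psi_def by (rule linear_linear_extension)+

theorem yangian_action_fock:
  "yangian_action (fock_tensor_e s1 s2 (\<lambda>a. - xvar a)) (fock_tensor_f s1 s2 (\<lambda>a. - xvar a))
     (fock_tensor_psi s1 s2 (\<lambda>a :: 'r::{finite,linorder}. - xvar a :: 'r ratfun))"
  by (intro yangian_action.intro generator_action.intro yangian_action_axioms.intro)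
    (rule linear_fock_tensor indets.fock_relations)+

section \<open>The matrix coefficients in the fixed point basis\<close>

context generic_parameters
begin

text \<open>
  The localization formulas in the coordinates of the diagrams before the box \<open>b\<close> is added. In contrast to the Fock
  coefficients, every row enters, whether it is earlier or later.
\<close>

definition loc_e :: "nat \<Rightarrow> ('r \<times> nat \<Rightarrow> 'k) \<Rightarrow> 'r \<times> nat \<Rightarrow> 'k" where
  "loc_e N y b = (\<Prod>b'\<in>rows_upto N - {b}. (y b - y b' - h2) / (y b - y b')) *
     (\<Prod>a\<in>UNIV. 1 / (tail_pole N a - y b)) / h1"

definition loc_f :: "nat \<Rightarrow> ('r \<times> nat \<Rightarrow> 'k) \<Rightarrow> 'r \<times> nat \<Rightarrow> 'k" where
  "loc_f N y b = (- 1) ^ (card (UNIV :: 'r set) - 1) *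
     ((\<Prod>b'\<in>rows_upto N - {b}. (y b - y b' + h1 + h2) / (y b - y b' + h1)) *
     (\<Prod>a\<in>UNIV. y b - tail_zero N a)) / h1"

text \<open>
  The factors of the two localization formulas pair up to the structure function of each other row, hence both
  sides are, up to the same constant, the residue of \<open>\<psi>(z)\<close> at the weight of the box.
\<close>

lemma loc_e_loc_f:
  assumes "b \<in> rows_upto N"
  shows "loc_e N y b * loc_f N y b = e_coeff N y b * f_coeff N (shift_at h1 y b) b"
proof -
  interpret raising_lowering_operators h1 h2 "rows_upto N" lex_less "raise_factor N" row_ket fock_e "states N"
    "lower_factor N" UNIV "tail_zero N" "tail_pole N" fock_f fock_psi
    by (rule raising_lowering_operators_fock)
  let ?A = "\<lambda>b'. (y b - y b' - h2) / (y b - y b')" and ?B = "\<lambda>b'. (y b - y b' + h1 + h2) / (y b - y b' + h1)"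
  let ?r = "card (UNIV :: 'r set)"
  have r: "?r = Suc (?r - 1)" by (metis Suc_pred' finite_UNIV_card_ge_0 finite)
  have bonds: "(\<Prod>b'\<in>rows_upto N - {b}. ?A b') * (\<Prod>b'\<in>rows_upto N - {b}. ?B b') =
      (\<Prod>b'\<in>rows_upto N - {b}. bond h1 h2 (y b - y b'))"
    unfolding prod.distrib[symmetric] by (simp add: bond_def)
  have "1 / (tail_pole N a - y b) * (y b - tail_zero N a) = - 1 * ((y b - tail_zero N a) / (y b - tail_pole N a))" for a
  proof -
    have "1 / (- m) * w = - 1 * (w / m)" for m w :: 'k by simp
    from this[of "y b - tail_pole N a" "y b - tail_zero N a"] show ?thesis by (simp only: minus_diff_eq)
  qed
  then have tails: "(\<Prod>a\<in>UNIV. 1 / (tail_pole N a - y b)) * (\<Prod>a\<in>UNIV. y b - tail_zero N a) = (- 1) ^ ?r * tail_value (y b)"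
    unfolding prod.distrib[symmetric] tail_value_def by (simp only: prod.distrib prod_constant)
  \<comment> \<open>the sign of the lowering formula, and one sign for the tail of each of the \<open>r\<close> diagrams\<close>
  have sgn: "(- 1) ^ (?r - 1) * (- 1) ^ ?r = (- 1 :: 'k)"
    by (subst (2) r) (simp flip: power_mult_distrib)
  have "loc_e N y b * loc_f N y b = ((- 1) ^ (?r - 1) * ((\<Prod>b'\<in>rows_upto N - {b}. ?A b') * (\<Prod>b'\<in>rows_upto N - {b}. ?B b')) *
      ((\<Prod>a\<in>UNIV. 1 / (tail_pole N a - y b)) * (\<Prod>a\<in>UNIV. y b - tail_zero N a))) / (h1 * h1)"
    unfolding loc_e_def loc_f_def times_divide_times_eq by (simp only: mult_ac)
  also have "\<dots> = ((- 1) ^ (?r - 1) * (- 1) ^ ?r) * (tail_value (y b) * (\<Prod>b'\<in>rows_upto N - {b}. bond h1 h2 (y b - y b'))) / (h1 * h1)"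
    unfolding bonds tails by (simp only: mult_ac)
  also have "\<dots> = row_coeff y b * f_coeff N (move y b) b"
    unfolding add_then_remove[OF assms] sgn by (simp add: power2_eq_square)
  finally show ?thesis .
qed

lemma loc_e_pair:
  assumes "i \<noteq> j" "i \<in> rows_upto N" "j \<in> rows_upto N"
  obtains R where "\<And>y'. (\<And>l. l \<noteq> i \<Longrightarrow> l \<noteq> j \<Longrightarrow> y' l = y l) \<Longrightarrow>
    loc_e N y' i = R (y' i) * ((y' i - y' j - h2) / (y' i - y' j))"
proof
  fix y' assume y': "\<And>l. l \<noteq> i \<Longrightarrow> l \<noteq> j \<Longrightarrow> y' l = y l"
  let ?R = "\<lambda>v. (\<Prod>l\<in>rows_upto N - {i} - {j}. (v - y l - h2) / (v - y l)) * (\<Prod>a\<in>UNIV. 1 / (tail_pole N a - v)) / h1"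
  have "(\<Prod>l\<in>rows_upto N - {i} - {j}. (y' i - y' l - h2) / (y' i - y' l)) =
      (\<Prod>l\<in>rows_upto N - {i} - {j}. (y' i - y l - h2) / (y' i - y l))"
    by (rule prod.cong) (auto simp: y')
  then have "(\<Prod>l\<in>rows_upto N - {i}. (y' i - y' l - h2) / (y' i - y' l)) = (y' i - y' j - h2) / (y' i - y' j) *
      (\<Prod>l\<in>rows_upto N - {i} - {j}. (y' i - y l - h2) / (y' i - y l))"
    using assms finite_rows_upto by (subst prod.remove[of _ j]) auto
  then show "loc_e N y' i = ?R (y' i) * ((y' i - y' j - h2) / (y' i - y' j))"
    unfolding loc_e_def by (simp only: mult_ac times_divide_eq_right times_divide_eq_left)
qed

text \<open>
  For a square in the graph of diagrams, the coefficients \<open>e_coeff\<close> along the two paths have ratio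
  \<open>bond (t - h1) : bond t\<close>, where \<open>t\<close> is the difference of the coordinates, and so have the coefficients \<open>loc_e\<close>.
\<close>

lemma diamond_ordered:
  assumes "lex_less i j" "i \<in> rows_upto N" "j \<in> rows_upto N"
  shows "e_coeff N y i * e_coeff N (shift_at h1 y i) j * (loc_e N y j * loc_e N (shift_at h1 y j) i) =
    e_coeff N y j * e_coeff N (shift_at h1 y j) i * (loc_e N y i * loc_e N (shift_at h1 y i) j)"
proof -
  interpret linearly_ordered_rows h1 h2 "rows_upto N" lex_less "raise_factor N"
    by (rule linearly_ordered_rows_lex[OF finite_rows_upto])
  have ij: "i \<noteq> j" "j \<noteq> i" using assms(1) by auto
  let ?t = "y j - y i"
  obtain R where R: "\<And>y'. (\<And>l. l \<noteq> i \<Longrightarrow> l \<noteq> j \<Longrightarrow> y' l = y l) \<Longrightarrow>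
      loc_e N y' i = R (y' i) * ((y' i - y' j - h2) / (y' i - y' j))"
    using loc_e_pair[OF ij(1) assms(2,3)] by blast
  obtain Q where Q: "\<And>y'. (\<And>l. l \<noteq> j \<Longrightarrow> l \<noteq> i \<Longrightarrow> y' l = y l) \<Longrightarrow>
      loc_e N y' j = Q (y' j) * ((y' j - y' i - h2) / (y' j - y' i))"
    using loc_e_pair[OF ij(2) assms(3,2)] by blast
  define r where "r = rest_coeff {i, j} y"
  note cp = coeff_pair[OF assms, where z = y, folded r_def]
  have diffs: "y i - y j = - ?t" "y i - (y j + h1) = - ?t - h1" "y j - (y i + h1) = ?t - h1" by simp_all
  have F: "row_coeff y i = r i (y i)" "row_coeff y j = r j (y j) * bond h1 h2 ?t"
    "row_coeff (move y i) j = r j (y j) * bond h1 h2 (?t - h1)" "row_coeff (move y j) i = r i (y i)"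
    using ij by (simp_all add: cp diffs)
  have G: "loc_e N y j = Q (y j) * ((?t - h2) / ?t)" "loc_e N (move y j) i = R (y i) * ((- ?t - h1 - h2) / (- ?t - h1))"
    "loc_e N y i = R (y i) * ((- ?t - h2) / (- ?t))" "loc_e N (move y i) j = Q (y j) * ((?t - h1 - h2) / (?t - h1))"
    using ij by (simp_all only: Q R diffs shift_at_same shift_at_other simp_thms)
  have b1: "(t - h2) / t * ((- t - h1 - h2) / (- t - h1)) = bond h1 h2 t" for t
  proof -
    have "- t - h1 - h2 = - (t + h1 + h2)" "- t - h1 = - (t + h1)" by simp_all
    then show ?thesis by (simp only: minus_divide_divide bond_def times_divide_times_eq)
  qed
  have b2: "(- t - h2) / (- t) * ((t - h1 - h2) / (t - h1)) = bond h1 h2 (t - h1)" for t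
  proof -
    have "- t - h2 = - (t + h2)" by simp
    then have "(- t - h2) / (- t) = (t + h2) / t" by (simp only: minus_divide_divide)
    then show ?thesis by (simp add: bond_def mult.commute)
  qed
  have "loc_e N y j * loc_e N (move y j) i = Q (y j) * R (y i) * bond h1 h2 ?t"
    unfolding G b1[of ?t, symmetric] by (simp only: mult_ac)
  moreover have "loc_e N y i * loc_e N (move y i) j = Q (y j) * R (y i) * bond h1 h2 (?t - h1)"
    unfolding G b2[of ?t, symmetric] by (simp only: mult_ac)
  ultimately show ?thesis unfolding F by (simp only: mult_ac)
qed

lemma diamond:
  assumes "i \<noteq> j" "i \<in> rows_upto N" "j \<in> rows_upto N"
  shows "e_coeff N y i * e_coeff N (shift_at h1 y i) j * (loc_e N y j * loc_e N (shift_at h1 y j) i) =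
    e_coeff N y j * e_coeff N (shift_at h1 y j) i * (loc_e N y i * loc_e N (shift_at h1 y i) j)"
proof -
  have "lex_less i j \<or> lex_less j i" using assms(1) by (auto simp: lex_less_def prod_eq_iff)
  then show ?thesis using diamond_ordered[of i j] diamond_ordered[of j i] assms by metis
qed

text \<open>
  The only row whose coordinate is smaller by \<open>h2\<close> would be the previous row, of the same length; then no box could
  be added.
\<close>

lemma coords_diff_nz:
  assumes "i \<in> addable (\<Lambda> a)" "b \<noteq> (a, i)"
  shows "coords \<Lambda> (a, i) - coords \<Lambda> b \<noteq> 0" 
    "snd b \<ge> 1 \<Longrightarrow> coords \<Lambda> (a, i) - coords \<Lambda> b - h2 \<noteq> 0"
proof -
  show "coords \<Lambda> (a, i) - coords \<Lambda> b \<noteq> 0"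
    using assms(2) by (auto simp: coords_point lattice_point_eq_iff prod_eq_iff)
  show "coords \<Lambda> (a, i) - coords \<Lambda> b - h2 \<noteq> 0" if "snd b \<ge> 1"
  proof
    assume "coords \<Lambda> (a, i) - coords \<Lambda> b - h2 = 0"
    then have "coords \<Lambda> (a, i) = coords \<Lambda> b + h2" by (simp add: algebra_simps)
    then have "fst b = a \<and> row (\<Lambda> a) i = row (\<Lambda> a) (snd b) \<and> i = snd b + 1"
      unfolding coords_point lattice_point_shift lattice_point_eq_iff by auto
    then show False using assms(1) that by (auto simp: addable_def)
  qed
qed

lemma loc_e_nz:
  assumes "i \<in> addable (\<Lambda> a)" "i \<in> {1..N}"
  shows "loc_e N (coords \<Lambda>) (a, i) \<noteq> 0"
proof -
  have "tail_pole N a' = lattice_point a' 0 (int N)" for a' by (simp add: tail_pole_def lattice_point_def)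
  then have t: "tail_pole N a' - coords \<Lambda> (a, i) \<noteq> 0" for a'
    using assms(2) by (auto simp: coords_point lattice_point_eq_iff)
  have "(coords \<Lambda> (a, i) - coords \<Lambda> b - h2) / (coords \<Lambda> (a, i) - coords \<Lambda> b) \<noteq> 0" if "b \<in> rows_upto N - {(a, i)}" for b
    using coords_diff_nz[of i \<Lambda> a b, OF assms(1)] that by (auto simp: rows_upto_def)
  then show ?thesis using t h_nz(1) finite_rows_upto
    unfolding loc_e_def divide_eq_0_iff mult_eq_0_iff by (auto simp: prod_zero_iff)
qed

lemma e_coeff_nz:
  assumes "i \<in> addable (\<Lambda> a)" "i \<in> {1..N}"
  shows "e_coeff N (coords \<Lambda>) (a, i) \<noteq> 0"
proof -
  let ?x = "coords \<Lambda> (a, i)"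
  have tp: "tail_pole N a' = lattice_point a' 0 (int N)" for a' by (simp add: tail_pole_def lattice_point_def)
  have tz: "tail_zero N a' = lattice_point a' (- 1) (int N - 1)" for a' 
    by (simp add: tail_zero_def lattice_point_def algebra_simps)
  have t: "?x - tail_pole N a' \<noteq> 0" "?x - tail_zero N a' \<noteq> 0" if "a' \<noteq> a" for a'
    using that by (auto simp: tp tz coords_point lattice_point_eq_iff)
  have "bond h1 h2 (?x - coords \<Lambda> b) \<noteq> 0" if "b \<in> {b\<in>rows_upto N. lex_less b (a, i)}" for b
  proof -
    have b: "b \<noteq> (a, i)" "snd b \<ge> 1" "fst b \<noteq> a \<or> snd b < i" using that by (auto simp: rows_upto_def lex_less_def)
    have "?x + h1 \<noteq> coords \<Lambda> b" "?x + h1 + h2 \<noteq> coords \<Lambda> b"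
      unfolding coords_point lattice_point_shift lattice_point_eq_iff using b(1,3) by (auto simp: prod_eq_iff)
    then have "?x - coords \<Lambda> b + h1 \<noteq> 0" "?x - coords \<Lambda> b + h1 + h2 \<noteq> 0"
      by (auto simp: algebra_simps add_eq_0_iff2)
    then show ?thesis using coords_diff_nz[of i \<Lambda> a b, OF assms(1) b(1)] b(2) by (simp add: bond_def)
  qed
  moreover have "raise_factor N (a, i) ?x \<noteq> 0"
    using t h_nz(1) by (auto simp: raise_factor_def prod_zero_iff)
  ultimately show ?thesis using finite_rows_upto unfolding e_coeff_def by (auto simp: prod_zero_iff)
qed

end

text \<open>
  The tails of the localization formulas do not depend on the row at which the products are cut off.
\<close>

lemma telescope_shift_up:
  fixes B :: "nat \<Rightarrow> 'k::field"
  assumes "n \<le> N" "\<And>k. n < k \<Longrightarrow> B (k + 1) = B k + h" "\<And>k. n < k \<Longrightarrow> B (k + 1) \<noteq> 0"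
  shows "(\<Prod>k=1..n. (B k + h) / B k) * (1 / B (n + 1)) = (\<Prod>k=1..N. (B k + h) / B k) * (1 / B (N + 1))"
  using assms(1)
proof (induction N rule: dec_induct)
  case (step m)
  have "B (Suc m + 1) = B (Suc m) + h" "B (Suc m + 1) \<noteq> 0"
    using assms(2)[of "Suc m"] assms(3)[of "Suc m"] step.hyps by auto
  then have eq: "(B (Suc m) + h) / B (Suc m) * (1 / B (Suc m + 1)) = 1 / B (m + 1)" by simp
  have split: "(\<Prod>k=1..Suc m. F k) * T = (\<Prod>k=1..m. F k) * (F (Suc m) * T)" for F :: "nat \<Rightarrow> 'k" and T
    by (simp add: mult_ac)
  have "(\<Prod>k=1..Suc m. (B k + h) / B k) * (1 / B (Suc m + 1)) = (\<Prod>k=1..m. (B k + h) / B k) * (1 / B (m + 1))"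
    unfolding split eq ..
  from trans[OF step.IH this[symmetric]] show ?case .
qed simp

lemma telescope_shift_down:
  fixes B :: "nat \<Rightarrow> 'k::field"
  assumes "n \<le> N" "\<And>k. n < k \<Longrightarrow> B (k + 1) = B k - h" "\<And>k. n < k \<Longrightarrow> B k \<noteq> 0"
  shows "(\<Prod>k=1..n. (B k + h) / B k) * (B (n + 1) + h) = (\<Prod>k=1..N. (B k + h) / B k) * (B (N + 1) + h)"
  using assms(1)
proof (induction N rule: dec_induct)
  case (step m)
  have "B (Suc m + 1) = B (Suc m) - h" "B (Suc m) \<noteq> 0"
    using assms(2)[of "Suc m"] assms(3)[of "Suc m"] step.hyps by auto
  then have eq: "(B (Suc m) + h) / B (Suc m) * (B (Suc m + 1) + h) = B (m + 1) + h" by simp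
  have split: "(\<Prod>k=1..Suc m. F k) * T = (\<Prod>k=1..m. F k) * (F (Suc m) * T)" for F :: "nat \<Rightarrow> 'k" and T
    by (simp add: mult_ac)
  have "(\<Prod>k=1..Suc m. (B k + h) / B k) * (B (Suc m + 1) + h) = (\<Prod>k=1..m. (B k + h) / B k) * (B (m + 1) + h)"
    unfolding split eq ..
  from trans[OF step.IH this[symmetric]] show ?case .
qed simp

lemma xrow_coords: "xrow \<Lambda> a k = indets.coords \<Lambda> (a, k) - s1"
  by (simp add: xrow_def indets.coords_def algebra_simps)

text \<open>
  The formula is given in terms of the diagrams after the box has been added. The shift by \<open>s1\<close> in \<open>xrow\<close> makes
  this the coordinates before the addition, except in the row \<open>(l, j)\<close> itself, whose factor is
  \<open>(s1 + s2) / s1\<close>.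
\<close>

lemma gieseker_e_coeff_eq:
  fixes M :: "'r::{finite,linorder} \<Rightarrow> young"
  assumes j: "j \<in> addable (M l)" and N: "\<And>a. num_rows (M a) < N"
  shows "gieseker_e_coeff p (M(l := add_box (M l) j)) l j =
    indets.coords M (l, j) ^ p * indets.loc_e N (indets.coords M) (l, j)"
proof -
  let ?L = "M(l := add_box (M l) j)" and ?y = "indets.coords M" and ?J = "indets.rows_upto N"
  let ?v = "?y (l, j)" and ?y' = "indets.coords (M(l := add_box (M l) j))"
  let ?B = "\<lambda>a k. ?y' (a, k) - ?v"
  have y': "?y' = shift_at s1 ?y (l, j)" by (rule indets.coords_add_box[of j M l, OF j])
  have x: "xrow ?L l j = ?v" by (simp add: xrow_coords y')
  have B: "s1 + xrow ?L a k - ?v = ?B a k" "s1 + s2 + xrow ?L a k - ?v = ?B a k + s2" for a k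
    by (simp_all add: xrow_coords)
  have nz: "(s1 + s2 :: 'r ratfun) \<noteq> 0" by (rule indets.h_nz)
  have jN: "j \<in> {1..N}" using addable_bounds[OF j] N[of l] by auto
  have rows: "num_rows (?L a) \<le> N" for a using num_rows_add_box[OF j] N[of l] N[of a] by auto
  have "(let n = max (num_rows (?L a)) j in (\<Prod>k=1..n. (?B a k + s2) / ?B a k) * (1 / ?B a (n + 1))) =
     (\<Prod>k=1..N. (?B a k + s2) / ?B a k) * (1 / ?B a (N + 1))" for a
    unfolding Let_def
  proof (rule telescope_shift_up)
    show "max (num_rows (?L a)) j \<le> N" using rows[of a] jN by simp
    fix k assume k: "max (num_rows (?L a)) j < k"
    have t: "?y' (a, k) = indets.tail_pole (k - 1) a" "?y' (a, k + 1) = indets.tail_pole k a"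
      using indets.coords_tail[of ?L a k] indets.coords_tail[of ?L a "k + 1"] k by simp_all
    have "indets.tail_pole k a = indets.tail_pole (k - 1) a + s2"
      using k by (cases k) (simp_all add: indets.tail_pole_def algebra_simps)
    then show "?B a (k + 1) = ?B a k + s2" unfolding t by simp
    show "?B a (k + 1) \<noteq> 0"
      using k by (auto simp: indets.coords_point indets.lattice_point_eq_iff)
  qed
  moreover have "?B a (N + 1) = indets.tail_pole N a - ?v" for a
    using indets.coords_tail[of ?L a "N + 1"] rows[of a] by simp
  ultimately have "gieseker_e_coeff p ?L l j = ?v ^ p / (s1 + s2) *
     ((\<Prod>a\<in>UNIV. \<Prod>k=1..N. (?B a k + s2) / ?B a k) * (\<Prod>a\<in>UNIV. 1 / (indets.tail_pole N a - ?v)))"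
    unfolding gieseker_e_coeff_def x B by (simp only: prod.distrib)
  also have "(\<Prod>a\<in>UNIV. \<Prod>k=1..N. (?B a k + s2) / ?B a k) = (\<Prod>b\<in>?J. (?y' b - ?v + s2) / (?y' b - ?v))"
    by (rule indets.prod_rows_upto[symmetric])
  also have "\<dots> = (s1 + s2) / s1 * (\<Prod>b\<in>?J - {(l, j)}. (?v - ?y b - s2) / (?v - ?y b))"
  proof -
    have "(?y' b - ?v + s2) / (?y' b - ?v) = (?v - ?y b - s2) / (?v - ?y b)" if "b \<in> ?J - {(l, j)}" for b
    proof -
      have "?y' b = ?y b" using that by (simp add: y')
      moreover have "?y b - ?v + s2 = - (?v - ?y b - s2)" "?y b - ?v = - (?v - ?y b)" by simp_all
      ultimately show ?thesis by (simp only: minus_divide_divide)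
    qed
    moreover have "(l, j) \<in> ?J" using jN by (simp add: indets.rows_upto_def)
    ultimately show ?thesis
      using indets.finite_rows_upto by (subst prod.remove[of _ "(l, j)"]) (simp_all add: y')
  qed
  also have "?v ^ p / (s1 + s2) * ((s1 + s2) / s1 * (\<Prod>b\<in>?J - {(l, j)}. (?v - ?y b - s2) / (?v - ?y b)) *
      (\<Prod>a\<in>UNIV. 1 / (indets.tail_pole N a - ?v))) = ?v ^ p * indets.loc_e N ?y (l, j)"
    using nz unfolding indets.loc_e_def by simp
  finally show ?thesis .
qed

lemma gieseker_f_coeff_eq:
  fixes M :: "'r::{finite,linorder} \<Rightarrow> young"
  assumes j: "j \<in> addable (M l)" and N: "\<And>a. num_rows (M a) < N"
  shows "gieseker_f_coeff p M l j = indets.coords M (l, j) ^ p * indets.loc_f N (indets.coords M) (l, j)"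
proof -
  let ?y = "indets.coords M" and ?J = "indets.rows_upto N"
  let ?v = "?y (l, j)"
  let ?B = "\<lambda>a k. ?v - ?y (a, k) + s1"
  have B: "s1 + xrow M l j - xrow M a k = ?B a k" "s1 + s2 + xrow M l j - xrow M a k = ?B a k + s2" for a k
    by (simp_all add: xrow_coords)
  have v: "s1 + xrow M l j = ?v" by (simp add: xrow_coords)
  have nz: "(s1 + s2 :: 'r ratfun) \<noteq> 0" by (rule indets.h_nz)
  have jN: "j \<in> {1..N}" using addable_bounds[OF j] N[of l] by auto
  have "(let n = max (num_rows (M a)) j in (\<Prod>k=1..n. (?B a k + s2) / ?B a k) * (?B a (n + 1) + s2)) =
     (\<Prod>k=1..N. (?B a k + s2) / ?B a k) * (?B a (N + 1) + s2)" for a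
    unfolding Let_def
  proof (rule telescope_shift_down)
    show "max (num_rows (M a)) j \<le> N" using N[of a] jN by simp
    fix k assume k: "max (num_rows (M a)) j < k"
    have t: "?y (a, k) = indets.tail_pole (k - 1) a" "?y (a, k + 1) = indets.tail_pole k a"
      using indets.coords_tail[of M a k] indets.coords_tail[of M a "k + 1"] k by simp_all
    have "indets.tail_pole k a = indets.tail_pole (k - 1) a + s2"
      using k by (cases k) (simp_all add: indets.tail_pole_def algebra_simps)
    then show "?B a (k + 1) = ?B a k - s2" unfolding t by simp
    have "?v + s1 \<noteq> ?y (a, k)"
      unfolding indets.coords_point indets.lattice_point_shift indets.lattice_point_eq_iff using k by auto
    then show "?B a k \<noteq> 0" by (auto simp: algebra_simps add_eq_0_iff2)
  qed
  moreover have "?B a (N + 1) + s2 = ?v - indets.tail_zero N a" for a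
    using indets.coords_tail[of M a "N + 1"] N[of a] by (simp add: indets.tail_zero_def indets.tail_pole_def)
  ultimately have "gieseker_f_coeff p M l j = (- 1) ^ (card (UNIV :: 'r set) - 1) * (?v ^ p / (s1 + s2)) *
     ((\<Prod>a\<in>UNIV. \<Prod>k=1..N. (?B a k + s2) / ?B a k) * (\<Prod>a\<in>UNIV. ?v - indets.tail_zero N a))"
    unfolding gieseker_f_coeff_def unfolding B unfolding v by (simp only: prod.distrib)
  also have "(\<Prod>a\<in>UNIV. \<Prod>k=1..N. (?B a k + s2) / ?B a k) = (\<Prod>b\<in>?J. (?v - ?y b + s1 + s2) / (?v - ?y b + s1))"
    by (rule indets.prod_rows_upto[symmetric])
  also have "\<dots> = (s1 + s2) / s1 * (\<Prod>b\<in>?J - {(l, j)}. (?v - ?y b + s1 + s2) / (?v - ?y b + s1))"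
  proof -
    have "(l, j) \<in> ?J" using jN by (simp add: indets.rows_upto_def)
    then show ?thesis using indets.finite_rows_upto by (subst prod.remove[of _ "(l, j)"]) simp_all
  qed
  also have "(- 1) ^ (card (UNIV :: 'r set) - 1) * (?v ^ p / (s1 + s2)) *
      ((s1 + s2) / s1 * (\<Prod>b\<in>?J - {(l, j)}. (?v - ?y b + s1 + s2) / (?v - ?y b + s1)) *
      (\<Prod>a\<in>UNIV. ?v - indets.tail_zero N a)) = ?v ^ p * indets.loc_f N ?y (l, j)"
    using nz unfolding indets.loc_f_def by simp
  finally show ?thesis .
qed

section \<open>Fixed points and boxes\<close>

definition add_at :: "('r \<Rightarrow> young) \<Rightarrow> 'r \<times> nat \<Rightarrow> 'r \<Rightarrow> young" where
  "add_at M b = M(fst b := add_box (M (fst b)) (snd b))"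

definition remove_at :: "('r \<Rightarrow> young) \<Rightarrow> 'r \<times> nat \<Rightarrow> 'r \<Rightarrow> young" where
  "remove_at M b = M(fst b := remove_box (M (fst b)) (snd b))"

definition addables :: "('r::finite \<Rightarrow> young) \<Rightarrow> ('r \<times> nat) set" where
  "addables M = Sigma UNIV (\<lambda>a. addable (M a))"

definition removables :: "('r::finite \<Rightarrow> young) \<Rightarrow> ('r \<times> nat) set" where
  "removables M = Sigma UNIV (\<lambda>a. removable (M a))"

definition num_boxes :: "('r::finite \<Rightarrow> young) \<Rightarrow> nat" where
  "num_boxes M = (\<Sum>a\<in>UNIV. card (boxes (M a)))"

lemma finite_addables: "finite (addables M)" "finite (removables M)"
  unfolding addables_def removables_def by (auto intro: finite_SigmaI finite_addable finite_removable)

lemma boxes_add_box: "j \<in> addable \<mu> \<Longrightarrow> boxes (add_box \<mu> j) = insert (row \<mu> j + 1, j) (boxes \<mu>)"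
  using addable_bounds[of j \<mu>] by (auto simp: boxes_def row_add_box)

lemma new_box_notin: "(row \<mu> j + 1, j) \<notin> boxes \<mu>"
  by (simp add: boxes_def)

lemma num_boxes_add_at:
  assumes "b \<in> addables M"
  shows "num_boxes (add_at M b) = Suc (num_boxes M)"
proof -
  obtain l j where b: "b = (l, j)" "j \<in> addable (M l)" using assms by (auto simp: addables_def)
  have "num_boxes (add_at M b) = card (boxes (add_box (M l) j)) + (\<Sum>a\<in>UNIV - {l}. card (boxes (M a)))"
    unfolding num_boxes_def add_at_def b by (subst sum.remove[of _ l]) (auto intro!: sum.cong)
  also have "card (boxes (add_box (M l) j)) = Suc (card (boxes (M l)))"
    unfolding boxes_add_box[OF b(2)] by (rule card_insert_disjoint[OF finite_boxes new_box_notin])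
  also have "Suc (card (boxes (M l))) + (\<Sum>a\<in>UNIV - {l}. card (boxes (M a))) = Suc (num_boxes M)"
    unfolding num_boxes_def by (subst (2) sum.remove[of _ l]) auto
  finally show ?thesis .
qed

lemma removed_box:
  assumes "b \<in> removables \<Lambda>"
  shows "b \<in> addables (remove_at \<Lambda> b)" "add_at (remove_at \<Lambda> b) b = \<Lambda>"
  using assms by (auto simp: removables_def addables_def remove_at_def add_at_def addable_remove_box add_remove_box)

lemma added_box:
  assumes "b \<in> addables M"
  shows "b \<in> removables (add_at M b)" "remove_at (add_at M b) b = M"
  using assms by (auto simp: removables_def addables_def remove_at_def add_at_def removable_add_box remove_add_box)

lemma num_boxes_remove_at: "b \<in> removables \<Lambda> \<Longrightarrow> num_boxes \<Lambda> = Suc (num_boxes (remove_at \<Lambda> b))"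
  using num_boxes_add_at[OF removed_box(1), of b \<Lambda>] removed_box(2)[of b \<Lambda>] by simp

lemma row_empty_young [simp]: "row empty_young k = 0"
  unfolding empty_young_def by (subst Abs_young_inverse) auto

lemma removables_empty:
  assumes "removables \<Lambda> = {}"
  shows "\<Lambda> = (\<lambda>_. empty_young)"
proof
  fix a
  have "num_rows (\<Lambda> a) = 0"
  proof (rule ccontr)
    let ?n = "num_rows (\<Lambda> a)"
    assume "?n \<noteq> 0"
    then have "row (\<Lambda> a) (?n + 1) = 0" "row (\<Lambda> a) ?n \<noteq> 0"
      using row_eq_0_iff[of "\<Lambda> a" "?n + 1"] row_eq_0_iff[of "\<Lambda> a" ?n] by auto
    then have "(a, ?n) \<in> removables \<Lambda>" using \<open>?n \<noteq> 0\<close> by (auto simp: removables_def removable_def)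
    then show False using assms by simp
  qed
  then show "\<Lambda> a = empty_young" by (intro young_eqI) (simp add: row_eq_0_iff)
qed

text \<open>
  Every nonempty tuple of diagrams has a removable box.
\<close>

lemma fixed_point_induct [case_names empty add]:
  fixes P :: "('r::finite \<Rightarrow> young) \<Rightarrow> bool"
  assumes "P (\<lambda>_. empty_young)" "\<And>M b. b \<in> addables M \<Longrightarrow> P M \<Longrightarrow> P (add_at M b)"
  shows "P \<Lambda>"
proof (induction "num_boxes \<Lambda>" arbitrary: \<Lambda> rule: less_induct)
  case less
  show ?case
  proof (cases "removables \<Lambda> = {}")
    case True
    then show ?thesis using assms(1) by (simp only: removables_empty[OF True])
  next
    case False
    then obtain b where b: "b \<in> removables \<Lambda>" by blast
    have "P (remove_at \<Lambda> b)" using num_boxes_remove_at[OF b] by (intro less) simp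
    then show ?thesis using assms(2)[OF removed_box(1)[OF b]] removed_box(2)[OF b] by metis
  qed
qed

text \<open>
  A row has a removable box if it is longer than the next one, and this remains true when the next one is shortened.
\<close>

lemma remove_two:
  assumes "b \<in> removables \<Lambda>" "b' \<in> removables \<Lambda>" "b \<noteq> b'"
  shows "b' \<in> removables (remove_at \<Lambda> b)" "remove_at (remove_at \<Lambda> b) b' = remove_at (remove_at \<Lambda> b') b"
proof -
  obtain l j l' j' where b: "b = (l, j)" "b' = (l', j')" by (cases b, cases b') auto
  have r: "j \<in> removable (\<Lambda> l)" "j' \<in> removable (\<Lambda> l')" using assms(1,2) by (auto simp: b removables_def)
  have rm: "i' \<in> removable (remove_box \<mu> i)" if "i \<in> removable \<mu>" "i' \<in> removable \<mu>" "i \<noteq> i'" for \<mu> i i'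
    using that by (auto simp: removable_def row_remove_box[OF that(1)])
  show "b' \<in> removables (remove_at \<Lambda> b)"
    using r assms(3) rm by (auto simp: b removables_def remove_at_def)
  have "remove_box (remove_box \<mu> i) i' = remove_box (remove_box \<mu> i') i"
    if "i \<in> removable \<mu>" "i' \<in> removable \<mu>" "i \<noteq> i'" for \<mu> i i'
    using that by (intro young_eqI) (simp add: row_remove_box rm)
  then show "remove_at (remove_at \<Lambda> b) b' = remove_at (remove_at \<Lambda> b') b"
    using r assms(3) by (auto simp: b remove_at_def fun_eq_iff)
qed

lemma coords_add_at: "b \<in> addables M \<Longrightarrow> indets.coords (add_at M b) = shift_at s1 (indets.coords M) b"
  using indets.coords_add_box[of "snd b" M "fst b"] by (auto simp: add_at_def addables_def)

lemma add_at_inj: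
  fixes M :: "'r::{finite,linorder} \<Rightarrow> young"
  assumes "b \<in> addables M" "b' \<in> addables M" "add_at M b = add_at M b'"
  shows "b = b'"
proof (rule ccontr)
  assume ne: "b \<noteq> b'"
  have "shift_at s1 (indets.coords M) b = shift_at s1 (indets.coords M) b'"
    using assms by (metis coords_add_at)
  then have "shift_at s1 (indets.coords M) b b = shift_at s1 (indets.coords M) b' b" by simp
  moreover have "(s1 :: 'r ratfun) \<noteq> 0" by (rule indets.h_nz)
  ultimately show False using ne by simp
qed

section \<open>The eigenvalues of \<open>\<psi>\<close> agree\<close>

definition fock_series :: "('r::{finite,linorder} \<Rightarrow> young) \<Rightarrow> 'r ratfun fps" where
  "fock_series \<Lambda> = (\<Prod>k\<in>UNIV. expand_inf (gamma_num s1 s2 (\<Lambda> k) (- xvar k)) (gamma_den s1 s2 (\<Lambda> k) (- xvar k)))"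

lemma fock_series_eq:
  fixes \<Lambda> :: "'r::{finite,linorder} \<Rightarrow> young"
  assumes "\<And>a. num_rows (\<Lambda> a) < N"
  shows "fock_series \<Lambda> = indets.psi_coeff N (indets.coords \<Lambda>)"
proof -
  have "fock_series \<Lambda> = (\<Prod>a\<in>UNIV. (\<Prod>i=1..N. lin_fps (indets.coords \<Lambda> (a, i) + s2) * lin_fps (indets.coords \<Lambda> (a, i) - s1 - s2) *
       (delta_plus (indets.coords \<Lambda> (a, i)) * delta_plus (indets.coords \<Lambda> (a, i) - s1))) *
    (lin_fps (indets.tail_zero N a) * delta_plus (indets.tail_pole N a)))"
    unfolding fock_series_def using assms by (intro prod.cong refl indets.expand_gamma less_imp_le)
  then show ?thesis unfolding rows_psi_series_def indets.prod_rows_upto by (simp only: prod.distrib)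
qed

lemma rows_bound:
  fixes M :: "'r::finite \<Rightarrow> young"
  obtains N where "\<And>a. num_rows (M a) + 3 < N"
proof
  fix a
  have "num_rows (M a) \<le> (\<Sum>a\<in>UNIV. num_rows (M a))" by (rule member_le_sum) auto
  then show "num_rows (M a) + 3 < (\<Sum>a\<in>UNIV. num_rows (M a)) + 4" by simp
qed

lemma num_rows_add_at:
  assumes "b \<in> addables M"
  shows "num_rows (add_at M b a) \<le> num_rows (M a) + 1"
proof (cases "a = fst b")
  case True
  then show ?thesis
    using assms num_rows_add_box[of "snd b" "M (fst b)"] by (auto simp: add_at_def addables_def)
qed (simp add: add_at_def)

text \<open>
  Adding a box multiplies \<open>\<psi>(z)\<close> by \<open>\<Prod>\<^sub>k (z - \<chi> + s\<^sub>k) / (z - \<chi> - s\<^sub>k)\<close>.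
\<close>

lemma fock_series_add_at:
  fixes M :: "'r::{finite,linorder} \<Rightarrow> young"
  assumes b: "b \<in> addables M"
  defines "\<chi> \<equiv> indets.coords M b"
  shows "fock_series (add_at M b) * (lin_fps (\<chi> + s1) * lin_fps (\<chi> + s2) * lin_fps (\<chi> - s1 - s2)) =
    fock_series M * (lin_fps (\<chi> - s1) * lin_fps (\<chi> - s2) * lin_fps (\<chi> + s1 + s2))"
proof -
  obtain N where N: "\<And>a. num_rows (M a) + 3 < N" by (rule rows_bound[of M]) blast
  have N0: "num_rows (M a) < N" "num_rows (add_at M b a) < N" for a
    using N[of a] num_rows_add_at[OF b, of a] by auto
  have "snd b \<in> addable (M (fst b))" using b by (auto simp: addables_def)
  then have "snd b \<in> {1..N}" using addable_bounds[of "snd b" "M (fst b)"] N[of "fst b"] by auto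
  then have bJ: "b \<in> indets.rows_upto N" by (cases b) (simp add: indets.rows_upto_def)
  show ?thesis
    unfolding fock_series_eq[of M, OF N0(1)] fock_series_eq[of "add_at M b", OF N0(2)] coords_add_at[OF b] \<chi>_def
    by (rule raising_lowering_operators.psi_series_move[OF indets.raising_lowering_operators_fock bJ])
qed

lemma inf_fps_shifted: "inf_fps [:- \<chi> + s, 1:] = lin_fps (\<chi> - s)" "inf_fps [:- \<chi> - s, 1:] = lin_fps (\<chi> + s)"
  using inf_fps_lin[of "\<chi> - s"] inf_fps_lin[of "\<chi> + s"] by (simp_all add: algebra_simps)

lemma boxes_prod_add_at:
  fixes G :: "'r::finite \<Rightarrow> nat \<times> nat \<Rightarrow> 'a::comm_monoid_mult"
  assumes "b \<in> addables M"
  shows "(\<Prod>a\<in>UNIV. \<Prod>x\<in>boxes (add_at M b a). G a x) =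
    (\<Prod>a\<in>UNIV. \<Prod>x\<in>boxes (M a). G a x) * G (fst b) (row (M (fst b)) (snd b) + 1, snd b)"
proof -
  obtain l j where b: "b = (l, j)" "j \<in> addable (M l)" using assms by (auto simp: addables_def)
  have "(\<Prod>a\<in>UNIV. \<Prod>x\<in>boxes (add_at M b a). G a x) =
    (\<Prod>x\<in>boxes (add_box (M l) j). G l x) * (\<Prod>a\<in>UNIV - {l}. \<Prod>x\<in>boxes (M a). G a x)"
    by (subst prod.remove[of _ l]) (auto simp: b add_at_def intro!: prod.cong)
  also have "(\<Prod>x\<in>boxes (add_box (M l) j). G l x) = G l (row (M l) j + 1, j) * (\<Prod>x\<in>boxes (M l). G l x)"
    unfolding boxes_add_box[OF b(2)] by (rule prod.insert[OF finite_boxes new_box_notin])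
  also have "G l (row (M l) j + 1, j) * (\<Prod>x\<in>boxes (M l). G l x) * (\<Prod>a\<in>UNIV - {l}. \<Prod>x\<in>boxes (M a). G a x) =
     (\<Prod>a\<in>UNIV. \<Prod>x\<in>boxes (M a). G a x) * G l (row (M l) j + 1, j)"
    by (subst (2) prod.remove[of _ l]) (auto simp: mult_ac)
  finally show ?thesis by (simp add: b)
qed

lemma gieseker_psi_poly_add_at:
  assumes "b \<in> addables M"
  defines "\<chi> \<equiv> indets.coords M b"
  shows "gieseker_psi_num (add_at M b) = gieseker_psi_num M * ([:- \<chi> + s1, 1:] * [:- \<chi> + s2, 1:] * [:- \<chi> + s3, 1:])"
    "gieseker_psi_den (add_at M b) = gieseker_psi_den M * ([:- \<chi> - s1, 1:] * [:- \<chi> - s2, 1:] * [:- \<chi> - s3, 1:])"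
proof -
  have w: "box_weight (fst b) (row (M (fst b)) (snd b) + 1, snd b) = \<chi>"
    by (simp add: box_weight_def \<chi>_def indets.coords_def)
  have l: "(\<Prod>s\<leftarrow>[s1, s2, s3]. f s) = f s1 * f s2 * f s3" for f :: "_ \<Rightarrow> _ poly"
    by (simp only: list.map prod_list.Cons prod_list.Nil mult_1_right mult.assoc)
  show "gieseker_psi_num (add_at M b) = gieseker_psi_num M * ([:- \<chi> + s1, 1:] * [:- \<chi> + s2, 1:] * [:- \<chi> + s3, 1:])"
    "gieseker_psi_den (add_at M b) = gieseker_psi_den M * ([:- \<chi> - s1, 1:] * [:- \<chi> - s2, 1:] * [:- \<chi> - s3, 1:])"
    unfolding gieseker_psi_num_def gieseker_psi_den_def boxes_prod_add_at[OF assms(1)] w l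
    by (simp_all only: mult.assoc)
qed

lemma degree_three_linear:
  fixes p :: "'k::field poly"
  assumes "p \<noteq> 0"
  shows "p * ([:u, 1:] * [:v, 1:] * [:w, 1:]) \<noteq> 0" "degree (p * ([:u, 1:] * [:v, 1:] * [:w, 1:])) = degree p + 3"
proof -
  have "[:u, 1:] * [:v, 1:] * [:w, 1:] \<noteq> 0" "degree ([:u, 1:] * [:v, 1:] * [:w, 1:]) = 3"
    by (simp_all add: degree_mult_eq del: mult_pCons_left mult_pCons_right)
  then show "p * ([:u, 1:] * [:v, 1:] * [:w, 1:]) \<noteq> 0" "degree (p * ([:u, 1:] * [:v, 1:] * [:w, 1:])) = degree p + 3"
    using assms by (simp_all only: degree_mult_eq mult_eq_0_iff simp_thms not_False_eq_True)
qed

text \<open>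
  Both eigenvalues are \<open>\<Prod>\<^sub>a (z + x\<^sub>a - s\<^sub>3) / (z + x\<^sub>a)\<close> for empty diagrams, and change by the same factor when a box is
  added. The statements about degrees are needed to divide the expansions.
\<close>

lemma gieseker_psi_poly:
  fixes \<Lambda> :: "'r::{finite,linorder} \<Rightarrow> young"
  shows "gieseker_psi_num \<Lambda> \<noteq> 0 \<and> gieseker_psi_den \<Lambda> \<noteq> 0 \<and> degree (gieseker_psi_num \<Lambda>) = degree (gieseker_psi_den \<Lambda>) \<and>
    fock_series \<Lambda> * inf_fps (gieseker_psi_den \<Lambda>) = inf_fps (gieseker_psi_num \<Lambda>)"
proof (induction \<Lambda> rule: fixed_point_induct)
  case empty
  let ?E = "\<lambda>_ :: 'r. empty_young"
  have boxes: "boxes empty_young = {}" by (auto simp: boxes_def)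
  have num: "gieseker_psi_num ?E = (\<Prod>a\<in>UNIV. lin_poly (indets.tail_zero 0 a))"
    unfolding gieseker_psi_num_def boxes by (simp add: indets.tail_zero_def algebra_simps)
  have den: "gieseker_psi_den ?E = (\<Prod>a\<in>UNIV. lin_poly (indets.tail_pole 0 a))"
    unfolding gieseker_psi_den_def boxes by (simp add: indets.tail_pole_def)
  have rows: "num_rows empty_young = 0" by (simp add: num_rows_def)
  have "fock_series ?E = (\<Prod>a\<in>UNIV. lin_fps (indets.tail_zero 0 a) * delta_plus (indets.tail_pole 0 a))"
    unfolding fock_series_def using indets.expand_gamma[of ?E _ 0] by (simp add: rows)
  then have "fock_series ?E * inf_fps (gieseker_psi_den ?E) = (\<Prod>a\<in>UNIV. lin_fps (indets.tail_zero 0 a) *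
      (lin_fps (indets.tail_pole 0 a) * delta_plus (indets.tail_pole 0 a)))"
    unfolding den inf_fps_prod inf_fps_lin by (simp only: prod.distrib mult_ac)
  also have "\<dots> = inf_fps (gieseker_psi_num ?E)"
    unfolding lin_delta_plus num inf_fps_prod inf_fps_lin by simp
  finally have "fock_series ?E * inf_fps (gieseker_psi_den ?E) = inf_fps (gieseker_psi_num ?E)" .
  moreover have "gieseker_psi_num ?E \<noteq> 0" "gieseker_psi_den ?E \<noteq> 0" unfolding num den by (rule prod_lin_poly)+
  moreover have "degree (gieseker_psi_num ?E) = degree (gieseker_psi_den ?E)" unfolding num den prod_lin_poly ..
  ultimately show ?case by blast
next
  case (add M b)
  let ?c = "indets.coords M b"
  note p = gieseker_psi_poly_add_at[OF add.hyps]
  have "fock_series (add_at M b) * inf_fps (gieseker_psi_den (add_at M b)) =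
     inf_fps (gieseker_psi_den M) * (fock_series (add_at M b) * (lin_fps (?c + s1) * lin_fps (?c + s2) * lin_fps (?c - s1 - s2)))"
    unfolding p inf_fps_mult inf_fps_shifted by (simp add: mult_ac add_diff_eq)
  also have "\<dots> = (fock_series M * inf_fps (gieseker_psi_den M)) * (lin_fps (?c - s1) * lin_fps (?c - s2) * lin_fps (?c + s1 + s2))"
    unfolding fock_series_add_at[OF add.hyps] by (simp only: mult_ac)
  also have "\<dots> = inf_fps (gieseker_psi_num (add_at M b))"
  proof -
    have "?c - s3 = ?c + s1 + s2" by simp
    then show ?thesis using add.IH unfolding p inf_fps_mult inf_fps_shifted by (simp only:)
  qed
  finally show ?case using add.IH degree_three_linear unfolding p by metis
qed

lemma expand_gieseker_psi: "expand_inf (gieseker_psi_num \<Lambda>) (gieseker_psi_den \<Lambda>) = fock_series \<Lambda>"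
  using gieseker_psi_poly[of \<Lambda>] by (intro expand_inf_eqI) auto

lemma gieseker_psi_eq_fock_psi: "gieseker_psi p = fock_tensor_psi s1 s2 (\<lambda>a. - xvar a) p"
  unfolding gieseker_psi_def fock_tensor_psi_def expand_gieseker_psi fock_series_def ..

section \<open>The matrix coefficients in the two bases\<close>

text \<open>
  The coefficient of \<open>ket (add_at M b)\<close> in \<open>e\<^sub>0 (ket M)\<close>; that in \<open>e\<^sub>p (ket M)\<close> is larger by the \<open>p\<close>-th power of the
  weight of the box, in both bases.
\<close>

definition gieseker_amplitude :: "('r::{finite,linorder} \<Rightarrow> young) \<Rightarrow> 'r \<times> nat \<Rightarrow> 'r ratfun" where
  "gieseker_amplitude M b = gieseker_e_coeff 0 (add_at M b) (fst b) (snd b)"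

definition fock_amplitude :: "('r::{finite,linorder} \<Rightarrow> young) \<Rightarrow> 'r \<times> nat \<Rightarrow> 'r ratfun" where
  "fock_amplitude M b = mode
     (fps_const (\<Prod>l\<in>{..<fst b}. gamma s1 s2 (M l) (- xvar l) (fock_e_point s1 s2 (- xvar (fst b)) (M (fst b)) (snd b))) *
      fock_e_series s1 s2 (- xvar (fst b)) (M (fst b)) (snd b)) 0"

context
  fixes M :: "'r::{finite,linorder} \<Rightarrow> young" and b N
  assumes b: "b \<in> addables M" and N: "\<And>a. num_rows (M a) < N"
begin

lemma addable_row: "snd b \<in> addable (M (fst b))" "snd b \<in> {1..N}" "b \<in> indets.rows_upto N"
proof -
  show 1: "snd b \<in> addable (M (fst b))" using b by (auto simp: addables_def)
  show 2: "snd b \<in> {1..N}" using addable_bounds[OF 1] N[of "fst b"] by auto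
  show "b \<in> indets.rows_upto N" using 2 by (cases b) (simp add: indets.rows_upto_def)
qed

lemma gieseker_amplitude_eq: "gieseker_amplitude M b = indets.loc_e N (indets.coords M) b"
  using gieseker_e_coeff_eq[of "snd b" M "fst b" N 0, OF addable_row(1) N] by (simp add: gieseker_amplitude_def add_at_def)

lemma fock_amplitude_eq: "fock_amplitude M b = indets.e_coeff N (indets.coords M) b"
  using indets.fock_e_coeff[of M N "snd b" "fst b" 0, OF N addable_row(2)] by (simp add: fock_amplitude_def)

lemma gieseker_e_coeff_amplitude:
  "gieseker_e_coeff p (add_at M b) (fst b) (snd b) = indets.coords M b ^ p * gieseker_amplitude M b"
  using gieseker_e_coeff_eq[of "snd b" M "fst b" N p, OF addable_row(1) N] by (simp add: gieseker_amplitude_eq add_at_def)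

lemma fock_e_amplitude:
  "mode (fps_const (\<Prod>l\<in>{..<fst b}. gamma s1 s2 (M l) (- xvar l) (fock_e_point s1 s2 (- xvar (fst b)) (M (fst b)) (snd b))) *
      fock_e_series s1 s2 (- xvar (fst b)) (M (fst b)) (snd b)) p = indets.coords M b ^ p * fock_amplitude M b"
  using indets.fock_e_coeff[of M N "snd b" "fst b" p, OF N addable_row(2)] by (simp add: fock_amplitude_eq)

lemma amplitude_nz: "gieseker_amplitude M b \<noteq> 0" "fock_amplitude M b \<noteq> 0"
  using indets.loc_e_nz[of "snd b" M "fst b" N, OF addable_row(1,2)] indets.e_coeff_nz[of "snd b" M "fst b" N, OF addable_row(1,2)]
  by (simp_all add: gieseker_amplitude_eq fock_amplitude_eq)

end

definition amplitude_ratio :: "('r::{finite,linorder} \<Rightarrow> young) \<Rightarrow> 'r \<times> nat \<Rightarrow> 'r ratfun" where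
  "amplitude_ratio M b = fock_amplitude M b / gieseker_amplitude M b"

lemma amplitudes_nz:
  assumes "b \<in> addables M"
  shows "gieseker_amplitude M b \<noteq> 0" "fock_amplitude M b \<noteq> 0"
proof -
  obtain N where N: "\<And>a. num_rows (M a) + 3 < N" using rows_bound[of M] by blast
  have "num_rows (M a) < N" for a using N[of a] by simp
  from amplitude_nz[OF assms this] show "gieseker_amplitude M b \<noteq> 0" "fock_amplitude M b \<noteq> 0" .
qed

lemma amplitude_ratio_nz: "b \<in> addables M \<Longrightarrow> amplitude_ratio M b \<noteq> 0"
  by (simp add: amplitude_ratio_def amplitudes_nz)

text \<open>
  The ratios of the amplitudes are a cocycle on the graph of diagrams, hence a coboundary.
\<close>

lemma amplitude_ratio_diamond:
  assumes b: "b \<in> addables M" and b': "b' \<in> addables M" and ne: "b \<noteq> b'"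
    and bb: "b' \<in> addables (add_at M b)" "b \<in> addables (add_at M b')"
  shows "amplitude_ratio M b * amplitude_ratio (add_at M b) b' = amplitude_ratio M b' * amplitude_ratio (add_at M b') b"
proof -
  obtain N where N: "\<And>a. num_rows (M a) + 3 < N" using rows_bound[of M] by blast
  have N0: "num_rows (M a) < N" "num_rows (add_at M b a) < N" "num_rows (add_at M b' a) < N" for a
    using N[of a] num_rows_add_at[OF b, of a] num_rows_add_at[OF b', of a] by auto
  note amp = fock_amplitude_eq[OF b N0(1)] fock_amplitude_eq[OF b' N0(1)]
    fock_amplitude_eq[OF bb(1) N0(2)] fock_amplitude_eq[OF bb(2) N0(3)]
    gieseker_amplitude_eq[OF b N0(1)] gieseker_amplitude_eq[OF b' N0(1)]
    gieseker_amplitude_eq[OF bb(1) N0(2)] gieseker_amplitude_eq[OF bb(2) N0(3)]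
  have key: "fock_amplitude M b * fock_amplitude (add_at M b) b' * (gieseker_amplitude M b' * gieseker_amplitude (add_at M b') b) =
    fock_amplitude M b' * fock_amplitude (add_at M b') b * (gieseker_amplitude M b * gieseker_amplitude (add_at M b) b')"
    unfolding amp coords_add_at[OF b] coords_add_at[OF b']
    by (rule indets.diamond[OF ne addable_row(3)[OF b N0(1)] addable_row(3)[OF b' N0(1)]])
  have nz: "gieseker_amplitude M b * gieseker_amplitude (add_at M b) b' \<noteq> 0"
    "gieseker_amplitude M b' * gieseker_amplitude (add_at M b') b \<noteq> 0"
    using amplitudes_nz(1)[OF b] amplitudes_nz(1)[OF b'] amplitudes_nz(1)[OF bb(1)] amplitudes_nz(1)[OF bb(2)] by simp_all
  show ?thesis
    unfolding amplitude_ratio_def times_divide_times_eq frac_eq_eq[OF nz] by (rule key)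
qed

definition fock_f_amplitude :: "nat \<Rightarrow> ('r::{finite,linorder} \<Rightarrow> young) \<Rightarrow> 'r \<times> nat \<Rightarrow> 'r ratfun" where
  "fock_f_amplitude p \<Lambda> b = mode
     (fps_const (\<Prod>l\<in>{fst b<..}. gamma s1 s2 (\<Lambda> l) (- xvar l) (fock_f_point s1 s2 (- xvar (fst b)) (\<Lambda> (fst b)) (snd b))) *
      fock_f_series s1 s2 (- xvar (fst b)) (\<Lambda> (fst b)) (snd b)) p"

text \<open>
  The matrix coefficients of \<open>e\<^sub>0\<close> along an edge and of \<open>f\<^sub>p\<close> back have the same product in both bases, so a rescaling
  that matches \<open>e\<close> also matches \<open>f\<close>.
\<close>

lemma amplitude_products:
  assumes b: "b \<in> addables M"
  shows "gieseker_amplitude M b * gieseker_f_coeff p M (fst b) (snd b) =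
    fock_amplitude M b * fock_f_amplitude p (add_at M b) b"
proof -
  obtain N where N: "\<And>a. num_rows (M a) + 3 < N" using rows_bound[of M] by blast
  have N0: "num_rows (M a) < N" "num_rows (add_at M b a) < N" for a
    using N[of a] num_rows_add_at[OF b, of a] by auto
  let ?y = "indets.coords M"
  have g: "gieseker_f_coeff p M (fst b) (snd b) = ?y b ^ p * indets.loc_f N ?y b"
    using gieseker_f_coeff_eq[of "snd b" M "fst b" N p, OF addable_row(1)[OF b N0(1)] N0(1)] by simp
  have f: "fock_f_amplitude p (add_at M b) b = ?y b ^ p * indets.f_coeff N (shift_at s1 ?y b) b"
    using indets.fock_f_coeff[of "add_at M b" N "snd b" "fst b" p, OF N0(2) addable_row(2)[OF b N0(1)]]
    by (simp add: fock_f_amplitude_def coords_add_at[OF b])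
  have eq: "gieseker_amplitude M b * indets.loc_f N ?y b = fock_amplitude M b * indets.f_coeff N (shift_at s1 ?y b) b"
    unfolding gieseker_amplitude_eq[OF b N0(1)] fock_amplitude_eq[OF b N0(1)]
    by (rule indets.loc_e_loc_f[OF addable_row(3)[OF b N0(1)]])
  show ?thesis unfolding g f mult.left_commute[of _ "?y b ^ p"] eq ..
qed

section \<open>The rescaling constants\<close>

text \<open>
  The product of the amplitude ratios along some path from the empty diagrams, chosen step by step from the end. The
  first argument is the number of boxes.
\<close>

primrec rescaling_by_size :: "nat \<Rightarrow> ('r::{finite,linorder} \<Rightarrow> young) \<Rightarrow> 'r ratfun" where
  "rescaling_by_size 0 \<Lambda> = 1"
| "rescaling_by_size (Suc n) \<Lambda> = (let b = (SOME b. b \<in> removables \<Lambda>) in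
     amplitude_ratio (remove_at \<Lambda> b) b * rescaling_by_size n (remove_at \<Lambda> b))"

definition rescaling :: "('r::{finite,linorder} \<Rightarrow> young) \<Rightarrow> 'r ratfun" where
  "rescaling \<Lambda> = rescaling_by_size (num_boxes \<Lambda>) \<Lambda>"

text \<open>
  The choice of the path does not matter: two different last steps are compared through the diagrams with both
  boxes removed, by the cocycle property.
\<close>

lemma rescaling_by_size_remove:
  "num_boxes \<Lambda> = Suc n \<Longrightarrow> b \<in> removables \<Lambda> \<Longrightarrow>
   rescaling_by_size (Suc n) \<Lambda> = amplitude_ratio (remove_at \<Lambda> b) b * rescaling_by_size n (remove_at \<Lambda> b)"
proof (induction n arbitrary: \<Lambda> b)
  case 0
  define b0 where "b0 = (SOME b. b \<in> removables \<Lambda>)"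
  have b0: "b0 \<in> removables \<Lambda>" unfolding b0_def using 0(2) by (rule someI)
  have "b = b0"
  proof (rule ccontr)
    assume "b \<noteq> b0"
    then have "b \<in> removables (remove_at \<Lambda> b0)" using remove_two(1)[OF b0 0(2)] by simp
    then show False using num_boxes_remove_at[OF b0] num_boxes_remove_at[of b "remove_at \<Lambda> b0"] 0(1) by simp
  qed
  then show ?case unfolding rescaling_by_size.simps Let_def b0_def[symmetric] by simp
next
  case (Suc n)
  define b0 where "b0 = (SOME b. b \<in> removables \<Lambda>)"
  have b0: "b0 \<in> removables \<Lambda>" unfolding b0_def using Suc.prems(2) by (rule someI)
  note b = Suc.prems(2)
  have start: "rescaling_by_size (Suc (Suc n)) \<Lambda> = amplitude_ratio (remove_at \<Lambda> b0) b0 * rescaling_by_size (Suc n) (remove_at \<Lambda> b0)"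
    unfolding rescaling_by_size.simps(2)[of "Suc n" \<Lambda>] Let_def b0_def[symmetric] ..
  show ?case
  proof (cases "b = b0")
    case True
    then show ?thesis using start by simp
  next
    case False
    \<comment> \<open>the bottom of the square with top \<open>\<Lambda>\<close>\<close>
    let ?M = "remove_at (remove_at \<Lambda> b0) b"
    have M': "?M = remove_at (remove_at \<Lambda> b) b0" by (rule remove_two(2)[OF b0 b]) (use False in simp)
    have r: "b \<in> removables (remove_at \<Lambda> b0)" "b0 \<in> removables (remove_at \<Lambda> b)"
      using remove_two(1)[OF b0 b] remove_two(1)[OF b b0] False by simp_all
    have ads: "b \<in> addables ?M" "b0 \<in> addables ?M" "add_at ?M b = remove_at \<Lambda> b0" "add_at ?M b0 = remove_at \<Lambda> b"
      using removed_box[OF r(1)] removed_box[OF r(2)] unfolding M'[symmetric] by simp_all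
    have sizes: "num_boxes (remove_at \<Lambda> b0) = Suc n" "num_boxes (remove_at \<Lambda> b) = Suc n"
      using num_boxes_remove_at[OF b] num_boxes_remove_at[OF b0] Suc.prems(1) by simp_all
    have "rescaling_by_size (Suc (Suc n)) \<Lambda> =
       amplitude_ratio (add_at ?M b) b0 * (amplitude_ratio ?M b * rescaling_by_size n ?M)"
      unfolding start Suc.IH[OF sizes(1) r(1)] ads ..
    also have "\<dots> = (amplitude_ratio ?M b * amplitude_ratio (add_at ?M b) b0) * rescaling_by_size n ?M"
      by (simp only: mult_ac)
    also have "\<dots> = (amplitude_ratio ?M b0 * amplitude_ratio (add_at ?M b0) b) * rescaling_by_size n ?M"
      by (subst amplitude_ratio_diamond[OF ads(1,2) False])
        (use removed_box(1)[OF b] removed_box(1)[OF b0] ads in simp_all)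
    also have "\<dots> = amplitude_ratio (remove_at \<Lambda> b) b * rescaling_by_size (Suc n) (remove_at \<Lambda> b)"
      unfolding Suc.IH[OF sizes(2) r(2)] ads M'[symmetric] by (simp only: mult_ac)
    finally show ?thesis .
  qed
qed

lemma rescaling_add_at:
  assumes "b \<in> addables M"
  shows "rescaling (add_at M b) = amplitude_ratio M b * rescaling M"
  using rescaling_by_size_remove[OF num_boxes_add_at[OF assms] added_box(1)[OF assms]]
  unfolding rescaling_def num_boxes_add_at[OF assms] added_box(2)[OF assms] .

lemma rescaling_empty: "rescaling (\<lambda>_. empty_young) = 1"
proof -
  have "boxes empty_young = {}" by (auto simp: boxes_def)
  then show ?thesis by (simp add: rescaling_def num_boxes_def)
qed

lemma rescaling_nz: "rescaling \<Lambda> \<noteq> 0"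
  by (induction \<Lambda> rule: fixed_point_induct)
    (simp_all add: rescaling_empty rescaling_add_at amplitude_ratio_nz)

section \<open>The isomorphism\<close>

lemma linear_eq_on_kets:
  assumes "linear_op A" "linear_op B" "\<And>b. A (ket b) = B (ket b)"
  shows "A v = B v"
proof -
  interpret A: Vector_Spaces.linear vscale vscale A by (rule assms)
  interpret B: Vector_Spaces.linear vscale vscale B by (rule assms)
  have "linear_op (\<lambda>v. A v - B v)"
    by unfold_locales (auto intro!: poly_mapping_eqI simp: A.add B.add A.scale B.scale lookup_minus lookup_add algebra_simps)
  then have "A v - B v = 0" by (rule linear_zero_on_kets) (simp add: assms(3))
  then show ?thesis by simp
qed

lemma linear_comp:
  assumes "linear_op A" "linear_op B"
  shows "linear_op (\<lambda>v. A (B v))"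
  using assms by (simp add: Vector_Spaces.linear_iff)

lemma linear_rescaling_map: "linear_op (rescaling_map c)"
  unfolding rescaling_map_def by (rule linear_linear_extension)

lemma rescaling_map_ket: "rescaling_map c (ket \<Lambda>) = vscale (c \<Lambda>) (ket \<Lambda>)"
  by (simp add: rescaling_map_def linear_extension_ket)

lemma rescaling_map_inverse:
  assumes "\<And>\<Lambda>. c \<Lambda> \<noteq> 0"
  shows "rescaling_map c (rescaling_map (\<lambda>\<Lambda>. 1 / c \<Lambda>) v) = v" "rescaling_map (\<lambda>\<Lambda>. 1 / c \<Lambda>) (rescaling_map c v) = v"
proof -
  have id: "linear_op (\<lambda>v. v)"
    by (simp add: Vector_Spaces.linear_iff vector_space_vscale)
  show "rescaling_map c (rescaling_map (\<lambda>\<Lambda>. 1 / c \<Lambda>) v) = v" "rescaling_map (\<lambda>\<Lambda>. 1 / c \<Lambda>) (rescaling_map c v) = v"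
    by (rule linear_eq_on_kets[OF linear_comp[OF linear_rescaling_map linear_rescaling_map] id],
        simp add: rescaling_map_ket linear_vscale[OF linear_rescaling_map] vscale_vscale assms)+
qed

lemma linear_gieseker:
  "linear_op (gieseker_e p)"
  "linear_op (gieseker_f p)"
  "linear_op (gieseker_psi p)"
  unfolding gieseker_e_def gieseker_f_def gieseker_psi_def by (rule linear_linear_extension)+

lemma sum_Sigma_addable:
  fixes g :: "'r::finite \<times> nat \<Rightarrow> 'a::comm_monoid_add"
  shows "(\<Sum>l\<in>UNIV. \<Sum>j\<in>addable (M l). g (l, j)) = (\<Sum>b\<in>addables M. g b)"
    "(\<Sum>l\<in>UNIV. \<Sum>j\<in>removable (M l). g (l, j)) = (\<Sum>b\<in>removables M. g b)"
  unfolding addables_def removables_def by (subst sum.Sigma; simp add: finite_addable finite_removable split_def)+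

lemma gieseker_e_ket: "gieseker_e p (ket M) = (\<Sum>b\<in>addables M. vscale (indets.coords M b ^ p * gieseker_amplitude M b) (ket (add_at M b)))"
proof -
  obtain N where N: "\<And>a. num_rows (M a) + 3 < N" using rows_bound[of M] by blast
  have N0: "num_rows (M a) < N" for a using N[of a] by simp
  have "gieseker_e p (ket M) = (\<Sum>l\<in>UNIV. \<Sum>j\<in>addable (M l).
      vscale (gieseker_e_coeff p (add_at M (l, j)) (fst (l, j)) (snd (l, j))) (ket (add_at M (l, j))))"
    by (simp add: gieseker_e_def linear_extension_ket Let_def add_at_def)
  also have "\<dots> = (\<Sum>b\<in>addables M. vscale (gieseker_e_coeff p (add_at M b) (fst b) (snd b)) (ket (add_at M b)))"
    by (rule sum_Sigma_addable)
  finally show ?thesis by (simp add: gieseker_e_coeff_amplitude[OF _ N0])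
qed

lemma fock_e_ket: "fock_tensor_e s1 s2 (\<lambda>a. - xvar a) p (ket M) =
  (\<Sum>b\<in>addables M. vscale (indets.coords M b ^ p * fock_amplitude M b) (ket (add_at M b)))"
proof -
  obtain N where N: "\<And>a. num_rows (M a) + 3 < N" using rows_bound[of M] by blast
  have N0: "num_rows (M a) < N" for a using N[of a] by simp
  let ?m = "\<lambda>b. mode
     (fps_const (\<Prod>l\<in>{..<fst b}. gamma s1 s2 (M l) (- xvar l) (fock_e_point s1 s2 (- xvar (fst b)) (M (fst b)) (snd b))) *
      fock_e_series s1 s2 (- xvar (fst b)) (M (fst b)) (snd b)) p"
  have "fock_tensor_e s1 s2 (\<lambda>a. - xvar a) p (ket M) = (\<Sum>l\<in>UNIV. \<Sum>j\<in>addable (M l). vscale (?m (l, j)) (ket (add_at M (l, j))))"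
    unfolding fock_tensor_e_def linear_extension_ket add_at_def fst_conv snd_conv ..
  also have "\<dots> = (\<Sum>b\<in>addables M. vscale (?m b) (ket (add_at M b)))"
    by (rule sum_Sigma_addable)
  also have "\<dots> = (\<Sum>b\<in>addables M. vscale (indets.coords M b ^ p * fock_amplitude M b) (ket (add_at M b)))"
  proof (rule sum.cong[OF refl])
    fix b assume b: "b \<in> addables M"
    show "vscale (?m b) (ket (add_at M b)) = vscale (indets.coords M b ^ p * fock_amplitude M b) (ket (add_at M b))"
      unfolding fock_e_amplitude[OF b N0] ..
  qed
  finally show ?thesis .
qed

lemma gieseker_f_ket: "gieseker_f p (ket \<Lambda>) =
  (\<Sum>b\<in>removables \<Lambda>. vscale (gieseker_f_coeff p (remove_at \<Lambda> b) (fst b) (snd b)) (ket (remove_at \<Lambda> b)))"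
proof -
  have "gieseker_f p (ket \<Lambda>) = (\<Sum>l\<in>UNIV. \<Sum>j\<in>removable (\<Lambda> l).
      vscale (gieseker_f_coeff p (remove_at \<Lambda> (l, j)) (fst (l, j)) (snd (l, j))) (ket (remove_at \<Lambda> (l, j))))"
    by (simp add: gieseker_f_def linear_extension_ket Let_def remove_at_def)
  also have "\<dots> = (\<Sum>b\<in>removables \<Lambda>. vscale (gieseker_f_coeff p (remove_at \<Lambda> b) (fst b) (snd b)) (ket (remove_at \<Lambda> b)))"
    by (rule sum_Sigma_addable)
  finally show ?thesis .
qed

lemma fock_f_ket: "fock_tensor_f s1 s2 (\<lambda>a. - xvar a) p (ket \<Lambda>) =
  (\<Sum>b\<in>removables \<Lambda>. vscale (fock_f_amplitude p \<Lambda> b) (ket (remove_at \<Lambda> b)))"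
proof -
  have "fock_tensor_f s1 s2 (\<lambda>a. - xvar a) p (ket \<Lambda>) =
      (\<Sum>l\<in>UNIV. \<Sum>j\<in>removable (\<Lambda> l). vscale (fock_f_amplitude p \<Lambda> (l, j)) (ket (remove_at \<Lambda> (l, j))))"
    unfolding fock_tensor_f_def linear_extension_ket remove_at_def fock_f_amplitude_def fst_conv snd_conv ..
  also have "\<dots> = (\<Sum>b\<in>removables \<Lambda>. vscale (fock_f_amplitude p \<Lambda> b) (ket (remove_at \<Lambda> b)))"
    by (rule sum_Sigma_addable)
  finally show ?thesis .
qed

lemma rescaling_intertwines_e:
  "rescaling_map rescaling (gieseker_e p v) = fock_tensor_e s1 s2 (\<lambda>a. - xvar a) p (rescaling_map rescaling v)"
proof (rule linear_eq_on_kets[OF linear_comp[OF linear_rescaling_map linear_gieseker(1)] linear_comp[OF linear_fock_tensor(1) linear_rescaling_map]])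
  fix M :: "'a \<Rightarrow> young"
  show "rescaling_map rescaling (gieseker_e p (ket M)) = fock_tensor_e s1 s2 (\<lambda>a. - xvar a) p (rescaling_map rescaling (ket M))"
    unfolding gieseker_e_ket rescaling_map_ket linear_vscale[OF linear_fock_tensor(1)] fock_e_ket
      linear_vscale_sum[OF linear_rescaling_map] vscale_sum_right vscale_vscale
  proof (rule sum.cong[OF refl])
    fix b assume b: "b \<in> addables M"
    have "gieseker_amplitude M b * rescaling (add_at M b) = rescaling M * fock_amplitude M b"
      using amplitudes_nz[OF b] by (simp add: rescaling_add_at[OF b] amplitude_ratio_def)
    then have "indets.coords M b ^ p * gieseker_amplitude M b * rescaling (add_at M b) =
       rescaling M * (indets.coords M b ^ p * fock_amplitude M b)"
      by (simp only: mult.assoc mult.left_commute)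
    then show "vscale (indets.coords M b ^ p * gieseker_amplitude M b * rescaling (add_at M b)) (ket (add_at M b)) =
      vscale (rescaling M * (indets.coords M b ^ p * fock_amplitude M b)) (ket (add_at M b))" by (simp only:)
  qed
qed

lemma cross_multiply:
  fixes g g' f f' r R :: "'k::field"
  assumes "g * g' = f * f'" "R = f / g * r" "g \<noteq> 0"
  shows "g' * r = R * f'"
proof -
  have "R * g = f * r" using assms(2,3) by simp
  then have "g * (g' * r) = g * (R * f')" using assms(1) by algebra
  then show ?thesis using assms(3) by simp
qed

lemma rescaling_intertwines_f:
  "rescaling_map rescaling (gieseker_f p v) = fock_tensor_f s1 s2 (\<lambda>a. - xvar a) p (rescaling_map rescaling v)"
proof (rule linear_eq_on_kets[OF linear_comp[OF linear_rescaling_map linear_gieseker(2)] linear_comp[OF linear_fock_tensor(2) linear_rescaling_map]])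
  fix \<Lambda> :: "'a \<Rightarrow> young"
  show "rescaling_map rescaling (gieseker_f p (ket \<Lambda>)) = fock_tensor_f s1 s2 (\<lambda>a. - xvar a) p (rescaling_map rescaling (ket \<Lambda>))"
    unfolding gieseker_f_ket rescaling_map_ket linear_vscale[OF linear_fock_tensor(2)] fock_f_ket
      linear_vscale_sum[OF linear_rescaling_map] vscale_sum_right vscale_vscale
  proof (rule sum.cong[OF refl])
    fix b assume r: "b \<in> removables \<Lambda>"
    let ?M = "remove_at \<Lambda> b"
    note b = removed_box[OF r]
    have "gieseker_amplitude ?M b * gieseker_f_coeff p ?M (fst b) (snd b) = fock_amplitude ?M b * fock_f_amplitude p \<Lambda> b"
      using amplitude_products[OF b(1), of p] unfolding b(2) .
    moreover have "rescaling \<Lambda> = fock_amplitude ?M b / gieseker_amplitude ?M b * rescaling ?M"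
      using rescaling_add_at[OF b(1)] unfolding b(2) amplitude_ratio_def .
    ultimately have "gieseker_f_coeff p ?M (fst b) (snd b) * rescaling ?M = rescaling \<Lambda> * fock_f_amplitude p \<Lambda> b"
      using amplitudes_nz(1)[OF b(1)] by (rule cross_multiply)
    then show "vscale (gieseker_f_coeff p ?M (fst b) (snd b) * rescaling ?M) (ket ?M) = vscale (rescaling \<Lambda> * fock_f_amplitude p \<Lambda> b) (ket ?M)"
      by (simp only:)
  qed
qed

lemma rescaling_intertwines_psi:
  "rescaling_map rescaling (gieseker_psi p v) = fock_tensor_psi s1 s2 (\<lambda>a. - xvar a) p (rescaling_map rescaling v)"
proof -
  let ?P = "fock_tensor_psi s1 s2 (\<lambda>a. - xvar a) p"
  have "rescaling_map rescaling (?P (ket \<Lambda>)) = ?P (rescaling_map rescaling (ket \<Lambda>))" for \<Lambda>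
  proof -
    have "\<exists>t. ?P (ket \<Lambda>) = vscale t (ket \<Lambda>)"
      unfolding fock_tensor_psi_def linear_extension_ket by (rule exI) (rule refl)
    then obtain t where t: "?P (ket \<Lambda>) = vscale t (ket \<Lambda>)" ..
    show ?thesis
      unfolding t rescaling_map_ket linear_vscale[OF linear_fock_tensor(3)] linear_vscale[OF linear_rescaling_map] vscale_vscale
      by (simp only: mult.commute[of t])
  qed
  from linear_eq_on_kets[OF linear_comp[OF linear_rescaling_map linear_fock_tensor(3)] linear_comp[OF linear_fock_tensor(3) linear_rescaling_map] this]
  show ?thesis unfolding gieseker_psi_eq_fock_psi .
qed

text \<open>
  The coefficients of \<open>e\<^sub>0\<close> do not vanish, so that compatibility with \<open>e\<^sub>0\<close> determines the constants box by box.
\<close>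

lemma rescaling_unique:
  fixes c :: "'r::{finite,linorder} fixed_point \<Rightarrow> 'r ratfun"
  assumes "c (\<lambda>_. empty_young) = 1"
    and e: "\<And>v. rescaling_map c (gieseker_e 0 v) = fock_tensor_e s1 s2 (\<lambda>a. - xvar a) 0 (rescaling_map c v)"
  shows "c = rescaling"
proof
  fix \<Lambda>
  show "c \<Lambda> = rescaling \<Lambda>"
  proof (induction \<Lambda> rule: fixed_point_induct)
    case empty
    then show ?case using assms(1) by (simp add: rescaling_empty)
  next
    case (add M b)
    have coeff: "lookup (\<Sum>b'\<in>addables M. vscale (g b') (ket (add_at M b'))) (add_at M b) = g b" for g
    proof -
      have "lookup (\<Sum>b'\<in>addables M. vscale (g b') (ket (add_at M b'))) (add_at M b) =
        (\<Sum>b'\<in>addables M. if b' = b then g b' else 0)"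
        unfolding lookup_sum
      proof (rule sum.cong[OF refl])
        fix b' assume "b' \<in> addables M"
        then show "lookup (vscale (g b') (ket (add_at M b'))) (add_at M b) = (if b' = b then g b' else 0)"
          using add_at_inj[of b' M b] add.hyps by (auto simp: ket_def lookup_single when_def)
      qed
      then show ?thesis using add.hyps finite_addables(1)[of M] by simp
    qed
    have "gieseker_amplitude M b * c (add_at M b) = lookup (rescaling_map c (gieseker_e 0 (ket M))) (add_at M b)"
      unfolding gieseker_e_ket linear_vscale_sum[OF linear_rescaling_map] rescaling_map_ket vscale_vscale coeff by simp
    also have "\<dots> = c M * fock_amplitude M b"
      unfolding e rescaling_map_ket linear_vscale[OF linear_fock_tensor(1)] fock_e_ket vscale_sum_right vscale_vscale coeff by simp
    finally have "gieseker_amplitude M b * c (add_at M b) = c M * fock_amplitude M b" .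
    then show ?case
      using amplitudes_nz(1)[OF add.hyps] by (simp add: rescaling_add_at[OF add.hyps] amplitude_ratio_def add.IH[symmetric] field_simps)
  qed
qed

text \<open>
  The representation on the fixed point basis is obtained by transport of structure along the rescaling map: this
  map intertwines the operators on the tensor product with the given ones, so the transported action is given by the latter.
\<close>

theorem theorem4p9:
  shows "\<exists>!c :: 'r::{finite,linorder} fixed_point \<Rightarrow> 'r ratfun.
    c (\<lambda>_. empty_young) = 1 \<and>
    (\<exists>\<rho>V \<rho>F.
       yangian_rep_given_by gieseker_e gieseker_f gieseker_psi \<rho>V \<and>
       yangian_rep_given_by
         (fock_tensor_e s1 s2 (\<lambda>a. - xvar a))
         (fock_tensor_f s1 s2 (\<lambda>a. - xvar a))
         (fock_tensor_psi s1 s2 (\<lambda>a. - xvar a)) \<rho>F \<and>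
       yangian_rep_iso \<rho>V \<rho>F (rescaling_map c))"
proof (rule ex1I[of _ rescaling])
  interpret yangian_action "fock_tensor_e s1 s2 (\<lambda>a. - xvar a)" "fock_tensor_f s1 s2 (\<lambda>a. - xvar a)"
      "fock_tensor_psi s1 s2 (\<lambda>a :: 'r. - xvar a :: 'r ratfun)"
    by (rule yangian_action_fock)
  let ?F = yangian_operator
  let ?\<phi> = "rescaling_map rescaling :: 'r gieseker_space \<Rightarrow> _"
  let ?\<phi>' = "rescaling_map (\<lambda>\<Lambda>. 1 / rescaling \<Lambda>) :: _ \<Rightarrow> 'r gieseker_space"
  note inverse = rescaling_map_inverse[of rescaling, OF rescaling_nz]
  note F = yangian_operator_rep
  have linF: "linear_op (?F y)" for y
    using F unfolding yangian_rep_given_by_def yangian_rep_def by blast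
  define V where "V = (\<lambda>y v. ?\<phi>' (?F y (?\<phi> v)))"
  have gens: "V (yangian_gen (GenE j)) = gieseker_e j" "V (yangian_gen (GenF j)) = gieseker_f j"
    "V (yangian_gen (GenPsi j)) = gieseker_psi j" for j
  proof -
    have F: "?F (yangian_gen (GenE j)) = fock_tensor_e s1 s2 (\<lambda>a. - xvar a) j"
      "?F (yangian_gen (GenF j)) = fock_tensor_f s1 s2 (\<lambda>a. - xvar a) j"
      "?F (yangian_gen (GenPsi j)) = fock_tensor_psi s1 s2 (\<lambda>a. - xvar a) j"
      using F unfolding yangian_rep_given_by_def by blast+
    show "V (yangian_gen (GenE j)) = gieseker_e j" "V (yangian_gen (GenF j)) = gieseker_f j"
      "V (yangian_gen (GenPsi j)) = gieseker_psi j"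
      unfolding V_def F by (rule ext, simp only: inverse flip: rescaling_intertwines_e rescaling_intertwines_f rescaling_intertwines_psi)+
  qed
  have Vrep: "yangian_rep V"
  proof -
    have lin: "linear_op (V y)" for y
      unfolding V_def by (rule linear_comp[OF linear_rescaling_map linear_comp[OF linF linear_rescaling_map]])
    have Fprops: "?F (y + z) v = ?F y v + ?F z v" "?F (yangian_scale t y) v = vscale t (?F y v)"
      "?F (y * z) v = ?F y (?F z v)" "?F 1 v = v" for y z t v
      using F unfolding yangian_rep_given_by_def yangian_rep_def by blast+
    have "?\<phi>' (v + w) = ?\<phi>' v + ?\<phi>' w" for v w
      using linear_rescaling_map[of "\<lambda>\<Lambda>. 1 / rescaling \<Lambda> :: 'r ratfun"] unfolding Vector_Spaces.linear_iff by blast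
    then show ?thesis
      unfolding yangian_rep_def using lin
      by (simp add: V_def Fprops linear_vscale[OF linear_rescaling_map] inverse)
  qed
  have Frep: "yangian_rep ?F" using F unfolding yangian_rep_given_by_def by blast
  have "bij ?\<phi>" by (rule bij_betw_byWitness[where f' = ?\<phi>']) (simp_all add: inverse)
  then have iso: "yangian_rep_iso V ?F ?\<phi>"
    unfolding yangian_rep_iso_def using Vrep Frep linear_rescaling_map by (simp add: V_def inverse)
  have Vgiven: "yangian_rep_given_by gieseker_e gieseker_f gieseker_psi V"
    unfolding yangian_rep_given_by_def using Vrep gens by blast
  show "(rescaling :: 'r fixed_point \<Rightarrow> 'r ratfun) (\<lambda>_. empty_young) = 1 \<and>
    (\<exists>\<rho>V \<rho>F.
       yangian_rep_given_by gieseker_e gieseker_f gieseker_psi \<rho>V \<and>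
       yangian_rep_given_by
         (fock_tensor_e s1 s2 (\<lambda>a. - xvar a))
         (fock_tensor_f s1 s2 (\<lambda>a. - xvar a))
         (fock_tensor_psi s1 s2 (\<lambda>a. - xvar a)) \<rho>F \<and>
       yangian_rep_iso \<rho>V \<rho>F (rescaling_map (rescaling :: 'r fixed_point \<Rightarrow> 'r ratfun)))"
    by (intro conjI exI[of _ V] exI[of _ ?F]) (rule rescaling_empty Vgiven F iso)+
next
  fix c :: "'r fixed_point \<Rightarrow> 'r ratfun"
  assume c: "c (\<lambda>_. empty_young) = 1 \<and>
    (\<exists>\<rho>V \<rho>F.
       yangian_rep_given_by gieseker_e gieseker_f gieseker_psi \<rho>V \<and>
       yangian_rep_given_by
         (fock_tensor_e s1 s2 (\<lambda>a. - xvar a))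
         (fock_tensor_f s1 s2 (\<lambda>a. - xvar a))
         (fock_tensor_psi s1 s2 (\<lambda>a. - xvar a)) \<rho>F \<and>
       yangian_rep_iso \<rho>V \<rho>F (rescaling_map c))"
  then obtain \<rho>V \<rho>F where V: "yangian_rep_given_by gieseker_e gieseker_f gieseker_psi \<rho>V"
    and F: "yangian_rep_given_by (fock_tensor_e s1 s2 (\<lambda>a. - xvar a)) (fock_tensor_f s1 s2 (\<lambda>a. - xvar a))
         (fock_tensor_psi s1 s2 (\<lambda>a. - xvar a)) \<rho>F"
    and iso: "yangian_rep_iso \<rho>V \<rho>F (rescaling_map c)" by blast
  have "\<rho>V (yangian_gen (GenE 0)) = gieseker_e 0" using V unfolding yangian_rep_given_by_def by blast
  moreover have "\<rho>F (yangian_gen (GenE 0)) = fock_tensor_e s1 s2 (\<lambda>a. - xvar a) 0"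
    using F unfolding yangian_rep_given_by_def by blast
  moreover have "rescaling_map c (\<rho>V (yangian_gen (GenE 0)) v) = \<rho>F (yangian_gen (GenE 0)) (rescaling_map c v)" for v
    using iso unfolding yangian_rep_iso_def by blast
  ultimately show "c = rescaling" using c by (intro rescaling_unique) simp_all
qed

end
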